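(* Let $d\ge2$ and let $X=(X_j)_{j\in\mathbb{Z}^d}$ be a stationary Gaussian field with $\mathbb{E}[X_o]=0$, $\mathbb{E}[X_o^2]=1$ and covariance $\rho(u)=\mathbb{E}[X_oX_u]$, $u\in\mathbb{Z}^d$, where $o$ denotes the origin. Let $H:\mathbb{R}\to\mathbb{R}$ be a measurable function with $\operatorname{Var}[H(X_o)]<\infty$ and $\mathbb{E}[H(X_o)]=0$, with Hermite expansion $H=\sum_{q=m}^\infty c_qH_q$ and Hermite rank $m\ge1$, and suppose that $\sum_{u\in\mathbb{Z}^d}|\rho(u)|^m<\infty$. For $N\ge2$ let $\Phi_N$ be the random distribution on $D=[-1/2,1/2]^d$ given by $$\langle\Phi_N,f\rangle=N^{-d}\sum_{j\in B_N}H(X_j)\,f\!\left(\tfrac{j}{N}\right).$$ Then for every $\alpha>d/2$, $$\sup_{N}\ \mathbb{E}\Big[\big\|N^{d/2}\Phi_N\big\|_{\mathcal{H}^{-\alpha}(D)}^2\Big]<\infty .$$ In particular, for every $\alpha>d/2$ the sequence $(N^{d/2}\Phi_N)_N$ is tight in $\mathcal{H}^{-\alpha}(D)$, and the constant $C_m=\sum_{q=m}^\infty q!\,c_q^2\sum_{u\in\mathbb{Z}^d}\rho(u)^q$ is finite.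
   Context: $B_N=\{j\in\mathbb{Z}^d:|j|\le N/2\}$ is the box of size $N$ centered at the origin, with $|\cdot|$ the sup norm, so that $j/N\in D$ for $j\in B_N$. $(H_q)_{q\ge0}$ are the (probabilists') Hermite polynomials, normalized so that $\mathbb{E}[H_q(Y)H_q(Z)]=q!\,\mathbb{E}[YZ]^q$ for jointly Gaussian centered unit-variance $Y,Z$. The Hermite expansion converges in $L^2$ of the standard Gaussian measure. The Hermite rank $m$ of $H$ is the smallest $q\ge1$ with $c_q\ne0$. $\{\varphi_k\}_{k\ge1}$ is an orthonormal basis of $L^2(D)$ of eigenfunctions of $-\Delta$ on $D$ with zero (Dirichlet) boundary condition, with eigenvalues $\{\lambda_k\}_{k\ge1}$. For $\alpha>0$, $$\mathcal{H}^\alpha(D)=\Big\{u=\sum_{k\ge1}u_k\varphi_k:\ \sum_{k\ge1}(1+\lambda_k)^\alpha|u_k|^2<\infty\Big\},$$ and $\mathcal{H}^{-\alpha}(D)$ is its dual, with squared norm $\|\Phi\|_{\mathcal{H}^{-\alpha}}^2=\sum_{k\ge1}(1+\lambda_k)^{-\alpha}|\langle\Phi,\varphi_k\rangle|^2$. For $\alpha>d/2$ elements of $\mathcal{H}^\alpha(D)$ are identified with their continuous representatives. *)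

theory Defs
  imports "HOL-Probability.Probability"
begin

section \<open>Stationary Gaussian fields on the lattice\<close>

text \<open>The lattice of dimension \<open>d = CARD('n)\<close> is the type \<^typ>\<open>int ^ 'n\<close>.\<close>

text \<open>Constants count as (degenerate) Gaussian variables.\<close>

definition gaussian_var :: "'w measure \<Rightarrow> ('w \<Rightarrow> real) \<Rightarrow> bool" where
  "gaussian_var M Y \<longleftrightarrow>
     (\<exists>\<mu>. AE \<omega> in M. Y \<omega> = \<mu>) \<or>
     (\<exists>\<mu> \<sigma>. \<sigma> > 0 \<and> distributed M lborel Y (\<lambda>x. ennreal (normal_density \<mu> \<sigma> x)))"

definition gaussian_field :: "'w measure \<Rightarrow> ('i \<Rightarrow> 'w \<Rightarrow> real) \<Rightarrow> bool" where
  "gaussian_field M X \<longleftrightarrow>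
     (\<forall>j. X j \<in> borel_measurable M) \<and>
     (\<forall>J a. finite J \<longrightarrow> gaussian_var M (\<lambda>\<omega>. \<Sum>j\<in>J. a j * X j \<omega>))"

definition stationary_field :: "'w measure \<Rightarrow> (int ^ 'n \<Rightarrow> 'w \<Rightarrow> real) \<Rightarrow> bool" where
  "stationary_field M X \<longleftrightarrow>
     (\<forall>v. distr M (Pi\<^sub>M UNIV (\<lambda>_. borel)) (\<lambda>\<omega> j. X (j + v) \<omega>) =
          distr M (Pi\<^sub>M UNIV (\<lambda>_. borel)) (\<lambda>\<omega> j. X j \<omega>))"

section \<open>Hermite expansions\<close>

text \<open>Probabilists' Hermite polynomials.\<close>

fun hermite :: "nat \<Rightarrow> real \<Rightarrow> real" where
  "hermite 0 x = 1"
| "hermite (Suc 0) x = x"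
| "hermite (Suc (Suc q)) x = x * hermite (Suc q) x - real (Suc q) * hermite q x"

text \<open>\<open>H = (\<Sum>q. c q * hermite q)\<close>, with convergence in \<open>L\<^sup>2\<close> of the standard Gaussian measure.\<close>

definition hermite_expansion :: "(real \<Rightarrow> real) \<Rightarrow> (nat \<Rightarrow> real) \<Rightarrow> bool" where
  "hermite_expansion H c \<longleftrightarrow>
     (\<lambda>n. \<integral>\<^sup>+x. ennreal ((H x - (\<Sum>q\<le>n. c q * hermite q x))\<^sup>2)
             \<partial>density lborel (\<lambda>x. ennreal (std_normal_density x))) \<longlonglongrightarrow> 0"

definition hermite_rank :: "(nat \<Rightarrow> real) \<Rightarrow> nat \<Rightarrow> bool" where
  "hermite_rank c m \<longleftrightarrow> 1 \<le> m \<and> c m \<noteq> 0 \<and> (\<forall>q. 1 \<le> q \<and> q < m \<longrightarrow> c q = 0)"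

section \<open>Dirichlet eigenbases of the unit cube\<close>

definition unit_cube :: "(real ^ 'n) set" where
  "unit_cube = cbox (\<chi> i. - 1 / 2) (\<chi> i. 1 / 2)"

definition cube_inner :: "(real ^ 'n \<Rightarrow> real) \<Rightarrow> (real ^ 'n \<Rightarrow> real) \<Rightarrow> real" where
  "cube_inner f g = (LINT x:unit_cube|lborel. f x * g x)"

definition cube_L2 :: "(real ^ 'n \<Rightarrow> real) set" where
  "cube_L2 = {f. set_borel_measurable lborel unit_cube f \<and>
                 set_integrable lborel unit_cube (\<lambda>x. (f x)\<^sup>2)}"

text \<open>
  \<open>f\<close> is twice continuously differentiable on the closed cube with gradient \<open>g\<close> and Hessian \<open>h\<close>;
  its Laplacian is then the trace of \<open>h\<close>. Dirichlet eigenfunctions of a cube have this regularity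
  up to the boundary, so nothing is lost by using classical derivatives.
\<close>

definition dirichlet_eigenfunction :: "(real ^ 'n \<Rightarrow> real) \<Rightarrow> real \<Rightarrow> bool" where
  "dirichlet_eigenfunction f l \<longleftrightarrow>
     (\<exists>(g :: real ^ 'n \<Rightarrow> real ^ 'n) (h :: real ^ 'n \<Rightarrow> real ^ 'n ^ 'n).
        (\<forall>x\<in>unit_cube. (f has_derivative (\<lambda>v. g x \<bullet> v)) (at x within unit_cube)) \<and>
        (\<forall>x\<in>unit_cube. (g has_derivative (\<lambda>v. h x *v v)) (at x within unit_cube)) \<and>
        continuous_on unit_cube h \<and>
        (\<forall>x\<in>interior unit_cube. - trace (h x) = l * f x)) \<and>
     (\<forall>x\<in>frontier unit_cube. f x = 0) \<and>
     (\<exists>x\<in>unit_cube. f x \<noteq> 0)"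

definition dirichlet_eigenbasis :: "(nat \<Rightarrow> real ^ 'n \<Rightarrow> real) \<Rightarrow> (nat \<Rightarrow> real) \<Rightarrow> bool" where
  "dirichlet_eigenbasis \<phi> lam \<longleftrightarrow>
     (\<forall>k. dirichlet_eigenfunction (\<phi> k) (lam k)) \<and>
     (\<forall>k l. cube_inner (\<phi> k) (\<phi> l) = (if k = l then 1 else 0)) \<and>
     (\<forall>f\<in>cube_L2.
        (\<lambda>n. LINT x:unit_cube|lborel. (f x - (\<Sum>k<n. cube_inner f (\<phi> k) * \<phi> k x))\<^sup>2)
          \<longlonglongrightarrow> 0)"

section \<open>The spaces \<open>\<H>\<^sup>\<alpha>\<close> and their duals\<close>

definition sobolev_norm2 ::
    "(nat \<Rightarrow> real ^ 'n \<Rightarrow> real) \<Rightarrow> (nat \<Rightarrow> real) \<Rightarrow> real \<Rightarrow> (real ^ 'n \<Rightarrow> real) \<Rightarrow> ennreal" where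
  "sobolev_norm2 \<phi> lam \<alpha> f =
     (\<Sum>k. ennreal ((1 + lam k) powr \<alpha> * (cube_inner f (\<phi> k))\<^sup>2))"

text \<open>
  For \<open>\<alpha> > d / 2\<close>, the only range used, every element of the space has a unique
  continuous representative on the cube; the carrier consists of these. Values outside the cube
  are irrelevant: functions that agree on the cube are at distance 0, so the bounded
  linear functionals below do not separate them.
\<close>

definition sobolev ::
    "(nat \<Rightarrow> real ^ 'n \<Rightarrow> real) \<Rightarrow> (nat \<Rightarrow> real) \<Rightarrow> real \<Rightarrow> (real ^ 'n \<Rightarrow> real) set" where
  "sobolev \<phi> lam \<alpha> = {f. continuous_on unit_cube f \<and> sobolev_norm2 \<phi> lam \<alpha> f < \<infinity>}"

definition sobolev_dual ::
    "(nat \<Rightarrow> real ^ 'n \<Rightarrow> real) \<Rightarrow> (nat \<Rightarrow> real) \<Rightarrow> real \<Rightarrow> ((real ^ 'n \<Rightarrow> real) \<Rightarrow> real) set" where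
  "sobolev_dual \<phi> lam \<alpha> =
     {\<Phi> \<in> extensional (sobolev \<phi> lam \<alpha>).
        (\<forall>f\<in>sobolev \<phi> lam \<alpha>. \<forall>g\<in>sobolev \<phi> lam \<alpha>. \<forall>a b.
            \<Phi> (\<lambda>x. a * f x + b * g x) = a * \<Phi> f + b * \<Phi> g) \<and>
        (\<exists>B. \<forall>f\<in>sobolev \<phi> lam \<alpha>.
            \<bar>\<Phi> f\<bar> \<le> B * sqrt (enn2real (sobolev_norm2 \<phi> lam \<alpha> f)))}"

definition dual_norm2 ::
    "(nat \<Rightarrow> real ^ 'n \<Rightarrow> real) \<Rightarrow> (nat \<Rightarrow> real) \<Rightarrow> real \<Rightarrow> ((real ^ 'n \<Rightarrow> real) \<Rightarrow> real) \<Rightarrow> ennreal" where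
  "dual_norm2 \<phi> lam \<alpha> \<Phi> = (\<Sum>k. ennreal ((1 + lam k) powr (- \<alpha>) * (\<Phi> (\<phi> k))\<^sup>2))"

definition dual_dist ::
    "(nat \<Rightarrow> real ^ 'n \<Rightarrow> real) \<Rightarrow> (nat \<Rightarrow> real) \<Rightarrow> real \<Rightarrow>
     ((real ^ 'n \<Rightarrow> real) \<Rightarrow> real) \<Rightarrow> ((real ^ 'n \<Rightarrow> real) \<Rightarrow> real) \<Rightarrow> real" where
  "dual_dist \<phi> lam \<alpha> \<Phi> \<Psi> = sqrt (enn2real (dual_norm2 \<phi> lam \<alpha> (\<lambda>f. \<Phi> f - \<Psi> f)))"

definition dual_topology ::
    "(nat \<Rightarrow> real ^ 'n \<Rightarrow> real) \<Rightarrow> (nat \<Rightarrow> real) \<Rightarrow> real \<Rightarrow> ((real ^ 'n \<Rightarrow> real) \<Rightarrow> real) topology" where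
  "dual_topology \<phi> lam \<alpha> = Metric_space.mtopology (sobolev_dual \<phi> lam \<alpha>) (dual_dist \<phi> lam \<alpha>)"

section \<open>Tightness\<close>

text \<open>
  A tight family \<open>(Y N)\<close>, \<open>N \<in> I\<close>, of random elements of the space \<open>T\<close>, i.e. of maps that are
  measurable for the Borel sigma algebra of \<open>T\<close>.
\<close>

definition tight_family ::
    "'a topology \<Rightarrow> 'w measure \<Rightarrow> 'i set \<Rightarrow> ('i \<Rightarrow> 'w \<Rightarrow> 'a) \<Rightarrow> bool" where
  "tight_family T M I Y \<longleftrightarrow>
     (\<forall>N\<in>I. Y N \<in> measurable M (sigma (topspace T) {U. openin T U})) \<and>
     (\<forall>\<epsilon>>0. \<exists>K. compactin T K \<and>
        (\<forall>N\<in>I. measure M {\<omega> \<in> space M. Y N \<omega> \<in> K} \<ge> 1 - \<epsilon>))"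

section \<open>The random distributions\<close>

definition lattice_box :: "nat \<Rightarrow> (int ^ 'n) set" where
  "lattice_box N = {j. \<forall>i. \<bar>real_of_int (j $ i)\<bar> \<le> real N / 2}"

definition random_distribution ::
    "(real \<Rightarrow> real) \<Rightarrow> (int ^ 'n \<Rightarrow> 'w \<Rightarrow> real) \<Rightarrow> nat \<Rightarrow> 'w \<Rightarrow> (real ^ 'n \<Rightarrow> real) \<Rightarrow> real" where
  "random_distribution H X N \<omega> f =
     (1 / real N ^ CARD('n)) *
     (\<Sum>j\<in>lattice_box N. H (X j \<omega>) * f (\<chi> i. real_of_int (j $ i) / real N))"

text \<open>\<open>N\<^bsup>d/2\<^esup> \<Phi>\<^sub>N\<close> as a functional on \<^term>\<open>sobolev \<phi> lam \<alpha>\<close>.\<close>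

definition scaled_distribution ::
    "(nat \<Rightarrow> real ^ 'n \<Rightarrow> real) \<Rightarrow> (nat \<Rightarrow> real) \<Rightarrow> real \<Rightarrow>
     (real \<Rightarrow> real) \<Rightarrow> (int ^ 'n \<Rightarrow> 'w \<Rightarrow> real) \<Rightarrow> nat \<Rightarrow> 'w \<Rightarrow> (real ^ 'n \<Rightarrow> real) \<Rightarrow> real" where
  "scaled_distribution \<phi> lam \<alpha> H X N \<omega> =
     restrict (\<lambda>f. real N powr (real CARD('n) / 2) * random_distribution H X N \<omega> f)
              (sobolev \<phi> lam \<alpha>)"

end

theory Submission
  imports Defs
begin

text \<open>
  Every Dirichlet eigenfunction of the cube is a finite combination of products of sines with the
  same eigenvalue, because these products are complete among the continuous functions. By Bessel's
  inequality, \<open>\<Sum>\<^sub>k (1 + \<lambda>\<^sub>k)\<^bsup>-\<alpha>\<^esup> \<phi>\<^sub>k(x)\<^sup>2\<close> is then at most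
  \<open>2\<^sup>d \<Sum>\<^sub>n (1 + \<pi>\<^sup>2|n|\<^sup>2)\<^bsup>-\<alpha>\<^esup>\<close>, uniformly in \<open>x\<close> and finite for \<open>\<alpha> > d / 2\<close>. Gaussian
  integration by parts gives the orthogonality of the Hermite polynomials of correlated Gaussian
  variables, hence \<open>|Cov(H(X\<^sub>j), H(X\<^sub>k))| \<le> |\<rho>(k - j)|\<^sup>m Var H(X\<^sub>o)\<close>, and the summability of
  \<open>|\<rho>|\<^sup>m\<close> bounds the second moment of \<open>\<Sum>\<^sub>j a\<^sub>j H(X\<^sub>j)\<close> by a multiple of \<open>\<Sum>\<^sub>j a\<^sub>j\<^sup>2\<close>. Applied to
  \<open>a\<^sub>j = \<phi>\<^sub>k(j/N)\<close> and summed over \<open>k\<close>, this is the moment bound. Tightness follows from it with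
  some \<open>\<alpha>' < \<alpha>\<close> in place of \<open>\<alpha>\<close>, since balls of \<open>\<H>\<^bsup>-\<alpha>'\<^esup>\<close> are compact in \<open>\<H>\<^bsup>-\<alpha>\<^esup>\<close>.
\<close>

section \<open>Products of sines on the cube\<close>

text \<open>The basis is arbitrary within the eigenspaces, and multiplicities of eigenvalues are
  unbounded for d \<ge> 2, so a single \<phi>_k need not be bounded uniformly in k. What does not
  depend on the choice of basis is the weighted sum of the \<phi>_k(x)^2. It is the squared dual
  norm of the evaluation at x; bounding it replaces both a sup bound on eigenfunctions and a count
  of eigenvalues with multiplicity. The same constant makes evaluations continuous, so that the
  point sums belong to the dual space at all. The pairs of Gaussian variables include (X_j, X_j), so
  a joint density need not exist. Joint normality is used only through the linear combinations sY +
  Z: mixed moments are recovered from one-dimensional moments by comparing coefficients of powers of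
  s. A moment bound alone confines the functionals to balls, which are not compact for their own
  norm. The room between d/2 and \<alpha> is what supplies \<alpha>'.\<close>

abbreviation shift :: "real ^ 'n \<Rightarrow> 'n \<Rightarrow> real \<Rightarrow> real ^ 'n" where
  "shift x i t \<equiv> x + t *\<^sub>R axis i 1"

lemma mem_unit_cube: "x \<in> unit_cube \<longleftrightarrow> (\<forall>i. \<bar>x $ i\<bar> \<le> 1 / 2)"
proof -
  have "- 1 / 2 \<le> r \<and> r \<le> 1 / 2 \<longleftrightarrow> \<bar>r\<bar> \<le> 1 / 2" for r :: real by auto
  then show ?thesis by (simp add: unit_cube_def mem_box_cart)
qed

lemma mem_interior_unit_cube: "x \<in> interior unit_cube \<longleftrightarrow> (\<forall>i. \<bar>x $ i\<bar> < 1 / 2)"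
proof -
  have "- 1 / 2 < r \<and> r < 1 / 2 \<longleftrightarrow> \<bar>r\<bar> < 1 / 2" for r :: real by auto
  then show ?thesis by (simp add: unit_cube_def interior_cbox mem_box_cart)
qed

lemma compact_unit_cube [simp]: "compact (unit_cube :: (real ^ 'n) set)"
  by (simp add: unit_cube_def)

lemma integrable_on_unit_cube:
  fixes f :: "real ^ 'n \<Rightarrow> real"
  assumes "continuous_on unit_cube f"
  shows "f integrable_on unit_cube"
  using assms by (simp add: unit_cube_def integrable_continuous)

lemma set_integrable_unit_cube:
  fixes f :: "real ^ 'n \<Rightarrow> real"
  assumes "continuous_on unit_cube f"
  shows "set_integrable lborel unit_cube f"
  using borel_integrable_compact[OF compact_unit_cube assms] by (simp add: set_integrable_def)

lemma LINT_unit_cube: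
  fixes f :: "real ^ 'n \<Rightarrow> real"
  assumes "continuous_on unit_cube f"
  shows "(LINT x:unit_cube|lborel. f x) = integral unit_cube f"
  using set_borel_integral_eq_integral(2)[OF set_integrable_unit_cube[OF assms]] .

lemma cube_inner_eq_integral:
  fixes f g :: "real ^ 'n \<Rightarrow> real"
  assumes "continuous_on unit_cube f" "continuous_on unit_cube g"
  shows "cube_inner f g = integral unit_cube (\<lambda>x. f x * g x)"
  unfolding cube_inner_def by (intro LINT_unit_cube continuous_intros assms)

lemma integral_unit_cube_eq_0_imp:
  fixes f :: "real ^ 'n \<Rightarrow> real"
  assumes "continuous_on unit_cube f" "\<And>x. x \<in> unit_cube \<Longrightarrow> 0 \<le> f x"
    and "integral unit_cube f = 0" "x \<in> unit_cube"
  shows "f x = 0"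
proof -
  have "(f has_integral 0) unit_cube"
    using integrable_integral[OF integrable_on_unit_cube[OF assms(1)]] assms(3) by simp
  moreover have "interior (unit_cube :: (real^'n) set) \<noteq> {}"
    using mem_interior_unit_cube[of "0 :: real^'n"] by auto
  ultimately show ?thesis
    using assms interior_subset
    by (intro has_integral_0_cbox_imp_0[of "\<chi> i. - 1/2" "\<chi> i. 1/2" f x])
       (auto simp: unit_cube_def interior_cbox dest: box_subset_cbox[THEN subsetD])
qed

text \<open>The function extended by zero is Lipschitz in direction \<open>i\<close> and its integral is invariant
  under translations; differentiate in the translation parameter.\<close>

lemma integral_partial_eq_0:
  fixes F F' :: "real ^ 'n \<Rightarrow> real"
  assumes der: "\<And>x. x \<in> unit_cube \<Longrightarrow>
      ((\<lambda>t. F (shift x i t)) has_real_derivative F' x) (at 0 within {t. shift x i t \<in> unit_cube})"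
    and cF: "continuous_on unit_cube F" and cF': "continuous_on unit_cube F'"
    and zero: "\<And>x. x \<in> unit_cube \<Longrightarrow> \<bar>x $ i\<bar> = 1 / 2 \<Longrightarrow> F x = 0"
  shows "integral unit_cube F' = 0"
proof -
  let ?C = "unit_cube :: (real^'n) set"
  define G where "G x = indicator ?C x *\<^sub>R F x" for x
  obtain B where B: "\<And>x. x \<in> ?C \<Longrightarrow> \<bar>F' x\<bar> \<le> B"
    using compact_imp_bounded[OF compact_continuous_image[OF cF' compact_unit_cube]]
    unfolding bounded_iff by auto
  have B0: "0 \<le> B" using B[of 0] by (auto simp: mem_unit_cube)
  \<comment> \<open>Mean value inequality on a segment: the parameters that keep the point in the
    cube form a convex set.\<close>
  have lip0: "\<bar>F (shift x i a) - F (shift x i b)\<bar> \<le> B * \<bar>a - b\<bar>"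
    if "shift x i a \<in> ?C" "shift x i b \<in> ?C" for x a b
  proof -
    let ?T = "{t. shift x i t \<in> ?C}"
    have "convex ?T"
    proof (rule convexI)
      fix a b u v :: real
      assume "a \<in> ?T" "b \<in> ?T" "0 \<le> u" "0 \<le> v" "u + v = 1"
      then have "u *\<^sub>R shift x i a + v *\<^sub>R shift x i b \<in> ?C"
        by (intro convexD) (auto simp: unit_cube_def)
      also have "u *\<^sub>R shift x i a + v *\<^sub>R shift x i b = (u + v) *\<^sub>R x + (u * a + v * b) *\<^sub>R axis i 1"
        by (simp add: algebra_simps)
      finally show "u *\<^sub>R a + v *\<^sub>R b \<in> ?T" using \<open>u + v = 1\<close> by simp
    qed
    moreover have "((\<lambda>t. F (shift x i t)) has_real_derivative F' (shift x i t)) (at t within ?T)"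
      if "t \<in> ?T" for t
    proof -
      have "((\<lambda>s. F (shift (shift x i t) i s)) has_real_derivative F' (shift x i t))
         (at (t - t) within {s. shift (shift x i t) i s \<in> ?C})"
        using der[of "shift x i t"] that by simp
      moreover have "(\<lambda>s. s - t) ` ?T = {s. shift (shift x i t) i s \<in> ?C}"
        by (auto simp: algebra_simps intro!: image_eqI[where x="t + _"])
      ultimately have "((\<lambda>s. F (shift (shift x i t) i s)) \<circ> (\<lambda>u. u - t) has_real_derivative F' (shift x i t) * 1)
         (at t within ?T)"
        by (intro DERIV_image_chain) (auto intro!: derivative_eq_intros)
      then show ?thesis by (simp add: o_def algebra_simps)
    qed
    ultimately show ?thesis
      using field_differentiable_bound[of ?T "\<lambda>t. F (shift x i t)" "\<lambda>t. F' (shift x i t)" B a b] B that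
      by simp
  qed
  \<comment> \<open>\<open>cl\<close> clamps a coordinate to [-1/2, 1/2]. As F vanishes on the two
    faces orthogonal to direction i, its zero extension agrees, along a line that meets the cube,
    with F at the clamped point. Clamping does not increase distances, so the Lipschitz bound
    survives across these faces; a line that misses the cube sees only zeros.\<close>
  define cl where "cl r = max (- 1/2) (min (1/2) (r::real))" for r
  have GP: "G y = (if \<forall>j. j \<noteq> i \<longrightarrow> \<bar>y $ j\<bar> \<le> 1/2 then F (shift y i (cl (y $ i) - y $ i)) else 0)" for y
  proof -
    { assume *: "\<forall>j. j \<noteq> i \<longrightarrow> \<bar>y $ j\<bar> \<le> 1/2" and n: "\<not> \<bar>y $ i\<bar> \<le> 1/2"
      let ?z = "shift y i (cl (y $ i) - y $ i)"
      have "\<bar>cl (y $ i)\<bar> = 1/2" using n unfolding cl_def by linarith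
      then have "\<bar>?z $ i\<bar> = 1/2" by (simp add: axis_def)
      moreover from this have "?z \<in> ?C" using * by (auto simp: mem_unit_cube axis_def)
      ultimately have "F ?z = 0" by (intro zero)
      moreover have "y \<notin> ?C" using n mem_unit_cube by blast
      ultimately have ?thesis using * by (simp add: G_def) }
    moreover
    { assume *: "\<forall>j. j \<noteq> i \<longrightarrow> \<bar>y $ j\<bar> \<le> 1/2" and n: "\<bar>y $ i\<bar> \<le> 1/2"
      have "cl (y $ i) = y $ i" using n by (auto simp: cl_def abs_if split: if_splits)
      moreover have "y \<in> ?C" using * n by (metis mem_unit_cube)
      ultimately have ?thesis using * by (simp add: G_def) }
    moreover
    { assume *: "\<not> (\<forall>j. j \<noteq> i \<longrightarrow> \<bar>y $ j\<bar> \<le> 1/2)"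
      then have "y \<notin> ?C" using mem_unit_cube by blast
      then have ?thesis using * by (simp only: G_def if_not_P) simp }
    ultimately show ?thesis by blast
  qed
  have lip: "\<bar>G (shift x i t) - G x\<bar> \<le> B * \<bar>t\<bar>" for x t
  proof (cases "\<forall>j. j \<noteq> i \<longrightarrow> \<bar>x $ j\<bar> \<le> 1/2")
    case True
    have nth: "shift x i t $ i = x $ i + t" "\<forall>j. j \<noteq> i \<longrightarrow> \<bar>shift x i t $ j\<bar> \<le> 1/2"
      using True by (auto simp: axis_def)
    have inC: "shift x i (cl r - x $ i) \<in> ?C" for r
      using True by (auto simp: mem_unit_cube axis_def cl_def)
    have "\<bar>F (shift x i (cl (x $ i + t) - x $ i)) - F (shift x i (cl (x $ i) - x $ i))\<bar>
        \<le> B * \<bar>cl (x $ i + t) - cl (x $ i)\<bar>"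
      using lip0[OF inC inC, of "x $ i + t" "x $ i"] by simp
    also have "\<dots> \<le> B * \<bar>t\<bar>"
      by (intro mult_left_mono B0) (auto simp: cl_def)
    finally show ?thesis using True nth
      unfolding GP by (simp only: if_True if_P not_False_eq_True)
        (simp add: add.assoc scaleR_left_distrib[symmetric])
  next
    case False
    then show ?thesis using B0 by (auto simp: GP axis_def)
  qed
  have intG: "integrable lborel G"
    unfolding G_def by (intro borel_integrable_compact cF compact_unit_cube)
  have intGs: "integrable lborel (\<lambda>x. G (shift x i t))"
    and eqG: "(LINT x|lborel. G (shift x i t)) = (LINT x|lborel. G x)" for t
  proof -
    have d: "distr lborel borel ((+) (t *\<^sub>R axis i 1)) = (lborel :: (real^'n) measure)"
      by (rule lborel_distr_plus)
    have m: "G \<in> borel_measurable borel" using intG by simp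
    show "integrable lborel (\<lambda>x. G (shift x i t))"
      using integrable_distr_eq[of "(+) (t *\<^sub>R axis i 1)" lborel borel G] m intG
      by (simp add: d add.commute)
    show "(LINT x|lborel. G (shift x i t)) = (LINT x|lborel. G x)"
      using integral_distr[of "(+) (t *\<^sub>R axis i 1)" lborel borel G] m
      by (simp add: d add.commute)
  qed
  define t where "t n = inverse (real (Suc n))" for n
  have t0: "t \<longlonglongrightarrow> 0" unfolding t_def by (rule LIMSEQ_inverse_real_of_nat)
  have tpos: "0 < t n" "t n \<le> 1" for n by (auto simp: t_def field_simps)
  define Q where "Q n x = (G (shift x i (t n)) - G x) / t n" for n x
  \<comment> \<open>The shifts are at most 1, so all difference quotients vanish outside this box,
    and B times its indicator dominates them.\<close>
  let ?W = "cbox (\<chi> i. -2) (\<chi> i. 2) :: (real^'n) set"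
  have "(\<lambda>n. LINT x|lborel. Q n x) \<longlonglongrightarrow> (LINT x|lborel. indicator ?C x *\<^sub>R F' x)"
  proof (rule integral_dominated_convergence[where w = "\<lambda>x. indicator ?W x *\<^sub>R B"])
    show "(\<lambda>x. indicator ?C x *\<^sub>R F' x) \<in> borel_measurable lborel"
      using borel_integrable_compact[OF compact_unit_cube cF'] by simp
    show "Q n \<in> borel_measurable lborel" for n
      unfolding Q_def using intGs[of "t n"] intG by (intro borel_measurable_divide borel_measurable_diff) auto
    show "integrable lborel (\<lambda>x. indicator ?W x *\<^sub>R B)"
      by (intro borel_integrable_compact) auto
    show "AE x in lborel. norm (Q n x) \<le> indicator ?W x *\<^sub>R B" for n
    proof (rule AE_I2)
      fix x :: "real^'n"
      show "norm (Q n x) \<le> indicator ?W x *\<^sub>R B"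
      proof (cases "x \<in> ?W")
        case True
        then show ?thesis using lip[of x "t n"] tpos[of n] by (simp add: Q_def divide_le_eq abs_mult)
      next
        case False
        then obtain j where "\<not> (- 2 \<le> x $ j \<and> x $ j \<le> 2)" by (auto simp: mem_box_cart)
        then have j: "\<bar>x $ j\<bar> > 2" by linarith
        have "\<bar>shift x i (t n) $ j\<bar> > 1/2" using j tpos[of n] by (auto simp: axis_def abs_if split: if_splits)
        then have "shift x i (t n) \<notin> ?C" unfolding mem_unit_cube by (meson linorder_not_le)
        moreover have "x \<notin> ?C" unfolding mem_unit_cube using j by (auto intro!: exI[of _ j])
        ultimately show ?thesis by (simp add: Q_def G_def B0)
      qed
    qed
    \<comment> \<open>Off the boundary a point and its small shifts lie on the same side of it, so
      the quotients converge to F' inside and are eventually 0 outside.\<close>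
    have "AE x in lborel. x \<notin> frontier ?C"
    proof -
      have "negligible (frontier ?C)"
        unfolding unit_cube_def frontier_cbox by (rule negligible_frontier_interval)
      then have "frontier ?C \<in> null_sets lborel"
        by (simp add: negligible_iff_null_sets null_sets_completion_iff)
      then show ?thesis by (rule AE_not_in)
    qed
    then show "AE x in lborel. (\<lambda>n. Q n x) \<longlonglongrightarrow> indicator ?C x *\<^sub>R F' x"
    proof eventually_elim
      case (elim x)
      have lim: "(\<lambda>n. shift x i (t n)) \<longlonglongrightarrow> x"
        using tendsto_add[OF tendsto_const[of x] tendsto_scaleR[OF t0 tendsto_const[of "axis i 1"]]] by simp
      show ?case
      proof (cases "x \<in> ?C")
        case True
        then have "x \<in> interior ?C" using elim by (auto simp: frontier_def closure_closed compact_imp_closed)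
        then have ev: "eventually (\<lambda>n. shift x i (t n) \<in> interior ?C) sequentially"
          using topological_tendstoD[OF lim] by auto
        have "((\<lambda>s. (F (shift x i s) - F x) / s) \<longlongrightarrow> F' x) (at 0 within {s. shift x i s \<in> ?C})"
          using der[OF True] by (simp add: has_field_derivative_iff)
        moreover have "filterlim t (at 0 within {s. shift x i s \<in> ?C}) sequentially"
          unfolding filterlim_at using t0 tpos ev interior_subset[of ?C]
          by (auto elim!: eventually_mono) (metis less_irrefl subsetD)
        ultimately have "(\<lambda>n. (F (shift x i (t n)) - F x) / t n) \<longlonglongrightarrow> F' x"
          by (rule filterlim_compose)
        moreover have "eventually (\<lambda>n. (F (shift x i (t n)) - F x) / t n = Q n x) sequentially"
          using ev by eventually_elim (use True interior_subset[of ?C] in \<open>auto simp: Q_def G_def\<close>)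
        ultimately show ?thesis using True by (simp add: tendsto_cong)
      next
        case False
        have "open (- ?C)" by (simp add: open_Compl compact_imp_closed)
        then have "eventually (\<lambda>n. shift x i (t n) \<in> - ?C) sequentially"
          using topological_tendstoD[OF lim, of "- ?C"] False by simp
        then have "eventually (\<lambda>n. Q n x = 0) sequentially"
          by eventually_elim (use False in \<open>auto simp: Q_def G_def\<close>)
        then show ?thesis using False by (simp add: tendsto_eventually)
      qed
    qed
  qed
  moreover have "(LINT x|lborel. Q n x) = 0" for n
    unfolding Q_def using intGs intG by (simp add: eqG)
  ultimately have "(LINT x:?C|lborel. F' x) = 0"
    by (simp add: set_lebesgue_integral_def LIMSEQ_const_iff)
  then show ?thesis using LINT_unit_cube[OF cF'] by simp
qed

section \<open>Sine products: derivatives, boundary values, orthogonality\<close>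

text \<open>The successor makes every natural number the index of a nonzero mode. Below, the
  argument \<open>x $ i + 1 / 2\<close> moves the interval to [0, 1], where these sines vanish at
  both ends.\<close>

definition freq :: "nat \<Rightarrow> real" where
  "freq k = pi * real (Suc k)"

definition sine_product :: "('n \<Rightarrow> nat) \<Rightarrow> real ^ 'n \<Rightarrow> real" where
  "sine_product n x = (\<Prod>i\<in>UNIV. sin (freq (n i) * (x $ i + 1 / 2)))"

definition sine_product_partial :: "'n \<Rightarrow> ('n \<Rightarrow> nat) \<Rightarrow> real ^ 'n \<Rightarrow> real" where
  "sine_product_partial i n x = freq (n i) * cos (freq (n i) * (x $ i + 1 / 2)) *
     (\<Prod>j\<in>UNIV - {i}. sin (freq (n j) * (x $ j + 1 / 2)))"

definition sine_eigenvalue :: "('n::finite \<Rightarrow> nat) \<Rightarrow> real" where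
  "sine_eigenvalue n = (\<Sum>i\<in>UNIV. (freq (n i))\<^sup>2)"

lemma freq_pos: "0 < freq k" and freq_ge_1: "1 \<le> freq k"
proof -
  have "1 * 1 \<le> pi * real (Suc k)" by (intro mult_mono) (use pi_ge_two in auto)
  then show "1 \<le> freq k" by (simp add: freq_def)
  then show "0 < freq k" by simp
qed

lemma freq_inj: "freq k = freq l \<longleftrightarrow> k = l"
  by (simp add: freq_def)

lemma sin_freq: "sin (freq k) = 0"
  unfolding freq_def by (rule sin_npi2)

lemma sin_2_freq: "sin (2 * freq k) = 0"
  using sin_npi2[of "2 * Suc k"] by (simp add: freq_def algebra_simps)

lemma continuous_on_sine_product [continuous_intros]: "continuous_on A (sine_product n)"
  unfolding sine_product_def by (intro continuous_intros)

lemma continuous_on_sine_product_partial [continuous_intros]: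
  "continuous_on A (sine_product_partial i n)"
  unfolding sine_product_partial_def by (intro continuous_intros)

lemma sine_product_split:
  "sine_product n x = sin (freq (n i) * (x $ i + 1 / 2)) *
     (\<Prod>j\<in>UNIV - {i}. sin (freq (n j) * (x $ j + 1 / 2)))"
  unfolding sine_product_def by (rule prod.remove) auto

lemma prod_shift_cong:
  assumes "i \<notin> S"
  shows "(\<Prod>j\<in>S. f j (shift x i t $ j)) = (\<Prod>j\<in>S. f j (x $ j))"
  using assms by (intro prod.cong) (auto simp: axis_def)

lemma has_derivative_sine_product_shift:
  "((\<lambda>t. sine_product n (shift x i t)) has_real_derivative sine_product_partial i n x) (at 0 within T)"
proof -
  define c where "c = (\<Prod>j\<in>UNIV - {i}. sin (freq (n j) * (x $ j + 1 / 2)))"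
  have "sine_product n (shift x i t) = sin (freq (n i) * (x $ i + t + 1 / 2)) * c" for t
    unfolding c_def sine_product_split[of _ _ i]
    using prod_shift_cong[where f = "\<lambda>j y. sin (freq (n j) * (y + 1 / 2))" and S = "UNIV - {i}"]
    by (simp add: axis_def)
  then show ?thesis unfolding sine_product_partial_def c_def[symmetric]
    by (auto intro!: derivative_eq_intros)
qed

lemma has_derivative_sine_product_partial_shift:
  "((\<lambda>t. sine_product_partial i n (shift x i t)) has_real_derivative
      - (freq (n i))\<^sup>2 * sine_product n x) (at 0 within T)"
proof -
  define c where "c = (\<Prod>j\<in>UNIV - {i}. sin (freq (n j) * (x $ j + 1 / 2)))"
  have "sine_product_partial i n (shift x i t) = freq (n i) * cos (freq (n i) * (x $ i + t + 1 / 2)) * c" for t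
    unfolding c_def sine_product_partial_def
    using prod_shift_cong[where f = "\<lambda>j y. sin (freq (n j) * (y + 1 / 2))" and S = "UNIV - {i}"]
    by (simp add: axis_def)
  then show ?thesis unfolding sine_product_split[of _ _ i] c_def[symmetric]
    by (auto intro!: derivative_eq_intros simp: power2_eq_square)
qed

lemma sine_product_face:
  assumes "\<bar>x $ i\<bar> = 1 / 2"
  shows "sine_product n x = 0"
proof -
  have "x $ i + 1 / 2 = 1 \<or> x $ i + 1 / 2 = 0" using assms by auto
  then have "sin (freq (n i) * (x $ i + 1 / 2)) = 0" by (auto simp: sin_freq)
  then show ?thesis by (simp add: sine_product_split[of _ _ i])
qed

text \<open>Green's second identity in one direction. In the derivative of u1 s - u s_i the mixed
  terms cancel, and this function vanishes on the two faces because u and s do. Only derivatives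
  along lines are assumed, so the lemma applies to sine products and to eigenfunctions
  alike.\<close>

lemma integral_second_partial_sine_product:
  fixes u u1 u2 :: "real ^ 'n \<Rightarrow> real"
  assumes u1: "\<And>x. x \<in> unit_cube \<Longrightarrow>
      ((\<lambda>t. u (shift x i t)) has_real_derivative u1 x) (at 0 within {t. shift x i t \<in> unit_cube})"
    and u2: "\<And>x. x \<in> unit_cube \<Longrightarrow>
      ((\<lambda>t. u1 (shift x i t)) has_real_derivative u2 x) (at 0 within {t. shift x i t \<in> unit_cube})"
    and [continuous_intros]: "continuous_on unit_cube u" "continuous_on unit_cube u1" "continuous_on unit_cube u2"
    and zero: "\<And>x. x \<in> unit_cube \<Longrightarrow> \<bar>x $ i\<bar> = 1 / 2 \<Longrightarrow> u x = 0"
  shows "integral unit_cube (\<lambda>x. u2 x * sine_product n x) =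
      - (freq (n i))\<^sup>2 * integral unit_cube (\<lambda>x. u x * sine_product n x)"
proof -
  let ?F = "\<lambda>x. u1 x * sine_product n x - u x * sine_product_partial i n x"
  let ?F' = "\<lambda>x. u2 x * sine_product n x + (freq (n i))\<^sup>2 * (u x * sine_product n x)"
  have "integral unit_cube ?F' = 0"
  proof (rule integral_partial_eq_0[where F = ?F and i = i])
    fix x :: "real^'n" assume x: "x \<in> unit_cube"
    show "((\<lambda>t. ?F (shift x i t)) has_real_derivative ?F' x) (at 0 within {t. shift x i t \<in> unit_cube})"
      by (rule derivative_eq_intros u1[OF x] u2[OF x] has_derivative_sine_product_shift
            has_derivative_sine_product_partial_shift refl)+ (simp add: algebra_simps)
  qed (auto intro!: continuous_intros simp: zero sine_product_face)
  moreover have "integral unit_cube ?F' = integral unit_cube (\<lambda>x. u2 x * sine_product n x)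
      + (freq (n i))\<^sup>2 * integral unit_cube (\<lambda>x. u x * sine_product n x)"
    by (subst integral_add) (auto intro!: integrable_on_unit_cube continuous_intros)
  ultimately show ?thesis by simp
qed

text \<open>Write sin^2 as (1 - cos of the double angle)/2. The cosine part is a derivative in
  direction i of a function vanishing on both faces, so it integrates to 0. Induction over the
  coordinates takes the place of Fubini's theorem.\<close>

lemma integral_prod_sin_squared:
  fixes n :: "'n::finite \<Rightarrow> nat"
  assumes "finite S"
  shows "integral (unit_cube :: (real^'n) set) (\<lambda>x. \<Prod>i\<in>S. (sin (freq (n i) * (x $ i + 1 / 2)))\<^sup>2) = (1 / 2) ^ card S"
  using assms
proof (induction S)
  case empty
  have "measure lborel (unit_cube :: (real^'n) set) = 1"
    unfolding unit_cube_def by (subst content_cbox_cart) (auto simp: interval_ne_empty_cart)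
  then show ?case by (simp add: unit_cube_def)
next
  case (insert i S)
  let ?P = "\<lambda>x::real^'n. \<Prod>i\<in>S. (sin (freq (n i) * (x $ i + 1 / 2)))\<^sup>2"
  let ?a = "freq (n i)"
  have P_shift: "?P (shift x i t) = ?P x" for x t
    using prod_shift_cong[OF insert(2), of "\<lambda>i y. (sin (freq (n i) * (y + 1 / 2)))\<^sup>2"] .
  have "integral (unit_cube :: (real^'n) set) (\<lambda>x. cos (2 * (?a * (x $ i + 1 / 2))) * ?P x) = 0"
  proof (rule integral_partial_eq_0[where i = i])
    fix x :: "real^'n"
    have "((\<lambda>t. sin (2 * (?a * (x $ i + t + 1 / 2))) / (2 * ?a) * ?P x) has_real_derivative
        cos (2 * (?a * (x $ i + 1 / 2))) * ?P x) (at 0 within {t. shift x i t \<in> unit_cube})"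
      using freq_pos[of "n i"] by (auto intro!: derivative_eq_intros)
    then show "((\<lambda>t. (\<lambda>x. sin (2 * (?a * (x $ i + 1 / 2))) / (2 * ?a) * ?P x) (shift x i t)) has_real_derivative
        cos (2 * (?a * (x $ i + 1 / 2))) * ?P x) (at 0 within {t. shift x i t \<in> unit_cube})"
      unfolding P_shift by (simp add: axis_def)
  next
    fix x :: "real^'n" assume "\<bar>x $ i\<bar> = 1 / 2"
    then have "x $ i + 1 / 2 = 1 \<or> x $ i + 1 / 2 = 0" by auto
    then have "sin (2 * (?a * (x $ i + 1 / 2))) = 0" by (auto simp: sin_2_freq)
    then show "sin (2 * (?a * (x $ i + 1 / 2))) / (2 * ?a) * ?P x = 0" by simp
  qed (use freq_pos[of "n i"] in \<open>auto intro!: continuous_intros\<close>)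
  moreover have "(\<Prod>i\<in>insert i S. (sin (freq (n i) * (x $ i + 1 / 2)))\<^sup>2) =
      1/2 * ?P x - 1/2 * (cos (2 * (?a * (x $ i + 1 / 2))) * ?P x)" for x :: "real^'n"
    using insert(1,2) by (simp only: cos_double_sin prod.insert) (simp add: algebra_simps)
  then have "integral unit_cube (\<lambda>x::real^'n. \<Prod>i\<in>insert i S. (sin (freq (n i) * (x $ i + 1 / 2)))\<^sup>2) =
     1/2 * integral unit_cube ?P - 1/2 * integral unit_cube (\<lambda>x. cos (2 * (?a * (x $ i + 1 / 2))) * ?P x)"
    by (simp only:) (subst integral_diff, auto intro!: integrable_on_unit_cube continuous_intros)
  ultimately show ?case using insert by simp
qed

text \<open>In a direction where the indices differ, the two products are eigenfunctions of the
  second partial derivative with different eigenvalues, and that operator is symmetric here.\<close>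

lemma sine_product_orthogonal:
  fixes n n' :: "'n::finite \<Rightarrow> nat"
  shows "integral unit_cube (\<lambda>x. sine_product n x * sine_product n' x) =
      (if n = n' then (1 / 2) ^ CARD('n) else 0)"
proof (cases "n = n'")
  case True
  have "sine_product n x * sine_product n x = (\<Prod>i\<in>UNIV. (sin (freq (n i) * (x $ i + 1 / 2)))\<^sup>2)" for x
    by (simp add: sine_product_def power2_eq_square prod.distrib)
  then show ?thesis using True integral_prod_sin_squared[of UNIV n] by simp
next
  case False
  then obtain i where i: "n i \<noteq> n' i" by auto
  let ?I = "integral unit_cube (\<lambda>x. sine_product n x * sine_product n' x)"
  have "integral unit_cube (\<lambda>x. (- (freq (n i))\<^sup>2 * sine_product n x) * sine_product n' x) =
      - (freq (n' i))\<^sup>2 * ?I"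
    by (rule integral_second_partial_sine_product[of _ i "sine_product_partial i n"])
       (auto intro!: continuous_intros has_derivative_sine_product_shift
         has_derivative_sine_product_partial_shift[of i n, simplified] sine_product_face)
  moreover have "(\<lambda>x. (- (freq (n i))\<^sup>2 * sine_product n x) * sine_product n' x) =
     (\<lambda>x. - (freq (n i))\<^sup>2 * (sine_product n x * sine_product n' x))" by (simp add: mult.assoc)
  ultimately have "- (freq (n i))\<^sup>2 * ?I = - (freq (n' i))\<^sup>2 * ?I" by (simp only: integral_mult_right)
  then have "((freq (n i))\<^sup>2 - (freq (n' i))\<^sup>2) * ?I = 0" by (simp add: algebra_simps)
  moreover have "(freq (n i))\<^sup>2 \<noteq> (freq (n' i))\<^sup>2"
    using i freq_pos[of "n i"] freq_pos[of "n' i"] by (simp add: power2_eq_iff_nonneg freq_inj)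
  ultimately show ?thesis using False by simp
qed

section \<open>Completeness of the sine products\<close>

text \<open>Multiplication by \<open>cos (\<pi> y\<^sub>i)\<close> preserves the span of the sine products, so all polynomials in
  these cosines do. The cosines separate the points of the cube, and the Stone-Weierstrass theorem
  applies to the algebra of multipliers of the span.\<close>

inductive_set sine_span :: "(real ^ 'n \<Rightarrow> real) set" where
  base: "sine_product n \<in> sine_span"
| zero: "(\<lambda>_. 0) \<in> sine_span"
| add: "u \<in> sine_span \<Longrightarrow> v \<in> sine_span \<Longrightarrow> (\<lambda>x. u x + v x) \<in> sine_span"
| scale: "u \<in> sine_span \<Longrightarrow> (\<lambda>x. a * u x) \<in> sine_span"

lemma cos_mult_sine_span:
  fixes u :: "real ^ 'n \<Rightarrow> real"
  assumes "u \<in> sine_span"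
  shows "(\<lambda>x. cos (pi * (x $ i + 1 / 2)) * u x) \<in> sine_span"
  using assms
proof induction
  case (base n)
  \<comment> \<open>\<open>?s k\<close> has frequency pi k, without the successor of
    \<open>freq\<close>: lowering the lowest mode gives k = 0, the zero function, which is still in
    the span.\<close>
  let ?s = "\<lambda>k (x::real^'n). sin (pi * real k * (x $ i + 1 / 2)) *
     (\<Prod>j\<in>UNIV - {i}. sin (freq (n j) * (x $ j + 1 / 2)))"
  have s: "?s k \<in> sine_span" for k
  proof (cases k)
    case 0
    then show ?thesis using sine_span.zero by simp
  next
    case (Suc l)
    have "(\<Prod>j\<in>UNIV - {i}. sin (freq ((n(i := l)) j) * (x $ j + 1 / 2))) =
       (\<Prod>j\<in>UNIV - {i}. sin (freq (n j) * (x $ j + 1 / 2)))" for x :: "real^'n"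
      by (intro prod.cong) auto
    then have "sine_product (n(i := l)) = ?s k"
      by (intro ext) (simp add: sine_product_split[of _ _ i] Suc freq_def)
    then show ?thesis using sine_span.base[of "n(i := l)"] by simp
  qed
  have trig: "cos b * sin (real (Suc k) * b) = 1/2 * sin (real (Suc (Suc k)) * b) + 1/2 * sin (real k * b)"
    for b k
  proof -
    have "sin (real (Suc (Suc k)) * b) = sin (real (Suc k) * b + b)"
      "sin (real k * b) = sin (real (Suc k) * b - b)"
      by (simp_all add: algebra_simps)
    moreover have "cos b * sin a = 1/2 * sin (a + b) + 1/2 * sin (a - b)" for a
      by (simp add: sin_add sin_diff field_simps)
    ultimately show ?thesis by metis
  qed
  have "cos (pi * (x $ i + 1 / 2)) * sine_product n x = 1/2 * ?s (Suc (Suc (n i))) x + 1/2 * ?s (n i) x" for x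
  proof -
    have "sin (freq (n i) * (x $ i + 1 / 2)) = sin (real (Suc (n i)) * (pi * (x $ i + 1 / 2)))"
      and "\<And>k. sin (pi * real k * (x $ i + 1 / 2)) = sin (real k * (pi * (x $ i + 1 / 2)))"
      by (simp_all only: freq_def mult_ac)
    then show ?thesis
      using trig[of "pi * (x $ i + 1 / 2)" "n i"] unfolding sine_product_split[of _ _ i]
      by (simp only: mult.assoc[symmetric] distrib_right)
  qed
  then show ?case
    using sine_span.add[OF sine_span.scale[OF s, of "1/2"] sine_span.scale[OF s, of "1/2"],
       of "Suc (Suc (n i))" "n i"] by simp
next
  case zero
  then show ?case using sine_span.zero by simp
next
  case (add u v)
  then show ?case using sine_span.add[OF add.IH] by (simp add: algebra_simps)
next
  case (scale u a)
  then show ?case using sine_span.scale[OF scale.IH, of a] by (simp add: mult_ac)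
qed

text \<open>Elements of the span vanish on the boundary, so they cannot approximate every continuous
  function uniformly. Therefore F = f w, with w the lowest sine product, is approximated by a
  multiplier g instead. As g w lies in the span, F is orthogonal to g, so the integral of F^2 is at
  most e times that of |F|. Dividing by w is possible in the interior, where w is positive.\<close>

lemma orthogonal_to_sine_products_imp_0:
  fixes f :: "real ^ 'n \<Rightarrow> real"
  assumes cf [continuous_intros]: "continuous_on unit_cube f"
    and orth: "\<And>n. integral unit_cube (\<lambda>x. f x * sine_product n x) = 0"
    and x: "x \<in> interior unit_cube"
  shows "f x = 0"
proof -
  let ?C = "unit_cube :: (real^'n) set"
  define w where "w = (sine_product (\<lambda>_. 0) :: real^'n \<Rightarrow> real)"
  define R where "R = {p. continuous_on ?C p \<and> (\<forall>u\<in>sine_span. (\<lambda>x. p x * u x) \<in> sine_span)}"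
  have cw [continuous_intros]: "continuous_on ?C w" unfolding w_def by (intro continuous_intros)
  have span0: "continuous_on ?C u \<and> integral ?C (\<lambda>x. f x * u x) = 0" if "u \<in> sine_span" for u
    using that
  proof induction
    case (add u v)
    then have "integral ?C (\<lambda>x. f x * u x + f x * v x) = 0"
      by (subst integral_add) (auto intro!: integrable_on_unit_cube continuous_intros)
    with add show ?case by (auto intro!: continuous_intros simp: algebra_simps)
  next
    case (scale u a)
    then have "integral ?C (\<lambda>x. a * (f x * u x)) = 0" by simp
    with scale show ?case by (auto intro!: continuous_intros simp: mult_ac)
  qed (auto intro!: continuous_intros orth)
  interpret function_ring_on R ?C
  proof
    show "\<exists>f\<in>R. f x \<noteq> f y" if "x \<in> ?C" "y \<in> ?C" "x \<noteq> y" for x y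
    proof -
      obtain i where i: "x $ i \<noteq> y $ i" using \<open>x \<noteq> y\<close> by (auto simp: vec_eq_iff)
      have "\<bar>x $ i\<bar> \<le> 1/2" "\<bar>y $ i\<bar> \<le> 1/2" using that by (auto simp: mem_unit_cube)
      then have "0 \<le> x $ i + 1/2" "x $ i + 1/2 \<le> 1" "0 \<le> y $ i + 1/2" "y $ i + 1/2 \<le> 1"
        by (auto simp: abs_le_iff)
      then have "cos (pi * (x $ i + 1 / 2)) \<noteq> cos (pi * (y $ i + 1 / 2))"
        using i cos_inj_pi[of "pi * (x $ i + 1 / 2)" "pi * (y $ i + 1 / 2)"]
        by (auto simp: mult_left_le)
      then show ?thesis
        by (intro bexI[of _ "\<lambda>x. cos (pi * (x $ i + 1 / 2))"])
           (auto simp: R_def intro!: continuous_intros cos_mult_sine_span)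
    qed
    show "(\<lambda>x. f x * g x) \<in> R" if "f \<in> R" "g \<in> R" for f g
      using that by (auto simp: R_def mult.assoc intro!: continuous_intros)
    show "(\<lambda>x. f x + g x) \<in> R" if "f \<in> R" "g \<in> R" for f g
      using that by (auto simp: R_def ring_distribs intro!: continuous_intros sine_span.add)
  qed (auto simp: R_def intro!: continuous_intros sine_span.scale)
  define F where "F x = f x * w x" for x
  have cF [continuous_intros]: "continuous_on ?C F" unfolding F_def by (intro continuous_intros)
  let ?I = "integral ?C (\<lambda>x. F x * F x)"
  have "?I \<le> e * integral ?C (\<lambda>x. \<bar>F x\<bar>)" if "e > 0" for e
  proof -
    obtain g where g: "g \<in> R" "\<And>x. x \<in> ?C \<Longrightarrow> \<bar>F x - g x\<bar> < e"
      using Stone_Weierstrass_basic[OF cF \<open>e > 0\<close>] by blast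
    have [continuous_intros]: "continuous_on ?C g" using g by (simp add: R_def)
    have "(\<lambda>x. g x * w x) \<in> sine_span"
      using g(1) sine_span.base[of "\<lambda>_. 0"] by (auto simp: R_def w_def)
    from span0[OF this] have "integral ?C (\<lambda>x. F x * g x) = 0"
      by (simp add: F_def mult_ac)
    then have "?I = integral ?C (\<lambda>x. F x * F x - F x * g x)"
      by (subst integral_diff) (auto intro!: integrable_on_unit_cube continuous_intros)
    also have "\<dots> \<le> integral ?C (\<lambda>x. e * \<bar>F x\<bar>)"
    proof (rule integral_le)
      show "F x * F x - F x * g x \<le> e * \<bar>F x\<bar>" if "x \<in> ?C" for x
      proof -
        have "F x * (F x - g x) \<le> \<bar>F x\<bar> * \<bar>F x - g x\<bar>" by (simp flip: abs_mult)
        also have "\<dots> \<le> \<bar>F x\<bar> * e" using g(2)[OF that] by (intro mult_left_mono) auto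
        finally show ?thesis by (simp add: algebra_simps)
      qed
    qed (auto intro!: integrable_on_unit_cube continuous_intros)
    finally show ?thesis by simp
  qed
  then have "?I \<le> 0 + e" if "e > 0" for e
  proof -
    let ?A = "integral ?C (\<lambda>x. \<bar>F x\<bar>)"
    have "0 \<le> ?A" by (intro integral_nonneg integrable_on_unit_cube continuous_intros) auto
    then have "e / (?A + 1) * ?A \<le> e" "e / (?A + 1) > 0" using that by (auto simp: field_simps)
    with \<open>\<And>e. e > 0 \<Longrightarrow> ?I \<le> e * ?A\<close>[of "e / (?A + 1)"] show ?thesis by linarith
  qed
  then have "?I \<le> 0" by (rule field_le_epsilon)
  moreover have "0 \<le> ?I" by (intro integral_nonneg integrable_on_unit_cube continuous_intros) auto
  ultimately have "F x * F x = 0"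
    using x interior_subset by (intro integral_unit_cube_eq_0_imp[of "\<lambda>x. F x * F x"]) (auto intro!: continuous_intros)
  moreover have "w x \<noteq> 0"
  proof -
    have "0 < sin (freq 0 * (x $ i + 1/2))" for i
    proof (rule sin_gt_zero)
      have "\<bar>x $ i\<bar> < 1/2" using x by (simp add: mem_interior_unit_cube)
      then have "- (1/2) < x $ i" "x $ i < 1/2" by linarith+
      then show "0 < freq 0 * (x $ i + 1/2)" "freq 0 * (x $ i + 1/2) < pi"
        by (auto simp: freq_def)
    qed
    then have "0 < w x" unfolding w_def sine_product_def by (intro prod_pos) auto
    then show ?thesis by simp
  qed
  ultimately show ?thesis by (simp add: F_def)
qed

section \<open>Dirichlet eigenfunctions\<close>

lemma has_derivative_shift:
  assumes "(f has_derivative D) (at x within A)"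
  shows "((\<lambda>t. f (shift x i t)) has_derivative (\<lambda>t. D (t *\<^sub>R axis i 1))) (at 0 within {t. shift x i t \<in> A})"
proof (rule has_derivative_in_compose[where f = "\<lambda>t. shift x i t" and f' = "\<lambda>t. t *\<^sub>R axis i 1" and g = f and g' = D])
  show "((\<lambda>t. shift x i t) has_derivative (\<lambda>t. t *\<^sub>R axis i 1)) (at 0 within {t. shift x i t \<in> A})"
    by (auto intro!: derivative_eq_intros)
  show "(f has_derivative D) (at (shift x i 0) within (\<lambda>t. shift x i t) ` {t. shift x i t \<in> A})"
    by (auto intro!: has_derivative_subset[OF assms])
qed

section \<open>Sine expansion of a Dirichlet eigenfunction\<close>

lemma finite_funs_less:
  fixes k :: nat
  shows "finite {n :: 'n::finite \<Rightarrow> nat. \<forall>i. n i < k}"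
proof -
  have "{n :: 'n \<Rightarrow> nat. \<forall>i. n i < k} = PiE UNIV (\<lambda>_. {..<k})" by (auto simp: PiE_def)
  then show ?thesis by (simp add: finite_PiE)
qed

lemma freq_ge_Suc: "real (Suc k) \<le> freq k"
proof -
  have "1 * real (Suc k) \<le> pi * real (Suc k)" by (intro mult_right_mono) (use pi_ge_two in auto)
  then show ?thesis by (simp add: freq_def)
qed

lemma freq_squared_le_sine_eigenvalue: "(freq (n i))\<^sup>2 \<le> sine_eigenvalue n"
  unfolding sine_eigenvalue_def by (rule member_le_sum) auto

lemma sine_eigenvalue_nonneg: "0 \<le> sine_eigenvalue n"
  unfolding sine_eigenvalue_def by (intro sum_nonneg) auto

lemma finite_sine_eigenvalue_eq: "finite {n. sine_eigenvalue n = l}"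
proof -
  obtain k :: nat where k: "l < real k" using reals_Archimedean2 by blast
  have "n i < k" if "sine_eigenvalue n = l" for n :: "'a \<Rightarrow> nat" and i
  proof -
    have "real (Suc (n i)) * 1 \<le> freq (n i) * freq (n i)"
      by (intro mult_mono freq_ge_Suc freq_ge_1) (use freq_pos[of "n i"] in auto)
    also have "\<dots> \<le> l" using freq_squared_le_sine_eigenvalue[of n i] that by (simp add: power2_eq_square)
    finally show ?thesis using k by simp
  qed
  then show ?thesis by (intro finite_subset[OF _ finite_funs_less[of k]]) auto
qed

text \<open>The claim on coefficients is the symmetry of the Laplacian: summing the one-directional
  identity over i turns the diagonal of the Hessian into its trace, and the same integral is
  multiplied once by \<open>sine_eigenvalue n\<close> and once by l.\<close>

lemma
  fixes f :: "real ^ 'n \<Rightarrow> real"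
  assumes "dirichlet_eigenfunction f l"
  shows continuous_on_dirichlet_eigenfunction: "continuous_on unit_cube f"
    and dirichlet_eigenfunction_frontier: "x \<in> frontier unit_cube \<Longrightarrow> f x = 0"
    and dirichlet_eigenfunction_sine_coeff:
      "integral unit_cube (\<lambda>x. f x * sine_product n x) \<noteq> 0 \<Longrightarrow> sine_eigenvalue n = l"
proof -
  let ?C = "unit_cube :: (real^'n) set"
  obtain g :: "real ^ 'n \<Rightarrow> real ^ 'n" and h :: "real ^ 'n \<Rightarrow> real ^ 'n ^ 'n" where
    g: "\<And>x. x \<in> ?C \<Longrightarrow> (f has_derivative (\<lambda>v. g x \<bullet> v)) (at x within ?C)" and
    h: "\<And>x. x \<in> ?C \<Longrightarrow> (g has_derivative (\<lambda>v. h x *v v)) (at x within ?C)" and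
    ch: "continuous_on ?C h" and
    eq: "\<And>x. x \<in> interior ?C \<Longrightarrow> - trace (h x) = l * f x"
    and fr: "\<And>x. x \<in> frontier ?C \<Longrightarrow> f x = 0"
    using assms unfolding dirichlet_eigenfunction_def by blast
  show cf: "continuous_on ?C f"
    using g by (meson differentiableI differentiable_imp_continuous_on differentiable_on_def)
  show "x \<in> frontier ?C \<Longrightarrow> f x = 0" by (rule fr)
  have cg: "continuous_on ?C g"
    using h by (meson differentiableI differentiable_imp_continuous_on differentiable_on_def)
  have face: "f x = 0" if "x \<in> ?C" "\<bar>x $ i\<bar> = 1 / 2" for x i
  proof -
    have "x \<notin> interior ?C" using that by (metis less_irrefl mem_interior_unit_cube)
    then show ?thesis using that fr by (simp add: frontier_def closure_closed compact_imp_closed)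
  qed
  have dir: "integral ?C (\<lambda>x. h x $ i $ i * sine_product n x) =
      - (freq (n i))\<^sup>2 * integral ?C (\<lambda>x. f x * sine_product n x)" for i
  proof (rule integral_second_partial_sine_product[where ?u1.0 = "\<lambda>x. g x $ i"])
    fix x assume x: "x \<in> ?C"
    show "((\<lambda>t. f (shift x i t)) has_real_derivative g x $ i) (at 0 within {t. shift x i t \<in> ?C})"
      using has_derivative_shift[OF g[OF x], of i] unfolding has_field_derivative_def
      by (rule has_derivative_eq_rhs) (auto simp: inner_axis)
    have "((\<lambda>t. g (shift x i t) $ i) has_derivative (\<lambda>t. (h x *v (t *\<^sub>R axis i 1)) $ i))
        (at 0 within {t. shift x i t \<in> ?C})"
      using has_derivative_shift[OF h[OF x], of i] by (rule bounded_linear.has_derivative[OF bounded_linear_vec_nth])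
    then show "((\<lambda>t. g (shift x i t) $ i) has_real_derivative h x $ i $ i) (at 0 within {t. shift x i t \<in> ?C})"
      unfolding has_field_derivative_def
      by (rule has_derivative_eq_rhs)
         (auto simp: matrix_vector_mult_scaleR matrix_vector_mult_basis column_def)
  qed (auto intro!: continuous_intros cf cg ch face)
  assume nz: "integral ?C (\<lambda>x. f x * sine_product n x) \<noteq> 0" (is "?I \<noteq> 0")
  have "integral ?C (\<lambda>x. (\<Sum>i\<in>UNIV. h x $ i $ i * sine_product n x)) = (\<Sum>i\<in>UNIV. - (freq (n i))\<^sup>2 * ?I)"
    by (subst integral_sum) (auto simp: dir intro!: integrable_on_unit_cube continuous_intros ch)
  also have "\<dots> = - sine_eigenvalue n * ?I"
    by (simp add: sine_eigenvalue_def sum_distrib_right sum_negf)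
  \<comment> \<open>The eigenvalue equation is given in the interior only; the boundary is
    negligible for the integral.\<close>
  also have "integral ?C (\<lambda>x. (\<Sum>i\<in>UNIV. h x $ i $ i * sine_product n x)) =
      integral ?C (\<lambda>x. - l * (f x * sine_product n x))"
  proof (rule integral_spike[where S = "frontier ?C"])
    show "negligible (frontier ?C)"
      unfolding unit_cube_def frontier_cbox by (rule negligible_frontier_interval)
    fix x assume "x \<in> ?C - frontier ?C"
    then have "x \<in> interior ?C" by (auto simp: frontier_def closure_closed compact_imp_closed)
    then have "(\<Sum>i\<in>UNIV. h x $ i $ i) = - l * f x" using eq[of x] by (simp add: trace_def)
    then show "- l * (f x * sine_product n x) = (\<Sum>i\<in>UNIV. h x $ i $ i * sine_product n x)"
      by (simp flip: sum_distrib_right)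
  qed
  finally have "(sine_eigenvalue n - l) * ?I = 0" by auto
  with nz show "sine_eigenvalue n = l" by auto
qed

text \<open>The finite sum has the same sine coefficients as f: by orthogonality at indices with
  eigenvalue l, and because both are 0 at the others. Completeness then gives equality in the
  interior, and both sides vanish on the boundary. The power of 2 is the reciprocal of the squared
  norm of a sine product.\<close>

lemma dirichlet_eigenfunction_sine_expansion:
  fixes f :: "real ^ 'n \<Rightarrow> real"
  assumes eigenfunction_phi: "dirichlet_eigenfunction f l" and x: "x \<in> unit_cube"
  shows "f x = (\<Sum>n | sine_eigenvalue n = l.
      2 ^ CARD('n) * integral unit_cube (\<lambda>x. f x * sine_product n x) * sine_product n x)"
proof -
  let ?C = "unit_cube :: (real^'n) set"
  let ?N = "{n :: 'n \<Rightarrow> nat. sine_eigenvalue n = l}"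
  define I where "I n = integral ?C (\<lambda>x. f x * sine_product n x)" for n
  define s where "s x = (\<Sum>n\<in>?N. 2 ^ CARD('n) * I n * sine_product n x)" for x
  note cf [continuous_intros] = continuous_on_dirichlet_eigenfunction[OF eigenfunction_phi]
  have cs [continuous_intros]: "continuous_on ?C s" unfolding s_def by (intro continuous_intros)
  have Is: "integral ?C (\<lambda>x. s x * sine_product m x) = I m" for m
  proof -
    have "integral ?C (\<lambda>x. s x * sine_product m x) =
        integral ?C (\<lambda>x. \<Sum>n\<in>?N. 2 ^ CARD('n) * I n * (sine_product n x * sine_product m x))"
      by (simp only: s_def sum_distrib_right mult.assoc)
    also have "\<dots> = (\<Sum>n\<in>?N. 2 ^ CARD('n) * I n * (if n = m then (1 / 2) ^ CARD('n) else 0))"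
      by (subst integral_sum)
         (auto simp: finite_sine_eigenvalue_eq sine_product_orthogonal intro!: integrable_on_unit_cube continuous_intros)
    also have "\<dots> = (\<Sum>n\<in>?N. if n = m then I n else 0)"
      by (intro sum.cong) (auto simp: power_one_over)
    also have "\<dots> = I m"
      using dirichlet_eigenfunction_sine_coeff[OF eigenfunction_phi, of m] by (auto simp: finite_sine_eigenvalue_eq I_def)
    finally show ?thesis .
  qed
  show ?thesis
  proof (cases "x \<in> interior ?C")
    case True
    have "integral ?C (\<lambda>x. (f x - s x) * sine_product m x) = 0" for m
    proof -
      have "integral ?C (\<lambda>x. f x * sine_product m x - s x * sine_product m x) = I m - I m"
        unfolding Is[symmetric] by (subst integral_diff)
          (auto simp: I_def Is intro!: integrable_on_unit_cube continuous_intros)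
      then show ?thesis by (simp add: algebra_simps)
    qed
    then have "f x - s x = 0"
      by (intro orthogonal_to_sine_products_imp_0[of "\<lambda>x. f x - s x"] continuous_intros True) auto
    then show ?thesis by (simp add: s_def I_def)
  next
    case False
    then obtain i where "\<not> \<bar>x $ i\<bar> < 1 / 2" by (auto simp: mem_interior_unit_cube)
    moreover have "\<bar>x $ i\<bar> \<le> 1 / 2" using x by (simp add: mem_unit_cube)
    ultimately have "\<bar>x $ i\<bar> = 1 / 2" by simp
    then have "sine_product n x = 0" for n by (rule sine_product_face)
    moreover have "f x = 0"
      using False x dirichlet_eigenfunction_frontier[OF eigenfunction_phi, of x]
      by (simp add: frontier_def closure_closed compact_imp_closed)
    ultimately show ?thesis by simp
  qed
qed

text \<open>A negative l would leave the sine expansion with no terms, making f zero on the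
  cube.\<close>

lemma dirichlet_eigenvalue_nonneg:
  fixes f :: "real ^ 'n \<Rightarrow> real"
  assumes "dirichlet_eigenfunction f l"
  shows "0 \<le> l"
proof (rule ccontr)
  assume "\<not> 0 \<le> l"
  then have "{n :: 'n \<Rightarrow> nat. sine_eigenvalue n = l} = {}" using sine_eigenvalue_nonneg by auto
  from dirichlet_eigenfunction_sine_expansion[OF assms, unfolded this]
  have "f x = 0" if "x \<in> unit_cube" for x using that by simp
  then show False using assms by (auto simp: dirichlet_eigenfunction_def)
qed

section \<open>Summability of negative powers of the sine eigenvalues\<close>

text \<open>Every (n_i + 1)^2 is at most 1 + eigenvalue. Raising this to the power a/d and
  multiplying over the d coordinates dominates the term by a product of one-dimensional terms with
  exponent 2a/d, which exceeds 1 exactly when a > d/2.\<close>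

lemma sum_sine_eigenvalue_powr_bounded:
  assumes a: "real CARD('n) / 2 < a"
  shows "\<exists>Z. \<forall>F :: ('n::finite \<Rightarrow> nat) set. finite F \<longrightarrow> (\<Sum>n\<in>F. (1 + sine_eigenvalue n) powr (- a)) \<le> Z"
proof -
  let ?d = "CARD('n)"
  have d: "?d > 0" by simp
  have a0: "0 < a" using a by (smt (verit) divide_nonneg_nonneg of_nat_0_le_iff)
  define s where "s = 2 * a / ?d"
  have s: "1 < s" using a d by (simp add: s_def field_simps)
  define g where "g k = real (Suc k) powr (- s)" for k
  have "summable (\<lambda>k. real k powr (- s))" using s by (simp add: summable_real_powr_iff)
  then have g: "summable g" unfolding g_def by (subst summable_Suc_iff)
  have term_le: "(1 + sine_eigenvalue n) powr (- a) \<le> (\<Prod>i\<in>UNIV. g (n i))" for n :: "'n \<Rightarrow> nat"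
  proof -
    have pos: "0 < 1 + sine_eigenvalue n" using sine_eigenvalue_nonneg[of n] by simp
    have "(\<Prod>i\<in>UNIV. real (Suc (n i)) powr s) \<le> (\<Prod>i\<in>(UNIV::'n set). (1 + sine_eigenvalue n) powr (a / ?d))"
    proof (intro prod_mono conjI)
      fix i
      have "(real (Suc (n i)))\<^sup>2 \<le> (freq (n i))\<^sup>2" by (intro power_mono freq_ge_Suc) auto
      also have "\<dots> \<le> 1 + sine_eigenvalue n" using freq_squared_le_sine_eigenvalue[of n i] by simp
      finally have "((real (Suc (n i)))\<^sup>2) powr (a / ?d) \<le> (1 + sine_eigenvalue n) powr (a / ?d)"
        using a0 by (intro powr_mono2) auto
      also have "((real (Suc (n i)))\<^sup>2) powr (a / ?d) = real (Suc (n i)) powr s"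
        by (simp add: s_def powr_powr flip: powr_numeral)
      finally show "real (Suc (n i)) powr s \<le> (1 + sine_eigenvalue n) powr (a / ?d)" .
    qed auto
    also have "\<dots> = (1 + sine_eigenvalue n) powr a"
      using pos d by (simp add: powr_powr flip: powr_realpow)
    finally have "inverse ((1 + sine_eigenvalue n) powr a) \<le> inverse (\<Prod>i\<in>UNIV. real (Suc (n i)) powr s)"
      by (intro le_imp_inverse_le prod_pos) auto
    then show ?thesis
      using prod_inversef[of "\<lambda>i. real (Suc (n i)) powr s" UNIV] by (simp add: g_def powr_minus o_def)
  qed
  show ?thesis
  proof (intro exI allI impI)
    fix F :: "('n \<Rightarrow> nat) set" assume F: "finite F"
    \<comment> \<open>A cube of indices containing F, over which the sum of products factorizes. The
      inserted 0 keeps the maximum meaningful for empty F.\<close>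
    define k where "k = Suc (Max (insert 0 ((\<lambda>(n, i). n i) ` (F \<times> UNIV))))"
    have k: "n i < k" if "n \<in> F" for n i
      unfolding k_def less_Suc_eq_le using F that by (intro Max_ge) (auto intro!: image_eqI[where x = "(n, i)"])
    have "(\<Sum>n\<in>F. (1 + sine_eigenvalue n) powr (- a)) \<le> (\<Sum>n\<in>F. \<Prod>i\<in>UNIV. g (n i))"
      by (intro sum_mono term_le)
    also have "\<dots> \<le> (\<Sum>n\<in>PiE (UNIV :: 'n set) (\<lambda>_. {..<k}). \<Prod>i\<in>UNIV. g (n i))"
      by (rule sum_mono2) (auto simp: g_def finite_PiE k intro!: prod_nonneg)
    also have "\<dots> = (\<Prod>i\<in>(UNIV::'n set). \<Sum>j<k. g j)"
      by (rule prod_sum_PiE[symmetric]) auto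
    also have "\<dots> \<le> (\<Prod>i\<in>(UNIV::'n set). suminf g)"
      by (intro prod_mono conjI sum_nonneg sum_le_suminf g) (auto simp: g_def)
    finally show "(\<Sum>n\<in>F. (1 + sine_eigenvalue n) powr (- a)) \<le> suminf g ^ CARD('n)" by simp
  qed
qed

section \<open>Bounds for an arbitrary eigenbasis\<close>

locale eigenbasis =
  fixes \<phi> :: "nat \<Rightarrow> real ^ 'n \<Rightarrow> real" and lam :: "nat \<Rightarrow> real"
  assumes basis: "dirichlet_eigenbasis \<phi> lam"
begin

lemma eigenfunction_phi: "dirichlet_eigenfunction (\<phi> k) (lam k)"
  using basis by (simp add: dirichlet_eigenbasis_def)

lemma continuous_on_phi [continuous_intros]: "continuous_on unit_cube (\<phi> k)"
  by (rule continuous_on_dirichlet_eigenfunction[OF eigenfunction_phi])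

lemma lam_nonneg: "0 \<le> lam k"
  by (rule dirichlet_eigenvalue_nonneg[OF eigenfunction_phi])

lemma orthonormal: "integral unit_cube (\<lambda>x. \<phi> k x * \<phi> l x) = (if k = l then 1 else 0)"
  using basis cube_inner_eq_integral[OF continuous_on_phi continuous_on_phi] by (simp add: dirichlet_eigenbasis_def)

lemma bessel:
  assumes [continuous_intros]: "continuous_on unit_cube G" and K: "finite K"
  shows "(\<Sum>k\<in>K. (integral unit_cube (\<lambda>x. \<phi> k x * G x))\<^sup>2) \<le> integral unit_cube (\<lambda>x. (G x)\<^sup>2)"
proof -
  let ?C = "unit_cube :: (real^'n) set"
  define c where "c k = integral ?C (\<lambda>x. \<phi> k x * G x)" for k
  define s where "s x = (\<Sum>k\<in>K. c k * \<phi> k x)" for x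
  have cs [continuous_intros]: "continuous_on ?C s" unfolding s_def by (intro continuous_intros)
  have s: "integral ?C (\<lambda>x. s x * u x) = (\<Sum>k\<in>K. c k * integral ?C (\<lambda>x. \<phi> k x * u x))"
    if [continuous_intros]: "continuous_on ?C u" for u
  proof -
    have "integral ?C (\<lambda>x. s x * u x) = integral ?C (\<lambda>x. \<Sum>k\<in>K. c k * (\<phi> k x * u x))"
      by (simp only: s_def sum_distrib_right mult.assoc)
    also have "\<dots> = (\<Sum>k\<in>K. c k * integral ?C (\<lambda>x. \<phi> k x * u x))"
      by (subst integral_sum) (auto simp: K intro!: integrable_on_unit_cube continuous_intros)
    finally show ?thesis .
  qed
  have phis: "integral ?C (\<lambda>x. \<phi> k x * s x) = c k" if "k \<in> K" for k
  proof -
    have "integral ?C (\<lambda>x. \<phi> k x * s x) = integral ?C (\<lambda>x. s x * \<phi> k x)" by (simp add: mult.commute)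
    then show ?thesis
      using K that by (simp add: s continuous_on_phi orthonormal if_distrib[of "(*) _"] cong: if_cong)
  qed
  have "0 \<le> integral ?C (\<lambda>x. (G x - s x)\<^sup>2)"
    by (intro integral_nonneg integrable_on_unit_cube continuous_intros) auto
  also have "(\<lambda>x. (G x - s x)\<^sup>2) = (\<lambda>x. (G x)\<^sup>2 - 2 * (s x * G x) + s x * s x)"
    by (auto simp: power2_eq_square algebra_simps)
  also have "integral ?C \<dots> = integral ?C (\<lambda>x. (G x)\<^sup>2) - 2 * integral ?C (\<lambda>x. s x * G x) + integral ?C (\<lambda>x. s x * s x)"
    by (subst integral_add integral_diff; (intro integrable_on_unit_cube continuous_intros)?)+ simp
  also have "integral ?C (\<lambda>x. s x * G x) = (\<Sum>k\<in>K. (c k)\<^sup>2)"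
    by (simp add: s assms c_def power2_eq_square)
  also have "integral ?C (\<lambda>x. s x * s x) = (\<Sum>k\<in>K. (c k)\<^sup>2)"
    by (simp add: s cs phis power2_eq_square)
  finally show ?thesis by (simp add: c_def)
qed

text \<open>By the sine expansion, \<open>(1 + \<lambda>\<^sub>k)\<^bsup>-\<alpha>/2\<^esup> \<phi>\<^sub>k(x)\<close> is the inner product of \<open>\<phi>\<^sub>k\<close> with the kernel
  \<open>G\<close> of \<open>(1 - \<Delta>)\<^bsup>-\<alpha>/2\<^esup>\<close> at \<open>x\<close>, truncated to the finitely many sine products involved.\<close>

lemma weighted_sum_phi_squared_bounded:
  assumes a: "real CARD('n) / 2 < a"
  shows "\<exists>Z\<ge>0. \<forall>x\<in>unit_cube. \<forall>K. finite K \<longrightarrow> (\<Sum>k\<in>K. (1 + lam k) powr (- a) * (\<phi> k x)\<^sup>2) \<le> Z"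
proof -
  let ?C = "unit_cube :: (real^'n) set"
  obtain Z where Z: "\<And>F :: ('n \<Rightarrow> nat) set. finite F \<Longrightarrow> (\<Sum>n\<in>F. (1 + sine_eigenvalue n) powr (- a)) \<le> Z"
    using sum_sine_eigenvalue_powr_bounded[OF a] by blast
  have Z0: "0 \<le> Z" using Z[of "{}"] by simp
  have "(\<Sum>k\<in>K. (1 + lam k) powr (- a) * (\<phi> k x)\<^sup>2) \<le> 2 ^ CARD('n) * Z"
    if x: "x \<in> ?C" and K: "finite K" for x K
  proof -
    define N where "N = (\<Union>k\<in>K. {n :: 'n \<Rightarrow> nat. sine_eigenvalue n = lam k})"
    have N: "finite N" using K by (auto simp: N_def finite_sine_eigenvalue_eq)
    define w where "w n = (1 + sine_eigenvalue n) powr (- a / 2) * 2 ^ CARD('n) * sine_product n x" for n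
    define G where "G z = (\<Sum>n\<in>N. w n * sine_product n z)" for z
    have cG [continuous_intros]: "continuous_on ?C G" unfolding G_def by (intro continuous_intros)
    have G: "integral ?C (\<lambda>z. u z * G z) = (\<Sum>n\<in>N. w n * integral ?C (\<lambda>z. u z * sine_product n z))"
      if [continuous_intros]: "continuous_on ?C u" for u
    proof -
      have "integral ?C (\<lambda>z. u z * G z) = integral ?C (\<lambda>z. \<Sum>n\<in>N. w n * (u z * sine_product n z))"
        by (simp add: G_def sum_distrib_left mult_ac)
      also have "\<dots> = (\<Sum>n\<in>N. w n * integral ?C (\<lambda>z. u z * sine_product n z))"
        by (subst integral_sum) (auto simp: N intro!: integrable_on_unit_cube continuous_intros)
      finally show ?thesis .
    qed
    have phi: "integral ?C (\<lambda>z. \<phi> k z * G z) = (1 + lam k) powr (- a / 2) * \<phi> k x" if k: "k \<in> K" for k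
    proof -
      let ?E = "{n :: 'n \<Rightarrow> nat. sine_eigenvalue n = lam k}"
      let ?I = "\<lambda>n. integral ?C (\<lambda>z. \<phi> k z * sine_product n z)"
      have "integral ?C (\<lambda>z. \<phi> k z * G z) = (\<Sum>n\<in>N. w n * ?I n)" by (simp add: G continuous_on_phi)
      \<comment> \<open>Coefficients of \<phi>_k vanish at all other eigenvalues, so on the
        remaining indices the weight depends on \<open>lam k\<close> only and can be pulled
        out.\<close>
      also have "\<dots> = (\<Sum>n\<in>?E. w n * ?I n)"
        using dirichlet_eigenfunction_sine_coeff[OF eigenfunction_phi, of k] k N
        by (intro sum.mono_neutral_right) (auto simp: N_def)
      also have "\<dots> = (1 + lam k) powr (- a / 2) * (\<Sum>n\<in>?E. 2 ^ CARD('n) * ?I n * sine_product n x)"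
        by (simp add: w_def sum_distrib_left mult_ac)
      finally show ?thesis using dirichlet_eigenfunction_sine_expansion[OF eigenfunction_phi x, of k] by simp
    qed
    have "(\<Sum>k\<in>K. (1 + lam k) powr (- a) * (\<phi> k x)\<^sup>2) = (\<Sum>k\<in>K. (integral ?C (\<lambda>z. \<phi> k z * G z))\<^sup>2)"
      by (intro sum.cong) (auto simp: phi power_mult_distrib power2_eq_square simp flip: powr_add)
    also have "\<dots> \<le> integral ?C (\<lambda>z. (G z)\<^sup>2)" by (rule bessel[OF cG K])
    also have "\<dots> = integral ?C (\<lambda>z. G z * G z)" by (simp add: power2_eq_square)
    also have "\<dots> = (\<Sum>n\<in>N. w n * integral ?C (\<lambda>z. sine_product n z * G z))"
      by (simp add: G[OF cG] mult.commute)
    also have "\<dots> = (\<Sum>n\<in>N. (w n)\<^sup>2 * (1 / 2) ^ CARD('n))"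
      using N by (intro sum.cong refl)
        (simp add: G continuous_on_sine_product sine_product_orthogonal power2_eq_square if_distrib[of "(*) _"] cong: if_cong)
    \<comment> \<open>The square of the factor 2^d in \<open>w\<close>, times the squared norm 2^-d
      of a sine product, leaves 2^d; the sine product at x is at most 1 in absolute value.\<close>
    also have "\<dots> \<le> (\<Sum>n\<in>N. 2 ^ CARD('n) * (1 + sine_eigenvalue n) powr (- a))"
    proof (intro sum_mono)
      fix n
      have "(sine_product n x)\<^sup>2 \<le> 1"
        unfolding sine_product_def abs_square_le_1 abs_prod by (intro prod_le_1) auto
      moreover have "(w n)\<^sup>2 * (1 / 2) ^ CARD('n) =
          2 ^ CARD('n) * (1 + sine_eigenvalue n) powr (- a) * (sine_product n x)\<^sup>2"
        by (simp add: w_def power_mult_distrib power2_eq_square power_one_over flip: powr_add)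
      ultimately show "(w n)\<^sup>2 * (1 / 2) ^ CARD('n) \<le> 2 ^ CARD('n) * (1 + sine_eigenvalue n) powr (- a)"
        by (simp add: mult_left_le)
    qed
    also have "\<dots> \<le> 2 ^ CARD('n) * Z"
      using Z[OF N] by (simp flip: sum_distrib_left)
    finally show ?thesis .
  qed
  then show ?thesis using Z0 by (intro exI[of _ "2 ^ CARD('n) * Z"]) auto
qed

lemma measure_unit_cube: "measure lborel (unit_cube :: (real^'n) set) = 1"
  using integral_prod_sin_squared[of "{}"] by (simp add: unit_cube_def)

text \<open>Integrating the pointwise bound over the cube, of measure 1, replaces every \<phi>_k^2
  by 1. Multiplicities are thereby counted correctly without matching eigenvalues with sine
  products.\<close>

lemma summable_lam_powr:
  assumes a: "real CARD('n) / 2 < a"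
  shows "summable (\<lambda>k. (1 + lam k) powr (- a))"
proof -
  let ?C = "unit_cube :: (real^'n) set"
  obtain Z where Z: "\<And>x K. x \<in> ?C \<Longrightarrow> finite K \<Longrightarrow> (\<Sum>k\<in>K. (1 + lam k) powr (- a) * (\<phi> k x)\<^sup>2) \<le> Z"
    using weighted_sum_phi_squared_bounded[OF a] by blast
  show ?thesis
  proof (rule summableI_nonneg_bounded)
    fix n
    have "(\<Sum>k<n. (1 + lam k) powr (- a)) = integral ?C (\<lambda>x. \<Sum>k<n. (1 + lam k) powr (- a) * (\<phi> k x)\<^sup>2)"
      by (subst integral_sum)
         (auto simp: orthonormal power2_eq_square intro!: integrable_on_unit_cube continuous_intros)
    also have "\<dots> \<le> integral ?C (\<lambda>_. Z)"
      by (intro integral_le integrable_on_unit_cube continuous_intros Z) auto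
    also have "\<dots> = Z" using measure_unit_cube by (simp add: unit_cube_def)
    finally show "(\<Sum>k<n. (1 + lam k) powr (- a)) \<le> Z" .
  qed auto
qed

end

section \<open>Sobolev spaces and their duals\<close>

lemma
  fixes u v :: "nat \<Rightarrow> real"
  assumes u: "summable (\<lambda>k. (u k)\<^sup>2)" and v: "summable (\<lambda>k. (v k)\<^sup>2)"
  shows summable_sum_squared: "summable (\<lambda>k. (u k + v k)\<^sup>2)"
    and sqrt_suminf_sum_squared_le:
      "sqrt (\<Sum>k. (u k + v k)\<^sup>2) \<le> sqrt (\<Sum>k. (u k)\<^sup>2) + sqrt (\<Sum>k. (v k)\<^sup>2)"
proof -
  let ?A = "sqrt (\<Sum>k. (u k)\<^sup>2) + sqrt (\<Sum>k. (v k)\<^sup>2)"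
  have A0: "0 \<le> ?A" using suminf_nonneg[OF u] suminf_nonneg[OF v] by simp
  have bound: "(\<Sum>k<n. (u k + v k)\<^sup>2) \<le> ?A\<^sup>2" for n
  proof -
    have "sqrt (\<Sum>k<n. (u k + v k)\<^sup>2) \<le> sqrt (\<Sum>k<n. (u k)\<^sup>2) + sqrt (\<Sum>k<n. (v k)\<^sup>2)"
      using L2_set_triangle_ineq[of u v "{..<n}"] by (simp add: L2_set_def)
    also have "\<dots> \<le> ?A"
      by (intro add_mono real_sqrt_le_mono sum_le_suminf u v) auto
    finally have "(sqrt (\<Sum>k<n. (u k + v k)\<^sup>2))\<^sup>2 \<le> ?A\<^sup>2" by (intro power_mono) (auto intro: sum_nonneg)
    then show ?thesis by (simp add: sum_nonneg)
  qed
  show s: "summable (\<lambda>k. (u k + v k)\<^sup>2)"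
    by (rule summableI_nonneg_bounded[OF _ bound]) auto
  show "sqrt (\<Sum>k. (u k + v k)\<^sup>2) \<le> ?A"
    by (rule real_le_lsqrt[OF A0 suminf_le_const[OF s bound]])
qed

section \<open>The Sobolev space and its point evaluations\<close>

locale sobolev_scale = eigenbasis \<phi> lam
  for \<phi> :: "nat \<Rightarrow> real ^ 'n \<Rightarrow> real" and lam :: "nat \<Rightarrow> real" +
  fixes \<alpha> :: real
  assumes \<alpha>: "real CARD('n) / 2 < \<alpha>"
begin

abbreviation "wt k \<equiv> (1 + lam k) powr \<alpha>"
abbreviation "wt' k \<equiv> (1 + lam k) powr (- \<alpha>)"

lemma wt_wt': "wt k * wt' k = 1"
  using lam_nonneg[of k] by (simp flip: powr_add)

lemma alpha_pos: "0 < \<alpha>"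
  using \<alpha> by (smt (verit) divide_nonneg_nonneg of_nat_0_le_iff)

lemma sobolev_iff:
  "f \<in> sobolev \<phi> lam \<alpha> \<longleftrightarrow>
     continuous_on unit_cube f \<and> summable (\<lambda>k. wt k * (cube_inner f (\<phi> k))\<^sup>2)"
proof -
  have "summable (\<lambda>k. wt k * (cube_inner f (\<phi> k))\<^sup>2)" if "sobolev_norm2 \<phi> lam \<alpha> f < \<infinity>"
    using that unfolding sobolev_norm2_def by (intro summable_suminf_not_top) auto
  moreover have "sobolev_norm2 \<phi> lam \<alpha> f < \<infinity>" if "summable (\<lambda>k. wt k * (cube_inner f (\<phi> k))\<^sup>2)"
    using that unfolding sobolev_norm2_def by (subst suminf_ennreal2) auto
  ultimately show ?thesis by (auto simp: sobolev_def)
qed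

lemma sobolev_continuous: "f \<in> sobolev \<phi> lam \<alpha> \<Longrightarrow> continuous_on unit_cube f"
  and sobolev_summable: "f \<in> sobolev \<phi> lam \<alpha> \<Longrightarrow> summable (\<lambda>k. wt k * (cube_inner f (\<phi> k))\<^sup>2)"
  by (simp_all add: sobolev_iff)

definition sobolev_norm :: "(real ^ 'n \<Rightarrow> real) \<Rightarrow> real" where
  "sobolev_norm f = sqrt (enn2real (sobolev_norm2 \<phi> lam \<alpha> f))"

lemma sobolev_norm_eq:
  assumes "summable (\<lambda>k. wt k * (cube_inner f (\<phi> k))\<^sup>2)"
  shows "sobolev_norm f = sqrt (\<Sum>k. wt k * (cube_inner f (\<phi> k))\<^sup>2)"
  unfolding sobolev_norm_def sobolev_norm2_def using assms
  by (subst suminf_ennreal2) (auto intro!: enn2real_ennreal suminf_nonneg)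

lemma cube_inner_lin:
  assumes [continuous_intros]: "continuous_on unit_cube f" "continuous_on unit_cube g"
  shows "cube_inner (\<lambda>x. a * f x + b * g x) (\<phi> k) = a * cube_inner f (\<phi> k) + b * cube_inner g (\<phi> k)"
proof -
  have "integral unit_cube (\<lambda>x. (a * f x + b * g x) * \<phi> k x) =
     integral unit_cube (\<lambda>x. a * (f x * \<phi> k x) + b * (g x * \<phi> k x))" by (simp add: algebra_simps)
  also have "\<dots> = a * integral unit_cube (\<lambda>x. f x * \<phi> k x) + b * integral unit_cube (\<lambda>x. g x * \<phi> k x)"
    by (subst integral_add) (auto intro!: integrable_on_unit_cube continuous_intros)
  finally show ?thesis by (simp add: cube_inner_eq_integral continuous_intros assms)
qed

lemma sobolev_lin:
  assumes f: "f \<in> sobolev \<phi> lam \<alpha>" and g: "g \<in> sobolev \<phi> lam \<alpha>"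
  shows "(\<lambda>x. a * f x + b * g x) \<in> sobolev \<phi> lam \<alpha>"
proof -
  note [continuous_intros] = sobolev_continuous[OF f] sobolev_continuous[OF g]
  have "summable (\<lambda>k. wt k * (a * cube_inner f (\<phi> k) + b * cube_inner g (\<phi> k))\<^sup>2)"
  proof (rule summable_comparison_test'[where N = 0])
    show "summable (\<lambda>k. 2 * a\<^sup>2 * (wt k * (cube_inner f (\<phi> k))\<^sup>2) + 2 * b\<^sup>2 * (wt k * (cube_inner g (\<phi> k))\<^sup>2))"
      by (intro summable_add summable_mult sobolev_summable f g)
    fix k
    have "(a * cube_inner f (\<phi> k) + b * cube_inner g (\<phi> k))\<^sup>2 \<le>
        2 * (a * cube_inner f (\<phi> k))\<^sup>2 + 2 * (b * cube_inner g (\<phi> k))\<^sup>2"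
      using sum_squares_bound[of "a * cube_inner f (\<phi> k)" "b * cube_inner g (\<phi> k)"]
      by (simp add: power2_sum)
    from mult_left_mono[OF this, of "wt k"]
    show "norm (wt k * (a * cube_inner f (\<phi> k) + b * cube_inner g (\<phi> k))\<^sup>2) \<le>
        2 * a\<^sup>2 * (wt k * (cube_inner f (\<phi> k))\<^sup>2) + 2 * b\<^sup>2 * (wt k * (cube_inner g (\<phi> k))\<^sup>2)"
      by (simp add: algebra_simps power_mult_distrib)
  qed
  then show ?thesis unfolding sobolev_iff
    by (auto simp: cube_inner_lin sobolev_continuous[OF f] sobolev_continuous[OF g] intro!: continuous_intros)
qed

lemma cube_inner_phi: "cube_inner (\<phi> l) (\<phi> k) = (if l = k then 1 else 0)"
  by (simp add: cube_inner_eq_integral[OF continuous_on_phi continuous_on_phi] orthonormal)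

lemma phi_sobolev: "\<phi> l \<in> sobolev \<phi> lam \<alpha>"
  unfolding sobolev_iff cube_inner_phi
  by (auto simp: continuous_on_phi intro!: summable_finite[of "{l}"] split: if_splits)

lemma zero_sobolev: "(\<lambda>_. 0) \<in> sobolev \<phi> lam \<alpha>"
  using sobolev_lin[OF phi_sobolev phi_sobolev, of 0 _ 0] by simp

lemma sum_phi_sobolev:
  assumes "finite K"
  shows "(\<lambda>x. \<Sum>k\<in>K. c k * \<phi> k x) \<in> sobolev \<phi> lam \<alpha>"
  using assms
proof induction
  case empty
  then show ?case by (simp add: zero_sobolev)
next
  case (insert k K)
  then show ?case using sobolev_lin[OF phi_sobolev insert(3), of "c k" k 1] by simp
qed

lemma cube_inner_sum_phi:
  assumes "finite K"
  shows "cube_inner (\<lambda>x. \<Sum>k\<in>K. c k * \<phi> k x) (\<phi> l) = (if l \<in> K then c l else 0)"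
  using assms
proof induction
  case empty
  then show ?case by (simp add: cube_inner_def)
next
  case (insert k K)
  then show ?case
    using cube_inner_lin[OF continuous_on_phi sobolev_continuous[OF sum_phi_sobolev[OF insert(1)]], of "c k" k 1 c l]
    by (auto simp: cube_inner_phi)
qed

definition partial_sum :: "(real ^ 'n \<Rightarrow> real) \<Rightarrow> nat \<Rightarrow> real ^ 'n \<Rightarrow> real" where
  "partial_sum f n x = (\<Sum>k<n. cube_inner f (\<phi> k) * \<phi> k x)"

lemma partial_sum_sobolev: "partial_sum f n \<in> sobolev \<phi> lam \<alpha>"
  unfolding partial_sum_def[abs_def] by (rule sum_phi_sobolev) simp

lemma cube_inner_partial_sum:
  "cube_inner (partial_sum f n) (\<phi> k) = (if k < n then cube_inner f (\<phi> k) else 0)"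
  unfolding partial_sum_def[abs_def] using cube_inner_sum_phi[of "{..<n}"] by simp

text \<open>A uniform bound for the squared dual norm of the evaluation at a point of the cube; its
  root is the constant of the embedding into the continuous functions.\<close>

definition eval_const :: real where
  "eval_const = (SOME Z. 0 \<le> Z \<and> (\<forall>x\<in>unit_cube. \<forall>K. finite K \<longrightarrow> (\<Sum>k\<in>K. wt' k * (\<phi> k x)\<^sup>2) \<le> Z))"

lemma eval_const_nonneg: "0 \<le> eval_const"
  and weighted_sum_le_eval_const: "x \<in> unit_cube \<Longrightarrow> finite K \<Longrightarrow> (\<Sum>k\<in>K. wt' k * (\<phi> k x)\<^sup>2) \<le> eval_const"
  using someI_ex[of "\<lambda>Z. 0 \<le> Z \<and> (\<forall>x\<in>unit_cube. \<forall>K. finite K \<longrightarrow> (\<Sum>k\<in>K. wt' k * (\<phi> k x)\<^sup>2) \<le> Z)"]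
    weighted_sum_phi_squared_bounded[OF \<alpha>]
  unfolding eval_const_def[symmetric] by blast+

text \<open>Cauchy-Schwarz after inserting sqrt(wt k) sqrt(wt' k) = 1.\<close>

lemma sum_mult_le_sqrt_wt:
  "\<bar>\<Sum>k\<in>K. a k * b k\<bar> \<le> sqrt (\<Sum>k\<in>K. wt k * (a k)\<^sup>2) * sqrt (\<Sum>k\<in>K. wt' k * (b k)\<^sup>2)"
proof -
  have "(\<Sum>k\<in>K. a k * b k) = (\<Sum>k\<in>K. (sqrt (wt k) * a k) * (sqrt (wt' k) * b k))"
  proof (intro sum.cong refl)
    fix k
    have "sqrt (wt k) * sqrt (wt' k) = 1" using wt_wt'[of k] by (simp flip: real_sqrt_mult)
    then show "a k * b k = (sqrt (wt k) * a k) * (sqrt (wt' k) * b k)" by (simp add: mult_ac)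
  qed
  then have "(\<Sum>k\<in>K. a k * b k)\<^sup>2 \<le> (\<Sum>k\<in>K. (sqrt (wt k) * a k)\<^sup>2) * (\<Sum>k\<in>K. (sqrt (wt' k) * b k)\<^sup>2)"
    by (simp only: Cauchy_Schwarz_ineq_sum)
  also have "\<dots> = (\<Sum>k\<in>K. wt k * (a k)\<^sup>2) * (\<Sum>k\<in>K. wt' k * (b k)\<^sup>2)"
    by (simp add: power_mult_distrib)
  finally show ?thesis
    using real_sqrt_le_mono by (fastforce simp: real_sqrt_mult)
qed

text \<open>Sobolev embedding. The basis expansion is known to converge in the mean only. Finite
  norm and \<open>eval_const\<close> make the partial sums uniformly Cauchy; their limit g is
  continuous and at mean square distance 0 from f, so g = f at every point, and the bound passes to
  the limit.\<close>

lemma sobolev_pointwise_bound: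
  assumes f: "f \<in> sobolev \<phi> lam \<alpha>" and x: "x \<in> unit_cube"
  shows "\<bar>f x\<bar> \<le> sqrt eval_const * sobolev_norm f"
proof -
  let ?C = "unit_cube :: (real^'n) set"
  let ?c = "\<lambda>k. cube_inner f (\<phi> k)"
  note cf [continuous_intros] = sobolev_continuous[OF f]
  note cs [continuous_intros] = sobolev_continuous[OF partial_sum_sobolev[of f]]
  have bd: "\<bar>\<Sum>k\<in>K. ?c k * \<phi> k x\<bar> \<le> sqrt (\<Sum>k\<in>K. wt k * (?c k)\<^sup>2) * sqrt eval_const"
    if "x \<in> ?C" "finite K" for x K
    by (rule order_trans[OF sum_mult_le_sqrt_wt mult_left_mono[OF real_sqrt_le_mono[OF weighted_sum_le_eval_const[OF that]]]])
       (auto intro: sum_nonneg)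
  have "uniformly_Cauchy_on ?C (partial_sum f)"
  proof (rule uniformly_Cauchy_onI')
    fix e :: real assume e: "e > 0"
    \<comment> \<open>Makes sqrt e' * sqrt eval_const less than e; the summand 1 keeps the
      denominator positive when only nonnegativity of \<open>eval_const\<close> is known.\<close>
    define e' where "e' = (e / (sqrt eval_const + 1))\<^sup>2"
    have Z1: "sqrt eval_const + 1 > 0" using eval_const_nonneg by (simp add: add_nonneg_pos)
    have e': "e' > 0" using e Z1 by (simp add: e'_def)
    obtain M where M: "\<And>m n. m \<ge> M \<Longrightarrow> norm (\<Sum>k\<in>{m..<n}. wt k * (?c k)\<^sup>2) < e'"
      using sobolev_summable[OF f] e' unfolding summable_Cauchy by blast
    have "dist (partial_sum f m x) (partial_sum f n x) < e" if "x \<in> ?C" "M \<le> m" "m < n" for x m n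
    proof -
      have "partial_sum f n x - partial_sum f m x = (\<Sum>k\<in>{m..<n}. ?c k * \<phi> k x)"
        unfolding partial_sum_def using that
        by (subst sum_diff_nat_ivl[symmetric, of 0 m n]) (auto simp: atLeast0LessThan)
      then have "dist (partial_sum f m x) (partial_sum f n x) = \<bar>\<Sum>k\<in>{m..<n}. ?c k * \<phi> k x\<bar>"
        by (simp add: dist_real_def)
      also have "\<dots> \<le> sqrt (\<Sum>k\<in>{m..<n}. wt k * (?c k)\<^sup>2) * sqrt eval_const"
        by (rule bd) (use that in auto)
      also have "\<dots> \<le> sqrt e' * sqrt eval_const"
        using M[of m n] that by (intro mult_right_mono) (auto simp: eval_const_nonneg)
      also have "\<dots> = e * (sqrt eval_const / (sqrt eval_const + 1))" using e Z1 by (simp add: e'_def real_sqrt_divide)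
      also have "\<dots> < e * 1" using e Z1 by (intro mult_strict_left_mono) auto
      finally show ?thesis by simp
    qed
    then show "\<exists>M. \<forall>x\<in>?C. \<forall>m\<ge>M. \<forall>n>m. dist (partial_sum f m x) (partial_sum f n x) < e" by blast
  qed
  then obtain g where g: "uniform_limit ?C (partial_sum f) g sequentially"
    using Cauchy_uniformly_convergent by (auto simp: uniformly_convergent_on_def)
  have cg [continuous_intros]: "continuous_on ?C g"
    by (rule uniform_limit_theorem[OF _ g]) (auto intro!: always_eventually cs)
  have ul0: "uniform_limit ?C (\<lambda>n x. f x - partial_sum f n x) (\<lambda>x. f x - g x) sequentially"
    by (intro uniform_limit_minus uniform_limit_const g)
  have bdd: "bounded ((\<lambda>x. f x - g x) ` ?C)"
    by (intro compact_imp_bounded compact_continuous_image continuous_intros compact_unit_cube)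
  have "uniform_limit ?C (\<lambda>n x. (f x - partial_sum f n x) * (f x - partial_sum f n x))
      (\<lambda>x. (f x - g x) * (f x - g x)) sequentially"
    by (rule uniform_lim_mult[OF ul0 ul0 bdd bdd])
  then have ul: "uniform_limit ?C (\<lambda>n x. (f x - partial_sum f n x)\<^sup>2) (\<lambda>x. (f x - g x)\<^sup>2) sequentially"
    by (simp only: power2_eq_square)
  obtain I J where I: "\<And>n. ((\<lambda>x. (f x - partial_sum f n x)\<^sup>2) has_integral I n) ?C"
    and J: "((\<lambda>x. (f x - g x)\<^sup>2) has_integral J) ?C" and IJ: "I \<longlonglongrightarrow> J"
  proof (rule uniform_limit_integral_cbox[OF ul[unfolded unit_cube_def], folded unit_cube_def])
    show "continuous_on ?C (\<lambda>x. (f x - partial_sum f n x)\<^sup>2)" for n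
      by (intro continuous_intros)
  qed (auto intro: that)
  have "f \<in> cube_L2"
    unfolding cube_L2_def
    using set_integrable_unit_cube[OF cf] set_integrable_unit_cube[of "\<lambda>x. (f x)\<^sup>2"]
    by (auto simp: set_integrable_def set_borel_measurable_def intro!: continuous_intros)
  then have "(\<lambda>n. LINT x:?C|lborel. (f x - partial_sum f n x)\<^sup>2) \<longlonglongrightarrow> 0"
    using basis unfolding dirichlet_eigenbasis_def partial_sum_def by blast
  moreover have "(LINT x:?C|lborel. (f x - partial_sum f n x)\<^sup>2) = I n" for n
    using integral_unique[OF I] by (subst LINT_unit_cube) (auto intro!: continuous_intros)
  ultimately have "J = 0" using LIMSEQ_unique[OF IJ] by simp
  with J have "integral ?C (\<lambda>x. (f x - g x)\<^sup>2) = 0" by (simp add: integral_unique)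
  then have "(f x - g x)\<^sup>2 = 0"
    using x by (intro integral_unit_cube_eq_0_imp[of "\<lambda>x. (f x - g x)\<^sup>2"]) (auto intro!: continuous_intros)
  then have lim: "(\<lambda>n. partial_sum f n x) \<longlonglongrightarrow> f x"
    using tendsto_uniform_limitI[OF g x] by simp
  show "\<bar>f x\<bar> \<le> sqrt eval_const * sobolev_norm f"
  proof (rule LIMSEQ_le_const2[OF tendsto_rabs[OF lim]], intro exI allI impI)
    fix n
    have "\<bar>partial_sum f n x\<bar> \<le> sqrt (\<Sum>k<n. wt k * (?c k)\<^sup>2) * sqrt eval_const"
      unfolding partial_sum_def by (rule bd) (use x in auto)
    also have "\<dots> \<le> sobolev_norm f * sqrt eval_const"
      unfolding sobolev_norm_eq[OF sobolev_summable[OF f]]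
      by (intro mult_right_mono real_sqrt_le_mono sum_le_suminf sobolev_summable f) (auto simp: eval_const_nonneg)
    finally show "\<bar>partial_sum f n x\<bar> \<le> sqrt eval_const * sobolev_norm f" by (simp add: mult.commute)
  qed
qed

section \<open>The dual space as a weighted sequence space\<close>

abbreviation "dual \<equiv> sobolev_dual \<phi> lam \<alpha>"

lemma dual_lin:
  assumes "\<Phi> \<in> dual" "f \<in> sobolev \<phi> lam \<alpha>" "g \<in> sobolev \<phi> lam \<alpha>"
  shows "\<Phi> (\<lambda>x. a * f x + b * g x) = a * \<Phi> f + b * \<Phi> g"
  using assms unfolding sobolev_dual_def by blast

lemma dual_sum_phi:
  assumes \<Phi>: "\<Phi> \<in> dual" and "finite K"
  shows "\<Phi> (\<lambda>x. \<Sum>k\<in>K. c k * \<phi> k x) = (\<Sum>k\<in>K. c k * \<Phi> (\<phi> k))"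
  using assms(2)
proof induction
  case empty
  then show ?case using dual_lin[OF \<Phi> zero_sobolev zero_sobolev, of 0 0] by simp
next
  case (insert k K)
  then show ?case
    using dual_lin[OF \<Phi> phi_sobolev sum_phi_sobolev[OF insert(1)], of "c k" k 1 c] by simp
qed

lemma dual_bounded:
  assumes "\<Phi> \<in> dual"
  obtains B where "0 \<le> B" "\<And>f. f \<in> sobolev \<phi> lam \<alpha> \<Longrightarrow> \<bar>\<Phi> f\<bar> \<le> B * sobolev_norm f"
proof -
  obtain B where B: "\<And>f. f \<in> sobolev \<phi> lam \<alpha> \<Longrightarrow> \<bar>\<Phi> f\<bar> \<le> B * sobolev_norm f"
    using assms unfolding sobolev_dual_def sobolev_norm_def by blast
  have "\<bar>\<Phi> f\<bar> \<le> max 0 B * sobolev_norm f" if "f \<in> sobolev \<phi> lam \<alpha>" for f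
    by (rule order_trans[OF B[OF that] mult_right_mono]) (auto simp: sobolev_norm_def)
  then show thesis using that[of "max 0 B"] by simp
qed

text \<open>Test \<Phi> on the truncation of its own Riesz representative, with coefficients
  \<open>wt' k * \<Phi> (\<phi> k)\<close>. Its squared norm and its image under \<Phi> both equal
  the partial sum S, so S \<le> B sqrt S and S \<le> B^2.\<close>

lemma dual_summable:
  assumes \<Phi>: "\<Phi> \<in> dual"
  shows "summable (\<lambda>k. wt' k * (\<Phi> (\<phi> k))\<^sup>2)"
proof -
  obtain B where B0: "0 \<le> B" and B: "\<And>f. f \<in> sobolev \<phi> lam \<alpha> \<Longrightarrow> \<bar>\<Phi> f\<bar> \<le> B * sobolev_norm f"
    using dual_bounded[OF \<Phi>] by blast
  show ?thesis
  proof (rule summableI_nonneg_bounded)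
    fix n
    define S where "S = (\<Sum>k<n. wt' k * (\<Phi> (\<phi> k))\<^sup>2)"
    let ?f = "\<lambda>x. \<Sum>k<n. (wt' k * \<Phi> (\<phi> k)) * \<phi> k x"
    have S0: "0 \<le> S" unfolding S_def by (intro sum_nonneg) auto
    have coef: "cube_inner ?f (\<phi> k) = (if k < n then wt' k * \<Phi> (\<phi> k) else 0)" for k
      using cube_inner_sum_phi[of "{..<n}"] by simp
    have fs: "?f \<in> sobolev \<phi> lam \<alpha>" by (rule sum_phi_sobolev) simp
    have "sobolev_norm ?f = sqrt (\<Sum>k<n. wt k * (wt' k * \<Phi> (\<phi> k))\<^sup>2)"
      unfolding sobolev_norm_eq[OF sobolev_summable[OF fs]] coef
      by (subst suminf_finite[of "{..<n}"]) auto
    also have "(\<Sum>k<n. wt k * (wt' k * \<Phi> (\<phi> k))\<^sup>2) = S"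
      unfolding S_def
    proof (intro sum.cong refl)
      fix k
      have "wt k * (wt' k * \<Phi> (\<phi> k))\<^sup>2 = (wt k * wt' k) * (wt' k * (\<Phi> (\<phi> k))\<^sup>2)"
        by (simp only: power2_eq_square mult_ac)
      then show "wt k * (wt' k * \<Phi> (\<phi> k))\<^sup>2 = wt' k * (\<Phi> (\<phi> k))\<^sup>2" by (simp only: wt_wt' mult_1)
    qed
    finally have nf: "sobolev_norm ?f = sqrt S" .
    have "\<Phi> ?f = S"
      unfolding dual_sum_phi[OF \<Phi> finite_lessThan] S_def by (simp add: power2_eq_square mult.assoc)
    with B[OF fs] nf S0 have "S \<le> B * sqrt S" by simp
    then have "sqrt S * sqrt S \<le> B * sqrt S" using S0 by simp
    then have "sqrt S \<le> B" using B0 by (smt (verit) mult_right_le_imp_le)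
    then show "(\<Sum>k<n. wt' k * (\<Phi> (\<phi> k))\<^sup>2) \<le> B\<^sup>2"
      unfolding S_def[symmetric] by (rule sqrt_le_D)
  qed auto
qed

text \<open>The norm of f minus its partial sum is the root of a tail of a convergent series, so a
  bounded functional is determined by its values on the basis.\<close>

lemma dual_sums:
  assumes \<Phi>: "\<Phi> \<in> dual" and f: "f \<in> sobolev \<phi> lam \<alpha>"
  shows "(\<lambda>k. cube_inner f (\<phi> k) * \<Phi> (\<phi> k)) sums \<Phi> f"
proof -
  obtain B where B0: "0 \<le> B" and B: "\<And>f. f \<in> sobolev \<phi> lam \<alpha> \<Longrightarrow> \<bar>\<Phi> f\<bar> \<le> B * sobolev_norm f"
    using dual_bounded[OF \<Phi>] by blast
  let ?a = "\<lambda>k. wt k * (cube_inner f (\<phi> k))\<^sup>2"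
  have "(\<lambda>n. \<Phi> f - (\<Sum>k<n. cube_inner f (\<phi> k) * \<Phi> (\<phi> k))) \<longlonglongrightarrow> 0"
  proof (rule Lim_null_comparison)
    have "(\<lambda>n. \<Sum>k. ?a (k + n)) \<longlonglongrightarrow> 0"
      using suminf_exist_split2[OF sobolev_summable[OF f]] .
    then show "(\<lambda>n. B * sqrt (\<Sum>k. ?a (k + n))) \<longlonglongrightarrow> 0"
      by (intro tendsto_mult_right_zero) (use tendsto_real_sqrt in force)
    show "\<forall>\<^sub>F n in sequentially. norm (\<Phi> f - (\<Sum>k<n. cube_inner f (\<phi> k) * \<Phi> (\<phi> k))) \<le> B * sqrt (\<Sum>k. ?a (k + n))"
    proof (intro always_eventually allI)
      fix n
      let ?r = "\<lambda>x. 1 * f x + (- 1) * partial_sum f n x"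
      have r: "?r \<in> sobolev \<phi> lam \<alpha>" by (intro sobolev_lin f partial_sum_sobolev)
      have "\<Phi> ?r = 1 * \<Phi> f + (- 1) * \<Phi> (partial_sum f n)" by (intro dual_lin \<Phi> f partial_sum_sobolev)
      also have "\<Phi> (partial_sum f n) = (\<Sum>k<n. cube_inner f (\<phi> k) * \<Phi> (\<phi> k))"
        unfolding partial_sum_def[abs_def] by (rule dual_sum_phi[OF \<Phi>]) simp
      finally have \<Phi>r: "\<Phi> ?r = \<Phi> f - (\<Sum>k<n. cube_inner f (\<phi> k) * \<Phi> (\<phi> k))" by simp
      have coef: "cube_inner ?r (\<phi> k) = (if k < n then 0 else cube_inner f (\<phi> k))" for k
        by (subst cube_inner_lin) (auto simp: cube_inner_partial_sum intro: sobolev_continuous f partial_sum_sobolev)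
      have "(\<Sum>k. wt k * (cube_inner ?r (\<phi> k))\<^sup>2) = (\<Sum>k. wt (k + n) * (cube_inner ?r (\<phi> (k + n)))\<^sup>2) +
          (\<Sum>k<n. wt k * (cube_inner ?r (\<phi> k))\<^sup>2)"
        by (rule suminf_split_initial_segment[OF sobolev_summable[OF r]])
      then have "sobolev_norm ?r = sqrt (\<Sum>k. ?a (k + n))"
        unfolding sobolev_norm_eq[OF sobolev_summable[OF r]] coef by simp
      then show "norm (\<Phi> f - (\<Sum>k<n. cube_inner f (\<phi> k) * \<Phi> (\<phi> k))) \<le> B * sqrt (\<Sum>k. ?a (k + n))"
        using B[OF r] \<Phi>r by simp
    qed
  qed
  then have "(\<lambda>n. \<Sum>k<n. cube_inner f (\<phi> k) * \<Phi> (\<phi> k)) \<longlonglongrightarrow> \<Phi> f"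
    using tendsto_diff[OF tendsto_const[of "\<Phi> f"], of _ 0] by fastforce
  then show ?thesis by (simp add: sums_def)
qed

text \<open>Inverse of the coordinate map from \<Phi> to its values on the basis; it produces limit
  points in the dual from limits of coordinates.\<close>

definition dual_of_coeffs :: "(nat \<Rightarrow> real) \<Rightarrow> (real ^ 'n \<Rightarrow> real) \<Rightarrow> real" where
  "dual_of_coeffs x = restrict (\<lambda>f. \<Sum>k. cube_inner f (\<phi> k) * x k) (sobolev \<phi> lam \<alpha>)"

lemma
  assumes x: "summable (\<lambda>k. wt' k * (x k)\<^sup>2)"
  shows dual_of_coeffs_in: "dual_of_coeffs x \<in> dual"
    and dual_of_coeffs_phi: "dual_of_coeffs x (\<phi> l) = x l"
proof -
  let ?S = "sqrt (\<Sum>k. wt' k * (x k)\<^sup>2)"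
  have s: "summable (\<lambda>k. \<bar>cube_inner f (\<phi> k) * x k\<bar>)"
    and b: "(\<Sum>k. \<bar>cube_inner f (\<phi> k) * x k\<bar>) \<le> ?S * sobolev_norm f" if f: "f \<in> sobolev \<phi> lam \<alpha>" for f
  proof -
    have bd: "(\<Sum>k<n. \<bar>cube_inner f (\<phi> k) * x k\<bar>) \<le> ?S * sobolev_norm f" for n
    proof -
      have "(\<Sum>k<n. \<bar>cube_inner f (\<phi> k) * x k\<bar>) \<le>
          sqrt (\<Sum>k<n. wt k * (\<bar>cube_inner f (\<phi> k)\<bar>)\<^sup>2) * sqrt (\<Sum>k<n. wt' k * \<bar>x k\<bar>\<^sup>2)"
        using sum_mult_le_sqrt_wt[of "\<lambda>k. \<bar>cube_inner f (\<phi> k)\<bar>" "\<lambda>k. \<bar>x k\<bar>" "{..<n}"]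
        by (simp add: abs_mult sum_nonneg)
      also have "\<dots> \<le> sobolev_norm f * ?S"
        unfolding sobolev_norm_eq[OF sobolev_summable[OF f]] power2_abs
        by (intro mult_mono real_sqrt_le_mono sum_le_suminf sobolev_summable f x)
           (auto intro!: suminf_nonneg sum_nonneg sobolev_summable f)
      finally show ?thesis by (simp add: mult.commute)
    qed
    show s: "summable (\<lambda>k. \<bar>cube_inner f (\<phi> k) * x k\<bar>)"
      by (rule summableI_nonneg_bounded[OF _ bd]) auto
    show "(\<Sum>k. \<bar>cube_inner f (\<phi> k) * x k\<bar>) \<le> ?S * sobolev_norm f"
      by (rule suminf_le_const[OF s bd])
  qed
  show "dual_of_coeffs x (\<phi> l) = x l"
    unfolding dual_of_coeffs_def using phi_sobolev[of l]
    by (simp add: cube_inner_phi) (subst suminf_finite[of "{l}"], auto)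
  show "dual_of_coeffs x \<in> dual"
    unfolding sobolev_dual_def mem_Collect_eq
  proof (intro conjI ballI allI exI)
    show "dual_of_coeffs x \<in> extensional (sobolev \<phi> lam \<alpha>)" by (simp add: dual_of_coeffs_def)
  next
    fix f g a b assume f: "f \<in> sobolev \<phi> lam \<alpha>" and g: "g \<in> sobolev \<phi> lam \<alpha>"
    have "(\<Sum>k. cube_inner (\<lambda>x. a * f x + b * g x) (\<phi> k) * x k) =
        (\<Sum>k. a * (cube_inner f (\<phi> k) * x k) + b * (cube_inner g (\<phi> k) * x k))"
      by (simp add: cube_inner_lin sobolev_continuous f g algebra_simps)
    also have "\<dots> = a * (\<Sum>k. cube_inner f (\<phi> k) * x k) + b * (\<Sum>k. cube_inner g (\<phi> k) * x k)"
      using summable_rabs_cancel[OF s[OF f]] summable_rabs_cancel[OF s[OF g]]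
      by (simp add: suminf_add[symmetric] suminf_mult summable_mult)
    finally show "dual_of_coeffs x (\<lambda>x. a * f x + b * g x) = a * dual_of_coeffs x f + b * dual_of_coeffs x g"
      using f g by (simp add: dual_of_coeffs_def sobolev_lin)
  next
    fix f assume f: "f \<in> sobolev \<phi> lam \<alpha>"
    have "\<bar>dual_of_coeffs x f\<bar> \<le> (\<Sum>k. \<bar>cube_inner f (\<phi> k) * x k\<bar>)"
      using f summable_rabs[OF s[OF f]] by (simp add: dual_of_coeffs_def)
    also note b[OF f]
    finally show "\<bar>dual_of_coeffs x f\<bar> \<le> ?S * sqrt (enn2real (sobolev_norm2 \<phi> lam \<alpha> f))"
      by (simp add: sobolev_norm_def)
  qed
qed

lemma summable_weighted_diff:
  assumes "summable (\<lambda>k. wt' k * (x k)\<^sup>2)" "summable (\<lambda>k. wt' k * (y k)\<^sup>2)"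
  shows "summable (\<lambda>k. wt' k * (x k - y k)\<^sup>2)"
  using summable_sum_squared[of "\<lambda>k. sqrt (wt' k) * x k" "\<lambda>k. - (sqrt (wt' k) * y k)"] assms
  by (simp add: power_mult_distrib right_diff_distrib[symmetric])

text \<open>\<open>enn2real\<close> sends infinity to 0, so the formula relies on the weighted
  square summability of the coordinates of dual elements.\<close>

lemma dual_dist_eq:
  assumes "\<Phi> \<in> dual" "\<Psi> \<in> dual"
  shows "dual_dist \<phi> lam \<alpha> \<Phi> \<Psi> = sqrt (\<Sum>k. wt' k * (\<Phi> (\<phi> k) - \<Psi> (\<phi> k))\<^sup>2)"
proof -
  have "summable (\<lambda>k. wt' k * (\<Phi> (\<phi> k) - \<Psi> (\<phi> k))\<^sup>2)"
    by (intro summable_weighted_diff dual_summable assms)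
  then show ?thesis unfolding dual_dist_def dual_norm2_def
    by (subst suminf_ennreal2) (auto intro!: enn2real_ennreal suminf_nonneg)
qed

text \<open>Extensionality fixes the values outside the Sobolev space; inside it the coordinates
  decide. This is the separation property of the metric.\<close>

lemma dual_eqI:
  assumes "\<Phi> \<in> dual" "\<Psi> \<in> dual" "\<And>k. \<Phi> (\<phi> k) = \<Psi> (\<phi> k)"
  shows "\<Phi> = \<Psi>"
proof (rule extensionalityI[of _ "sobolev \<phi> lam \<alpha>"])
  show "\<Phi> \<in> extensional (sobolev \<phi> lam \<alpha>)" "\<Psi> \<in> extensional (sobolev \<phi> lam \<alpha>)"
    using assms by (auto simp: sobolev_dual_def)
  fix f assume "f \<in> sobolev \<phi> lam \<alpha>"
  then show "\<Phi> f = \<Psi> f"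
    using dual_sums[OF assms(1)] dual_sums[OF assms(2)] sums_unique2 by (fastforce simp: assms(3))
qed

sublocale dual_metric: Metric_space "sobolev_dual \<phi> lam \<alpha>" "dual_dist \<phi> lam \<alpha>"
proof
  fix \<Phi> \<Psi> \<Theta>
  show "0 \<le> dual_dist \<phi> lam \<alpha> \<Phi> \<Psi>" by (simp add: dual_dist_def)
  show "dual_dist \<phi> lam \<alpha> \<Phi> \<Psi> = dual_dist \<phi> lam \<alpha> \<Psi> \<Phi>"
    by (simp add: dual_dist_def dual_norm2_def power2_commute)
  assume \<Phi>: "\<Phi> \<in> dual" and \<Psi>: "\<Psi> \<in> dual"
  have s: "summable (\<lambda>k. wt' k * (\<Phi> (\<phi> k) - \<Psi> (\<phi> k))\<^sup>2)"
    by (intro summable_weighted_diff dual_summable \<Phi> \<Psi>)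
  have "(\<Sum>k. wt' k * (\<Phi> (\<phi> k) - \<Psi> (\<phi> k))\<^sup>2) = 0 \<longleftrightarrow> (\<forall>k. \<Phi> (\<phi> k) = \<Psi> (\<phi> k))"
    by (subst suminf_eq_zero_iff[OF s]) (use lam_nonneg in \<open>auto simp: add_nonneg_eq_0_iff\<close>)
  then show "dual_dist \<phi> lam \<alpha> \<Phi> \<Psi> = 0 \<longleftrightarrow> \<Phi> = \<Psi>"
    using dual_eqI[OF \<Phi> \<Psi>] by (auto simp: dual_dist_eq \<Phi> \<Psi>)
  assume \<Theta>: "\<Theta> \<in> dual"
  have s': "summable (\<lambda>k. wt' k * (\<Psi> (\<phi> k) - \<Theta> (\<phi> k))\<^sup>2)"
    by (intro summable_weighted_diff dual_summable \<Theta> \<Psi>)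
  have "wt' k * (\<Phi> (\<phi> k) - \<Theta> (\<phi> k))\<^sup>2 =
      (sqrt (wt' k) * (\<Phi> (\<phi> k) - \<Psi> (\<phi> k)) + sqrt (wt' k) * (\<Psi> (\<phi> k) - \<Theta> (\<phi> k)))\<^sup>2" for k
    by (simp add: power_mult_distrib flip: distrib_left)
  then show "dual_dist \<phi> lam \<alpha> \<Phi> \<Theta> \<le> dual_dist \<phi> lam \<alpha> \<Phi> \<Psi> + dual_dist \<phi> lam \<alpha> \<Psi> \<Theta>"
    using sqrt_suminf_sum_squared_le[of "\<lambda>k. sqrt (wt' k) * (\<Phi> (\<phi> k) - \<Psi> (\<phi> k))"
        "\<lambda>k. sqrt (wt' k) * (\<Psi> (\<phi> k) - \<Theta> (\<phi> k))"] s s'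
    by (simp add: dual_dist_eq \<Phi> \<Psi> \<Theta> power_mult_distrib)
qed

end

section \<open>Compact balls in the dual space\<close>

text \<open>Tychonoff's theorem for a product of intervals; it plays the role of a diagonal
  argument.\<close>

lemma compact_box_fun:
  fixes r :: "nat \<Rightarrow> real"
  shows "compact {x. \<forall>k. \<bar>x k\<bar> \<le> r k}"
proof -
  have "compactin (product_topology (\<lambda>_::nat. euclideanreal) UNIV) (PiE UNIV (\<lambda>k. {- r k .. r k}))"
    by (subst compactin_PiE) auto
  moreover have "PiE UNIV (\<lambda>k. {- r k .. r k}) = {x. \<forall>k. \<bar>x k\<bar> \<le> r k}"
    by (auto simp: PiE_def abs_le_iff minus_le_iff Pi_def)
  ultimately show ?thesis by (simp add: euclidean_product_topology)
qed

text \<open>Bounds on finite partial sums survive coordinatewise limits, whereas the norm itself is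
  not continuous under them.\<close>

lemma dual_norm2_le_iff:
  assumes "0 \<le> R"
  shows "dual_norm2 \<phi> lam \<alpha> \<Phi> \<le> ennreal R \<longleftrightarrow> (\<forall>n. (\<Sum>k<n. (1 + lam k) powr (- \<alpha>) * (\<Phi> (\<phi> k))\<^sup>2) \<le> R)"
proof -
  have *: "(\<Sum>k<n. ennreal ((1 + lam k) powr (- \<alpha>) * (\<Phi> (\<phi> k))\<^sup>2)) =
      ennreal (\<Sum>k<n. (1 + lam k) powr (- \<alpha>) * (\<Phi> (\<phi> k))\<^sup>2)" for n
    by (simp add: sum_ennreal)
  show ?thesis
  proof
    assume L: "dual_norm2 \<phi> lam \<alpha> \<Phi> \<le> ennreal R"
    show "\<forall>n. (\<Sum>k<n. (1 + lam k) powr (- \<alpha>) * (\<Phi> (\<phi> k))\<^sup>2) \<le> R"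
    proof
      fix n
      have "(\<Sum>k<n. ennreal ((1 + lam k) powr (- \<alpha>) * (\<Phi> (\<phi> k))\<^sup>2)) \<le> dual_norm2 \<phi> lam \<alpha> \<Phi>"
        unfolding dual_norm2_def by (intro sum_le_suminf) auto
      from order_trans[OF this L] show "(\<Sum>k<n. (1 + lam k) powr (- \<alpha>) * (\<Phi> (\<phi> k))\<^sup>2) \<le> R"
        unfolding * by (simp only: ennreal_le_iff[OF assms])
    qed
  next
    assume R: "\<forall>n. (\<Sum>k<n. (1 + lam k) powr (- \<alpha>) * (\<Phi> (\<phi> k))\<^sup>2) \<le> R"
    show "dual_norm2 \<phi> lam \<alpha> \<Phi> \<le> ennreal R"
      unfolding dual_norm2_def
      by (intro suminf_le_const) (auto simp: * R intro!: ennreal_leI)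
  qed
qed

context sobolev_scale
begin

text \<open>Growth of the eigenvalues is read off from the summability of \<open>wt'\<close>, whose
  terms tend to 0; the power b/\<alpha> adjusts the exponent.\<close>

lemma powr_one_plus_lam_tendsto_0:
  assumes "0 < b"
  shows "(\<lambda>k. (1 + lam k) powr (- b)) \<longlonglongrightarrow> 0"
proof -
  have "(\<lambda>k. wt' k powr (b / \<alpha>)) \<longlonglongrightarrow> 0"
    by (rule tendsto_zero_powrI[OF summable_LIMSEQ_zero[OF summable_lam_powr[OF \<alpha>]] tendsto_const])
       (use alpha_pos assms in auto)
  then show ?thesis using alpha_pos by (simp add: powr_powr)
qed

text \<open>A Rellich argument. Coordinates of the ball are bounded, so a subsequence converges in
  every coordinate. The weight of order \<alpha> is that of order \<alpha>' times a factor tending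
  to 0, which makes the tails uniformly small and the convergence metric. The limit obeys the same
  bound R, so the ball itself is compact and not merely its closure.\<close>

lemma compactin_dual_ball:
  assumes a': "\<alpha>' < \<alpha>" and R: "0 \<le> R"
  shows "compactin dual_metric.mtopology {\<Phi> \<in> dual. dual_norm2 \<phi> lam \<alpha>' \<Phi> \<le> ennreal R}"
    (is "compactin _ ?K")
  unfolding dual_metric.compactin_sequentially
proof (intro conjI allI impI)
  fix \<sigma> :: "nat \<Rightarrow> (real ^ 'n \<Rightarrow> real) \<Rightarrow> real" assume \<sigma>: "range \<sigma> \<subseteq> ?K"
  define v where "v k = (1 + lam k) powr (- \<alpha>')" for k
  have vpos: "0 < v k" for k using lam_nonneg[of k] by (simp add: v_def)
  have \<sigma>_dual: "\<sigma> j \<in> dual" for j using \<sigma> by auto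
  have \<sigma>_R: "(\<Sum>k<n. v k * (\<sigma> j (\<phi> k))\<^sup>2) \<le> R" for j n
    using \<sigma> dual_norm2_le_iff[OF R, of \<phi> lam \<alpha>' "\<sigma> j"] by (auto simp: v_def)
  define r where "r k = sqrt (R / v k)" for k
  have "\<bar>\<sigma> j (\<phi> k)\<bar> \<le> r k" for j k
  proof -
    have "v k * (\<sigma> j (\<phi> k))\<^sup>2 \<le> (\<Sum>k<Suc k. v k * (\<sigma> j (\<phi> k))\<^sup>2)"
      by (intro member_le_sum) (auto intro: mult_nonneg_nonneg less_imp_le[OF vpos])
    also have "\<dots> \<le> R" by (rule \<sigma>_R)
    finally have "(\<sigma> j (\<phi> k))\<^sup>2 \<le> R / v k" using vpos[of k] by (simp add: field_simps)
    then show ?thesis unfolding r_def by (metis real_sqrt_abs real_sqrt_le_mono)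
  qed
  then have "\<forall>j. (\<lambda>k. \<sigma> j (\<phi> k)) \<in> {x. \<forall>k. \<bar>x k\<bar> \<le> r k}" by simp
  from seq_compactE[OF compact_imp_seq_compact[OF compact_box_fun] this]
  obtain l s where s: "strict_mono s" and l: "((\<lambda>j k. \<sigma> j (\<phi> k)) \<circ> s) \<longlonglongrightarrow> l" by blast
  have lk: "(\<lambda>j. \<sigma> (s j) (\<phi> k)) \<longlonglongrightarrow> l k" for k
  proof -
    have "isCont (\<lambda>x :: nat \<Rightarrow> real. x k) l"
      by (rule continuous_on_interior[OF continuous_on_product_coordinates]) auto
    from isCont_tendsto_compose[OF this l] show ?thesis by (simp add: o_def)
  qed
  have l_R: "(\<Sum>k<n. v k * (l k)\<^sup>2) \<le> R" for n
  proof (rule LIMSEQ_le_const2)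
    show "(\<lambda>j. \<Sum>k<n. v k * (\<sigma> (s j) (\<phi> k))\<^sup>2) \<longlonglongrightarrow> (\<Sum>k<n. v k * (l k)\<^sup>2)"
      by (intro tendsto_intros lk)
  qed (use \<sigma>_R in auto)
  have wtv: "wt' k \<le> v k" for k
    unfolding v_def using lam_nonneg[of k] a' by (intro powr_mono) auto
  have suml: "summable (\<lambda>k. wt' k * (l k)\<^sup>2)"
  proof (rule summableI_nonneg_bounded)
    show "(\<Sum>k<n. wt' k * (l k)\<^sup>2) \<le> R" for n
      by (rule order_trans[OF sum_mono l_R]) (intro mult_right_mono wtv, auto)
  qed auto
  define \<Phi> where "\<Phi> = dual_of_coeffs l"
  have \<Phi>: "\<Phi> \<in> dual" "\<And>k. \<Phi> (\<phi> k) = l k"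
    unfolding \<Phi>_def by (auto simp: dual_of_coeffs_in dual_of_coeffs_phi suml)
  have "dual_norm2 \<phi> lam \<alpha>' \<Phi> \<le> ennreal R"
    using l_R by (subst dual_norm2_le_iff[OF R]) (auto simp: \<Phi> v_def)
  moreover have "limitin dual_metric.mtopology (\<sigma> \<circ> s) \<Phi> sequentially"
    unfolding dual_metric.limitin_metric_dist_null
  proof (intro conjI always_eventually allI)
    let ?D = "\<lambda>j. \<Sum>k. wt' k * (\<sigma> (s j) (\<phi> k) - l k)\<^sup>2"
    have sumD: "summable (\<lambda>k. wt' k * (\<sigma> (s j) (\<phi> k) - l k)\<^sup>2)" for j
      by (intro summable_weighted_diff dual_summable \<sigma>_dual suml)
    have D0: "0 \<le> ?D j" for j by (intro suminf_nonneg sumD) auto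
    have "?D \<longlonglongrightarrow> 0"
    proof (rule LIMSEQ_I)
      fix e :: real assume e: "0 < e"
      \<comment> \<open>The weighted squared differences of two sequences bounded by R sum to at
        most 4 R, so the tail costs at most e/2; the summand 1 covers R = 0.\<close>
      define e' where "e' = e / (2 * (4 * R + 1))"
      have e': "0 < e'" using e R by (simp add: e'_def)
      have "eventually (\<lambda>k. (1 + lam k) powr (- (\<alpha> - \<alpha>')) < e') sequentially"
        using order_tendstoD(2)[OF powr_one_plus_lam_tendsto_0 e', of "\<alpha> - \<alpha>'"] a' by simp
      then obtain m where m: "\<And>k. m \<le> k \<Longrightarrow> (1 + lam k) powr (- (\<alpha> - \<alpha>')) < e'"
        by (auto simp: eventually_sequentially)
      have wt_le: "wt' k \<le> e' * v k" if "m \<le> k" for k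
      proof -
        have "wt' k = (1 + lam k) powr (- (\<alpha> - \<alpha>')) * v k" by (simp add: v_def flip: powr_add)
        then show ?thesis using m[OF that] vpos[of k] by simp
      qed
      have head: "(\<lambda>j. \<Sum>k<m. wt' k * (\<sigma> (s j) (\<phi> k) - l k)\<^sup>2) \<longlonglongrightarrow> (\<Sum>k<m. wt' k * (l k - l k)\<^sup>2)"
        by (intro tendsto_intros lk)
      obtain J where J: "\<And>j. J \<le> j \<Longrightarrow> (\<Sum>k<m. wt' k * (\<sigma> (s j) (\<phi> k) - l k)\<^sup>2) < e / 2"
        using order_tendstoD(2)[OF head, of "e / 2"] e by (auto simp: eventually_sequentially)
      have "?D j < e" if "J \<le> j" for j
      proof -
        let ?d = "\<lambda>k. (\<sigma> (s j) (\<phi> k) - l k)\<^sup>2"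
        have "?D j \<le> (\<Sum>k<m. wt' k * ?d k) + e' * (4 * R)"
        proof (rule suminf_le_const[OF sumD])
          fix n
          \<comment> \<open>Below m the first summand already suffices; from m on
            \<open>wt_le\<close> applies. Adding the second summand for all k is harmless as it is
            nonnegative.\<close>
          have "(\<Sum>k<n. wt' k * ?d k) \<le> (\<Sum>k<n. (if k < m then wt' k * ?d k else 0) + e' * (v k * ?d k))"
          proof (rule sum_mono)
            fix k
            show "wt' k * ?d k \<le> (if k < m then wt' k * ?d k else 0) + e' * (v k * ?d k)"
              using wt_le[of k] e' vpos[of k]
              by (auto simp: mult.assoc[symmetric] intro!: mult_right_mono mult_nonneg_nonneg)
          qed
          also have "\<dots> = (\<Sum>k<n. if k < m then wt' k * ?d k else 0) + e' * (\<Sum>k<n. v k * ?d k)"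
            by (simp add: sum.distrib sum_distrib_left)
          also have "(\<Sum>k<n. if k < m then wt' k * ?d k else 0) = (\<Sum>k\<in>{..<n} \<inter> {..<m}. wt' k * ?d k)"
            by (subst sum.inter_restrict) auto
          also have "\<dots> \<le> (\<Sum>k<m. wt' k * ?d k)" by (intro sum_mono2) auto
          also have "(\<Sum>k<n. v k * ?d k) \<le> (\<Sum>k<n. 2 * (v k * (\<sigma> (s j) (\<phi> k))\<^sup>2) + 2 * (v k * (l k)\<^sup>2))"
          proof (rule sum_mono)
            fix k
            have "?d k \<le> 2 * (\<sigma> (s j) (\<phi> k))\<^sup>2 + 2 * (l k)\<^sup>2"
              using zero_le_power2[of "\<sigma> (s j) (\<phi> k) + l k"] by (simp add: power2_sum power2_diff)
            from mult_left_mono[OF this, of "v k"]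
            show "v k * ?d k \<le> 2 * (v k * (\<sigma> (s j) (\<phi> k))\<^sup>2) + 2 * (v k * (l k)\<^sup>2)"
              using vpos[of k] by (simp add: algebra_simps)
          qed
          also have "\<dots> \<le> 4 * R"
            using \<sigma>_R[of "s j" n] l_R[of n] by (simp add: sum.distrib flip: sum_distrib_left)
          finally show "(\<Sum>k<n. wt' k * ?d k) \<le> (\<Sum>k<m. wt' k * ?d k) + e' * (4 * R)"
            using e' by simp
        qed
        also have "e' * (4 * R) \<le> e / 2" using e R by (simp add: e'_def field_simps)
        finally show ?thesis using J[OF that] by simp
      qed
      then show "\<exists>J. \<forall>j\<ge>J. norm (?D j - 0) < e" using D0 by auto
    qed
    then have "(\<lambda>j. sqrt (?D j)) \<longlonglongrightarrow> 0" using tendsto_real_sqrt by fastforce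
    then show "(\<lambda>j. dual_dist \<phi> lam \<alpha> ((\<sigma> \<circ> s) j) \<Phi>) \<longlonglongrightarrow> 0"
      using dual_dist_eq[OF \<sigma>_dual \<Phi>(1)] by (simp add: \<Phi>)
  qed (use \<Phi> \<sigma>_dual in auto)
  ultimately show "\<exists>l r. l \<in> ?K \<and> strict_mono r \<and> limitin dual_metric.mtopology (\<sigma> \<circ> r) l sequentially"
    using s \<Phi> by blast
qed auto

section \<open>Combinations of point evaluations\<close>

text \<open>For fixed points the functional depends on the coefficients \<open>y\<close> alone. With
  random \<open>y\<close> this reduces measurability in the dual space to continuity in
  \<open>y\<close>.\<close>

definition point_functional ::
    "'i set \<Rightarrow> ('i \<Rightarrow> real ^ 'n) \<Rightarrow> ('i \<Rightarrow> real) \<Rightarrow> (real ^ 'n \<Rightarrow> real) \<Rightarrow> real" where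
  "point_functional J p y = restrict (\<lambda>f. \<Sum>j\<in>J. y j * f (p j)) (sobolev \<phi> lam \<alpha>)"

lemma point_functional_phi: "point_functional J p y (\<phi> k) = (\<Sum>j\<in>J. y j * \<phi> k (p j))"
  by (simp add: point_functional_def phi_sobolev)

lemma point_functional_in_dual:
  assumes "p ` J \<subseteq> unit_cube"
  shows "point_functional J p y \<in> dual"
  unfolding sobolev_dual_def mem_Collect_eq
proof (intro conjI ballI allI exI)
  show "point_functional J p y \<in> extensional (sobolev \<phi> lam \<alpha>)" by (simp add: point_functional_def)
next
  fix f g a b assume "f \<in> sobolev \<phi> lam \<alpha>" "g \<in> sobolev \<phi> lam \<alpha>"
  then show "point_functional J p y (\<lambda>x. a * f x + b * g x) =
      a * point_functional J p y f + b * point_functional J p y g"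
    by (simp add: point_functional_def sobolev_lin sum_distrib_left sum.distrib algebra_simps)
next
  fix f assume f: "f \<in> sobolev \<phi> lam \<alpha>"
  have "\<bar>point_functional J p y f\<bar> \<le> (\<Sum>j\<in>J. \<bar>y j\<bar> * \<bar>f (p j)\<bar>)"
    using f by (simp add: point_functional_def flip: abs_mult)
  also have "\<dots> \<le> (\<Sum>j\<in>J. \<bar>y j\<bar> * (sqrt eval_const * sobolev_norm f))"
    using assms by (intro sum_mono mult_left_mono sobolev_pointwise_bound f) auto
  also have "\<dots> = ((\<Sum>j\<in>J. \<bar>y j\<bar>) * sqrt eval_const) * sobolev_norm f"
    by (simp add: sum_distrib_right mult.assoc)
  finally show "\<bar>point_functional J p y f\<bar> \<le>
      ((\<Sum>j\<in>J. \<bar>y j\<bar>) * sqrt eval_const) * sqrt (enn2real (sobolev_norm2 \<phi> lam \<alpha> f))"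
    by (simp add: sobolev_norm_def)
qed

text \<open>Cauchy-Schwarz over J gives the factor \<open>card J\<close>, and every point
  contributes at most \<open>eval_const\<close>. Used for continuity in \<open>y\<close>.\<close>

lemma dual_dist_point_functional_le:
  assumes "p ` J \<subseteq> unit_cube"
  shows "dual_dist \<phi> lam \<alpha> (point_functional J p y) (point_functional J p z) \<le>
    sqrt (real (card J) * eval_const * (\<Sum>j\<in>J. (y j - z j)\<^sup>2))"
proof -
  note inD = point_functional_in_dual[OF assms]
  let ?d = "\<lambda>k. point_functional J p y (\<phi> k) - point_functional J p z (\<phi> k)"
  have s: "summable (\<lambda>k. wt' k * (?d k)\<^sup>2)" by (intro summable_weighted_diff dual_summable inD)
  have d: "?d k = (\<Sum>j\<in>J. (y j - z j) * \<phi> k (p j))" for k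
    by (simp add: point_functional_phi sum_subtractf algebra_simps)
  have "(\<Sum>k. wt' k * (?d k)\<^sup>2) \<le> real (card J) * eval_const * (\<Sum>j\<in>J. (y j - z j)\<^sup>2)"
  proof (rule suminf_le_const[OF s])
    fix n
    have "(\<Sum>k<n. wt' k * (?d k)\<^sup>2) \<le> (\<Sum>k<n. wt' k * ((\<Sum>j\<in>J. ((y j - z j) * \<phi> k (p j))\<^sup>2) * real (card J)))"
      unfolding d by (intro sum_mono mult_left_mono sum_squared_le_sum_of_squares) auto
    also have "\<dots> = (\<Sum>k<n. \<Sum>j\<in>J. real (card J) * (y j - z j)\<^sup>2 * (wt' k * (\<phi> k (p j))\<^sup>2))"
      by (subst sum_distrib_right, subst sum_distrib_left) (simp add: power_mult_distrib mult_ac)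
    also have "\<dots> = (\<Sum>j\<in>J. \<Sum>k<n. real (card J) * (y j - z j)\<^sup>2 * (wt' k * (\<phi> k (p j))\<^sup>2))"
      by (rule sum.swap)
    also have "\<dots> = (\<Sum>j\<in>J. real (card J) * (y j - z j)\<^sup>2 * (\<Sum>k<n. wt' k * (\<phi> k (p j))\<^sup>2))"
      by (simp only: sum_distrib_left)
    also have "\<dots> \<le> (\<Sum>j\<in>J. real (card J) * (y j - z j)\<^sup>2 * eval_const)"
      using assms by (intro sum_mono mult_left_mono weighted_sum_le_eval_const) auto
    also have "\<dots> = real (card J) * eval_const * (\<Sum>j\<in>J. (y j - z j)\<^sup>2)"
      by (simp add: sum_distrib_left mult_ac)
    finally show "(\<Sum>k<n. wt' k * (?d k)\<^sup>2) \<le> real (card J) * eval_const * (\<Sum>j\<in>J. (y j - z j)\<^sup>2)" .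
  qed
  then show ?thesis unfolding dual_dist_eq[OF inD inD] by simp
qed

lemma open_point_functional_preimage:
  fixes p :: "'i \<Rightarrow> real ^ 'n"
  assumes p: "p ` J \<subseteq> unit_cube" and U: "openin dual_metric.mtopology U"
  shows "open {y. point_functional J p y \<in> U}"
proof (subst open_subopen, intro ballI)
  fix y assume y: "y \<in> {y. point_functional J p y \<in> U}"
  then obtain e where e: "e > 0" "dual_metric.mball (point_functional J p y) e \<subseteq> U"
    using U unfolding dual_metric.openin_mtopology by blast
  define q where "q z = sqrt (real (card J) * eval_const * (\<Sum>j\<in>J. (y j - z j)\<^sup>2))" for z :: "'i \<Rightarrow> real"
  have "continuous_on UNIV q"
    unfolding q_def by (intro continuous_intros continuous_on_product_coordinates)
  then have "open {z. q z < e}" by (intro open_Collect_less continuous_intros) auto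
  moreover have "y \<in> {z. q z < e}" using e by (simp add: q_def)
  moreover have "{z. q z < e} \<subseteq> {y. point_functional J p y \<in> U}"
  proof safe
    fix z assume "q z < e"
    then have "dual_dist \<phi> lam \<alpha> (point_functional J p y) (point_functional J p z) < e"
      using dual_dist_point_functional_le[OF p, of y z] by (simp add: q_def)
    then show "point_functional J p z \<in> U"
      using e(2) point_functional_in_dual[OF p] by auto
  qed
  ultimately show "\<exists>T. open T \<and> y \<in> T \<and> T \<subseteq> {y. point_functional J p y \<in> U}" by blast
qed

text \<open>The map is a continuous function of the coefficient family. As the index type is
  countable, measurability of each coordinate gives Borel measurability into the product
  space.\<close>

lemma measurable_point_functional:
  fixes p :: "'i :: countable \<Rightarrow> real ^ 'n"
  assumes p: "p ` J \<subseteq> unit_cube" and Y: "\<And>j. (\<lambda>\<omega>. Y \<omega> j) \<in> borel_measurable M"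
  shows "(\<lambda>\<omega>. point_functional J p (Y \<omega>)) \<in>
    measurable M (sigma (topspace dual_metric.mtopology) {U. openin dual_metric.mtopology U})"
proof (rule measurable_measure_of)
  show "{U. openin dual_metric.mtopology U} \<subseteq> Pow (topspace dual_metric.mtopology)"
    using openin_subset by blast
  show "(\<lambda>\<omega>. point_functional J p (Y \<omega>)) \<in> space M \<rightarrow> topspace dual_metric.mtopology"
    using point_functional_in_dual[OF p] by simp
  fix U assume "U \<in> {U. openin dual_metric.mtopology U}"
  then have "open {y. point_functional J p y \<in> U}"
    using open_point_functional_preimage[OF p] by simp
  moreover have "Y \<in> borel_measurable M"
    by (rule measurable_coordinatewise_then_product[OF Y])
  ultimately have "Y -` {y. point_functional J p y \<in> U} \<inter> space M \<in> sets M"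
    by (intro measurable_sets[where A = borel]) auto
  then show "(\<lambda>\<omega>. point_functional J p (Y \<omega>)) -` U \<inter> space M \<in> sets M"
    by (simp add: vimage_def)
qed

end

section \<open>Hermite polynomials of correlated Gaussian variables\<close>

text \<open>Moments of the standard normal law: (n - 1)!! for even n, written with
  factorials.\<close>

definition gauss_moment :: "nat \<Rightarrow> real" where
  "gauss_moment n = (if even n then fact n / (2 ^ (n div 2) * fact (n div 2)) else 0)"

lemma gauss_moment_Suc_Suc: "gauss_moment (n + 2) = real (n + 1) * gauss_moment n"
proof (cases "even n")
  case True
  then obtain k where n: "n = 2 * k" by (elim evenE)
  have "gauss_moment (n + 2) = (real (2 * (k + 1)) * (real (2 * k + 1) * fact (2 * k))) / (real (2 * (k + 1)) * (2 ^ k * fact k))"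
    by (simp add: gauss_moment_def n algebra_simps)
  also have "\<dots> = real (2 * k + 1) * fact (2 * k) / (2 ^ k * fact k)"
    by (rule mult_divide_mult_cancel_left) simp
  finally show ?thesis by (simp add: gauss_moment_def n)
qed (simp add: gauss_moment_def)

lemma integrable_mult_of_squares:
  fixes f g :: "'a \<Rightarrow> real"
  assumes [measurable]: "f \<in> borel_measurable M" "g \<in> borel_measurable M"
    and f: "integrable M (\<lambda>x. (f x)\<^sup>2)" and g: "integrable M (\<lambda>x. (g x)\<^sup>2)"
  shows "integrable M (\<lambda>x. f x * g x)"
proof (rule Bochner_Integration.integrable_bound)
  show "integrable M (\<lambda>x. (f x)\<^sup>2 + (g x)\<^sup>2)" using f g by (rule Bochner_Integration.integrable_add)
  have "\<bar>a * b\<bar> \<le> \<bar>a\<^sup>2 + b\<^sup>2\<bar>" for a b :: real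
  proof -
    have "2 * \<bar>a\<bar> * \<bar>b\<bar> \<le> \<bar>a\<bar>\<^sup>2 + \<bar>b\<bar>\<^sup>2" by (rule sum_squares_bound)
    moreover have "0 \<le> \<bar>a\<bar> * \<bar>b\<bar>" by simp
    moreover have "0 \<le> a\<^sup>2" "0 \<le> b\<^sup>2" by auto
    ultimately show ?thesis unfolding abs_mult power2_abs by linarith
  qed
  then show "AE x in M. norm (f x * g x) \<le> norm ((f x)\<^sup>2 + (g x)\<^sup>2)" by simp
qed simp

lemma Cauchy_Schwarz_integral:
  fixes f g :: "'a \<Rightarrow> real"
  assumes [measurable]: "f \<in> borel_measurable M" "g \<in> borel_measurable M"
    and f: "integrable M (\<lambda>x. (f x)\<^sup>2)" and g: "integrable M (\<lambda>x. (g x)\<^sup>2)"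
  shows "\<bar>\<integral>x. f x * g x \<partial>M\<bar> \<le> sqrt (\<integral>x. (f x)\<^sup>2 \<partial>M) * sqrt (\<integral>x. (g x)\<^sup>2 \<partial>M)"
proof -
  have fg: "integrable M (\<lambda>x. f x * g x)" by (rule integrable_mult_of_squares) fact+
  have "(ennreal (\<integral>x. \<bar>f x * g x\<bar> \<partial>M))\<^sup>2 = (\<integral>\<^sup>+x. ennreal \<bar>f x\<bar> * ennreal \<bar>g x\<bar> \<partial>M)\<^sup>2"
    using nn_integral_eq_integral[OF integrable_abs[OF fg]] by (simp add: abs_mult ennreal_mult)
  also have "\<dots> \<le> (\<integral>\<^sup>+x. (ennreal \<bar>f x\<bar>)\<^sup>2 \<partial>M) * (\<integral>\<^sup>+x. (ennreal \<bar>g x\<bar>)\<^sup>2 \<partial>M)"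
    by (rule Cauchy_Schwarz_nn_integral) auto
  also have "\<dots> = ennreal (\<integral>x. (f x)\<^sup>2 \<partial>M) * ennreal (\<integral>x. (g x)\<^sup>2 \<partial>M)"
    using f g by (simp add: ennreal_power nn_integral_eq_integral)
  finally have "(\<integral>x. \<bar>f x * g x\<bar> \<partial>M)\<^sup>2 \<le> (\<integral>x. (f x)\<^sup>2 \<partial>M) * (\<integral>x. (g x)\<^sup>2 \<partial>M)"
    by (simp add: ennreal_power flip: ennreal_mult)
  then have "\<integral>x. \<bar>f x * g x\<bar> \<partial>M \<le> sqrt ((\<integral>x. (f x)\<^sup>2 \<partial>M) * (\<integral>x. (g x)\<^sup>2 \<partial>M))"
    by (rule real_le_rsqrt)
  then show ?thesis
    using integral_norm_bound[of M "\<lambda>x. f x * g x"] unfolding real_norm_def real_sqrt_mult by linarith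
qed

context prob_space
begin

text \<open>Centered constants are included: there the variance is 0, and both sides agree because
  0^0 = 1 at n = 0 while for n > 0 either the power or \<open>gauss_moment n\<close> is 0.\<close>

lemma
  assumes V: "gaussian_var M V" and [measurable]: "V \<in> borel_measurable M" and E: "expectation V = 0"
  shows gaussian_var_integrable_power: "integrable M (\<lambda>\<omega>. V \<omega> ^ n)"
    and gaussian_var_expectation_power:
      "expectation (\<lambda>\<omega>. V \<omega> ^ n) = gauss_moment n * (expectation (\<lambda>\<omega>. (V \<omega>)\<^sup>2)) ^ (n div 2)"
proof -
  have "integrable M (\<lambda>\<omega>. V \<omega> ^ n) \<and>
     expectation (\<lambda>\<omega>. V \<omega> ^ n) = gauss_moment n * (expectation (\<lambda>\<omega>. (V \<omega>)\<^sup>2)) ^ (n div 2)"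
    using V unfolding gaussian_var_def
  proof
    assume "\<exists>\<mu>. AE \<omega> in M. V \<omega> = \<mu>"
    then obtain \<mu> where \<mu>: "AE \<omega> in M. V \<omega> = \<mu>" by blast
    have "expectation V = expectation (\<lambda>_. \<mu>)" by (rule integral_cong_AE) (use \<mu> in auto)
    with E have "\<mu> = 0" by (simp add: prob_space)
    with \<mu> have V0: "AE \<omega> in M. V \<omega> = 0" by simp
    have pow: "AE \<omega> in M. V \<omega> ^ k = 0 ^ k" for k using V0 by eventually_elim simp
    have e: "expectation (\<lambda>\<omega>. V \<omega> ^ k) = 0 ^ k" for k
    proof -
      have "expectation (\<lambda>\<omega>. V \<omega> ^ k) = expectation (\<lambda>_. 0 ^ k)"
        by (rule integral_cong_AE) (use pow[of k] in auto)
      then show ?thesis by (simp add: prob_space)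
    qed
    have "integrable M (\<lambda>\<omega>. V \<omega> ^ n)"
      using integrable_cong_AE[of "\<lambda>\<omega>. V \<omega> ^ n" M "\<lambda>_. 0 ^ n"] pow[of n] by simp
    moreover have "(0::real) ^ n = gauss_moment n * (0\<^sup>2) ^ (n div 2)"
    proof (cases "n = 0")
      case False
      then have "n div 2 \<noteq> 0" if "even n" using that by (auto elim: evenE)
      with False show ?thesis by (cases "even n") (auto simp: gauss_moment_def power_0_left)
    qed (simp add: gauss_moment_def)
    ultimately show ?thesis unfolding e by simp
  next
    assume "\<exists>\<mu> \<sigma>. 0 < \<sigma> \<and> distributed M lborel V (\<lambda>x. ennreal (normal_density \<mu> \<sigma> x))"
    then obtain \<mu> \<sigma> where \<sigma>: "0 < \<sigma>" and D: "distributed M lborel V (\<lambda>x. ennreal (normal_density \<mu> \<sigma> x))" by blast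
    have \<mu>: "\<mu> = 0" using normal_distributed_expectation[OF \<sigma> D] E by simp
    have v: "expectation (\<lambda>\<omega>. (V \<omega>)\<^sup>2) = \<sigma>\<^sup>2"
      using normal_distributed_variance[OF \<sigma> D] E by simp
    have i: "integrable M (\<lambda>\<omega>. V \<omega> ^ n)"
      using distributed_integrable[OF D, of "\<lambda>x. x ^ n"] integrable_normal_moment[OF \<sigma>, of \<mu> n] by (simp add: \<mu>)
    have e: "expectation (\<lambda>\<omega>. V \<omega> ^ n) = (\<integral>x. normal_density 0 \<sigma> x * x ^ n \<partial>lborel)"
      using distributed_integral[OF D, of "\<lambda>x. x ^ n"] by (simp add: \<mu>)
    have "(\<integral>x. normal_density 0 \<sigma> x * x ^ n \<partial>lborel) = gauss_moment n * (\<sigma>\<^sup>2) ^ (n div 2)"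
    proof (cases "even n")
      case True
      then obtain k where "n = 2 * k" by (elim evenE)
      then show ?thesis using integral_normal_moment_even[OF \<sigma>, of 0 k] \<sigma>
        by (simp add: gauss_moment_def power_divide field_simps)
    next
      case False
      then obtain k where "n = 2 * k + 1" by (elim oddE)
      then show ?thesis using integral_normal_moment_odd[OF \<sigma>, of 0 k] by (simp add: gauss_moment_def)
    qed
    with i e v show ?thesis by simp
  qed
  then show "integrable M (\<lambda>\<omega>. V \<omega> ^ n)"
    and "expectation (\<lambda>\<omega>. V \<omega> ^ n) = gauss_moment n * (expectation (\<lambda>\<omega>. (V \<omega>)\<^sup>2)) ^ (n div 2)" by auto
qed

end

section \<open>Hermite polynomials as formal polynomials\<close>

fun hermite_poly :: "nat \<Rightarrow> real poly" where
  "hermite_poly 0 = 1"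
| "hermite_poly (Suc 0) = [:0, 1:]"
| "hermite_poly (Suc (Suc q)) = [:0, 1:] * hermite_poly (Suc q) - smult (real (Suc q)) (hermite_poly q)"

lemma poly_hermite_poly: "poly (hermite_poly q) x = hermite q x"
  by (induction q rule: hermite_poly.induct) auto

lemma pderiv_hermite_poly: "pderiv (hermite_poly (Suc q)) = smult (real (Suc q)) (hermite_poly q)"
proof (induction q rule: hermite_poly.induct)
  case 1
  then show ?case by (simp add: pderiv_pCons)
next
  case 2
  then show ?case by (simp add: pderiv_pCons pderiv_diff pderiv_mult one_pCons)
next
  case (3 q)
  have X: "pderiv [:0, 1:] = (1 :: real poly)" by (simp add: pderiv_pCons one_pCons)
  let ?h = hermite_poly
  have "pderiv (?h (Suc (Suc (Suc q)))) =
      [:0, 1:] * smult (real (Suc (Suc q))) (?h (Suc q)) + ?h (Suc (Suc q)) * 1 -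
      smult (real (Suc (Suc q))) (smult (real (Suc q)) (?h q))"
    by (simp only: hermite_poly.simps(3)[of "Suc q"] pderiv_diff pderiv_mult pderiv_smult X 3)
  also have "\<dots> = ?h (Suc (Suc q)) +
      smult (real (Suc (Suc q))) ([:0, 1:] * ?h (Suc q) - smult (real (Suc q)) (?h q))"
    by (simp only: smult_diff_right mult_smult_right)
  also have "\<dots> = smult (1 + real (Suc (Suc q))) (?h (Suc (Suc q)))"
    by (simp only: hermite_poly.simps(3)[symmetric] smult_add_left smult_1_left)
  finally show ?case by (simp only: of_nat_Suc)
qed

text \<open>The raising operator, multiplication by x minus differentiation. It is the combination
  that Gaussian integration by parts simplifies.\<close>

lemma hermite_poly_Suc: "hermite_poly (Suc q) = [:0, 1:] * hermite_poly q - pderiv (hermite_poly q)"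
  by (cases q) (simp_all add: pderiv_hermite_poly del: mult_pCons_left)

section \<open>Mixed moments of a correlated Gaussian pair\<close>

locale gaussian_pair = prob_space M for M :: "'w measure" +
  fixes Y Z :: "'w \<Rightarrow> real" and r :: real
  assumes measY [measurable]: "Y \<in> borel_measurable M" and measZ [measurable]: "Z \<in> borel_measurable M"
    and gauss: "\<And>a b. gaussian_var M (\<lambda>\<omega>. a * Y \<omega> + b * Z \<omega>)"
    and EY: "expectation Y = 0" and EZ: "expectation Z = 0"
    and EYY: "expectation (\<lambda>\<omega>. (Y \<omega>)\<^sup>2) = 1" and EZZ: "expectation (\<lambda>\<omega>. (Z \<omega>)\<^sup>2) = 1"
    and EYZ: "expectation (\<lambda>\<omega>. Y \<omega> * Z \<omega>) = r"
begin

lemma gaussY: "gaussian_var M Y" and gaussZ: "gaussian_var M Z"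
  using gauss[of 1 0] gauss[of 0 1] by simp_all

lemma swap: "gaussian_pair M Z Y r"
proof unfold_locales
  show "gaussian_var M (\<lambda>\<omega>. a * Z \<omega> + b * Y \<omega>)" for a b
    using gauss[of b a] by (simp add: add.commute)
  show "expectation (\<lambda>\<omega>. Z \<omega> * Y \<omega>) = r" using EYZ by (simp add: mult.commute)
qed (use EY EZ EYY EZZ in auto)

lemma diagonal: "gaussian_pair M Y Y 1"
proof unfold_locales
  show "gaussian_var M (\<lambda>\<omega>. a * Y \<omega> + b * Y \<omega>)" for a b
    using gauss[of "a + b" 0] by (simp add: distrib_right)
qed (use EY EYY in \<open>auto simp: power2_eq_square\<close>)

lemma std_normal: "distributed M lborel Y (\<lambda>x. ennreal (std_normal_density x))"
  using gaussY unfolding gaussian_var_def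
proof
  assume "\<exists>\<mu>. AE \<omega> in M. Y \<omega> = \<mu>"
  then obtain \<mu> where \<mu>: "AE \<omega> in M. Y \<omega> = \<mu>" by blast
  have "expectation Y = expectation (\<lambda>_. \<mu>)" "expectation (\<lambda>\<omega>. (Y \<omega>)\<^sup>2) = expectation (\<lambda>_. \<mu>\<^sup>2)"
    by (rule integral_cong_AE; use \<mu> in auto)+
  then show ?thesis using EY EYY by (simp add: prob_space)
next
  assume "\<exists>\<mu> \<sigma>. 0 < \<sigma> \<and> distributed M lborel Y (\<lambda>x. ennreal (normal_density \<mu> \<sigma> x))"
  then obtain \<mu> \<sigma> where \<sigma>: "0 < \<sigma>" and D: "distributed M lborel Y (\<lambda>x. ennreal (normal_density \<mu> \<sigma> x))" by blast
  have "\<mu> = 0" using normal_distributed_expectation[OF \<sigma> D] EY by simp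
  moreover have "\<sigma>\<^sup>2 = 1" using normal_distributed_variance[OF \<sigma> D] EY EYY by simp
  then have "\<sigma> = 1" using \<sigma> by (simp add: power2_eq_1_iff)
  ultimately show ?thesis using D by simp
qed

lemma integrable_powers: "integrable M (\<lambda>\<omega>. Y \<omega> ^ p * Z \<omega> ^ q)"
  using gaussian_var_integrable_power[OF gaussY measY EY, of "p * 2"]
    gaussian_var_integrable_power[OF gaussZ measZ EZ, of "q * 2"]
  by (intro integrable_mult_of_squares) (auto simp flip: power_mult)

definition pair_moment :: "nat \<Rightarrow> nat \<Rightarrow> real" where
  "pair_moment p q = expectation (\<lambda>\<omega>. Y \<omega> ^ p * Z \<omega> ^ q)"

lemma expectation_power_combination:
  "expectation (\<lambda>\<omega>. (s * Y \<omega> + Z \<omega>) ^ n) = (\<Sum>p\<le>n. real (n choose p) * pair_moment p (n - p) * s ^ p)"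
proof -
  have "(s * Y \<omega> + Z \<omega>) ^ n = (\<Sum>p\<le>n. real (n choose p) * s ^ p * (Y \<omega> ^ p * Z \<omega> ^ (n - p)))" for \<omega>
    by (simp add: binomial_ring power_mult_distrib mult_ac)
  then show ?thesis
    using integrable_powers by (simp add: pair_moment_def Bochner_Integration.integral_sum mult_ac)
qed

lemma expectation_power_combination_gauss:
  "expectation (\<lambda>\<omega>. (s * Y \<omega> + Z \<omega>) ^ n) = gauss_moment n * (s\<^sup>2 + 2 * r * s + 1) ^ (n div 2)"
proof -
  have i: "integrable M Y" "integrable M Z" "integrable M (\<lambda>\<omega>. (Y \<omega>)\<^sup>2)"
    "integrable M (\<lambda>\<omega>. (Z \<omega>)\<^sup>2)" "integrable M (\<lambda>\<omega>. Y \<omega> * Z \<omega>)"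
    using integrable_powers[of 1 0] integrable_powers[of 0 1] integrable_powers[of 2 0]
      integrable_powers[of 0 2] integrable_powers[of 1 1] by simp_all
  have "expectation (\<lambda>\<omega>. (s * Y \<omega> + Z \<omega>)\<^sup>2) =
      expectation (\<lambda>\<omega>. s\<^sup>2 * (Y \<omega>)\<^sup>2 + 2 * s * (Y \<omega> * Z \<omega>) + (Z \<omega>)\<^sup>2)"
    by (rule Bochner_Integration.integral_cong) (auto simp: power2_sum power_mult_distrib)
  also have "\<dots> = s\<^sup>2 + 2 * r * s + 1"
    using i by (simp add: EYY EZZ EYZ)
  finally show ?thesis
    using gaussian_var_expectation_power[of "\<lambda>\<omega>. s * Y \<omega> + Z \<omega>" n] gauss[of s 1] i EY EZ by simp
qed

text \<open>Differentiating \<open>\<bbbE>[(sY + Z)\<^bsup>n+2\<^esup>]\<close>, a power of the variance of \<open>sY + Z\<close>, in \<open>s\<close>.\<close>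

lemma sum_pair_moment_recursion:
  "(\<Sum>p\<le>n + 1. real (n + 1 choose p) * pair_moment (p + 1) (n + 1 - p) * s ^ p) =
     real (n + 1) * (s + r) * (\<Sum>p\<le>n. real (n choose p) * pair_moment p (n - p) * s ^ p)"
proof -
  let ?F = "\<lambda>n s. expectation (\<lambda>\<omega>. (s * Y \<omega> + Z \<omega>) ^ n)"
  let ?L = "\<Sum>p\<le>n + 1. real (n + 1 choose p) * pair_moment (p + 1) (n + 1 - p) * s ^ p"
  have "((\<lambda>s. \<Sum>p\<le>n + 2. real (n + 2 choose p) * pair_moment p (n + 2 - p) * s ^ p) has_real_derivative
      (\<Sum>p\<le>n + 2. real (n + 2 choose p) * pair_moment p (n + 2 - p) * (real p * s ^ (p - 1)))) (at s)"
    by (rule DERIV_sum) (auto intro!: derivative_eq_intros)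
  also have "(\<Sum>p\<le>n + 2. real (n + 2 choose p) * pair_moment p (n + 2 - p) * (real p * s ^ (p - 1))) =
      (\<Sum>p\<le>n + 1. real (n + 2 choose Suc p) * pair_moment (Suc p) (n + 2 - Suc p) * (real (Suc p) * s ^ p))"
    using sum.atMost_Suc_shift[of "\<lambda>p. real (n + 2 choose p) * pair_moment p (n + 2 - p) * (real p * s ^ (p - 1))" "n + 1"]
    by simp
  also have "\<dots> = real (n + 2) * ?L"
    unfolding sum_distrib_left
  proof (intro sum.cong refl)
    fix p
    have "real (Suc p) * real (n + 2 choose Suc p) = real (n + 2) * real (n + 1 choose p)"
    proof -
      have "n + 2 = Suc (n + 1)" by simp
      then show ?thesis by (simp only: of_nat_mult[symmetric] Suc_times_binomial)
    qed
    then show "real (n + 2 choose Suc p) * pair_moment (Suc p) (n + 2 - Suc p) * (real (Suc p) * s ^ p) =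
        real (n + 2) * (real (n + 1 choose p) * pair_moment (p + 1) (n + 1 - p) * s ^ p)"
      by (simp add: algebra_simps del: of_nat_Suc binomial_Suc_Suc)
  qed
  finally have d1: "(?F (n + 2) has_real_derivative real (n + 2) * ?L) (at s)"
    unfolding expectation_power_combination .
  \<comment> \<open>For n = 2k the moment is a constant times the power k + 1 of the variance, and 2
    (k + 1) = n + 2 yields the leading factor. For odd n both sides are 0.\<close>
  have "(?F (n + 2) has_real_derivative real (n + 2) * (real (n + 1) * (s + r) * ?F n s)) (at s)"
  proof (cases "even n")
    case True
    then obtain k where k: "n = 2 * k" by (elim evenE)
    have "((\<lambda>s. s\<^sup>2 + 2 * r * s + 1) has_real_derivative 2 * s + 2 * r) (at s)"
      by (auto intro!: derivative_eq_intros)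
    from DERIV_cmult[OF DERIV_power[OF this, of "Suc k"], of "gauss_moment (n + 2)"]
    have "((\<lambda>s. gauss_moment (n + 2) * (s\<^sup>2 + 2 * r * s + 1) ^ Suc k) has_real_derivative
       gauss_moment (n + 2) * (real (Suc k) * (2 * s + 2 * r) * (s\<^sup>2 + 2 * r * s + 1) ^ k)) (at s)"
      by (simp add: mult.assoc)
    then show ?thesis
      unfolding expectation_power_combination_gauss gauss_moment_Suc_Suc by (simp add: k algebra_simps)
  next
    case False
    then show ?thesis unfolding expectation_power_combination_gauss by (simp add: gauss_moment_def)
  qed
  from DERIV_unique[OF d1 this] show ?thesis
    unfolding expectation_power_combination by simp
qed

text \<open>\<open>sum_pair_moment_recursion\<close> is an identity of polynomials in s, so
  coefficients of s^p agree. The truncated exponents at p = 0 and q = 0 do no harm, since the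
  factors p and q vanish there.\<close>

lemma pair_moment_recursion: "pair_moment (Suc p) q = real p * pair_moment (p - 1) q + r * real q * pair_moment p (q - 1)"
proof (cases "p + q")
  case 0
  then show ?thesis using EY by (simp add: pair_moment_def)
next
  case (Suc n)
  \<comment> \<open>Coefficients of the product with s + r: the term i - 1 is shifted by s, the term
    i is multiplied by r. At i = n + 1 the binomial in the second term is 0.\<close>
  define d where "d i = real (n + 1) *
      ((if i = 0 then 0 else real (n choose (i - 1)) * pair_moment (i - 1) (n - (i - 1))) +
       r * (real (n choose i) * pair_moment i (n - i)))" for i
  have "(\<Sum>p\<le>n + 1. d p * s ^ p) = real (n + 1) * (s + r) * (\<Sum>p\<le>n. real (n choose p) * pair_moment p (n - p) * s ^ p)" for s
  proof -
    let ?a = "\<lambda>i. real (n choose i) * pair_moment i (n - i) * s ^ i"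
    have "(\<Sum>p\<le>n + 1. d p * s ^ p) = real (n + 1) *
        ((\<Sum>p\<le>Suc n. if p = 0 then 0 else s * ?a (p - 1)) + r * (\<Sum>p\<le>Suc n. ?a p))"
      unfolding sum_distrib_left sum.distrib[symmetric] d_def
      by (intro sum.cong) (auto simp: algebra_simps power_eq_if)
    also have "(\<Sum>p\<le>Suc n. if p = 0 then 0 else s * ?a (p - 1)) = s * (\<Sum>p\<le>n. ?a p)"
      by (subst sum.atMost_Suc_shift) (simp add: sum_distrib_left)
    also have "(\<Sum>p\<le>Suc n. ?a p) = (\<Sum>p\<le>n. ?a p)" by simp
    finally show ?thesis by (simp add: algebra_simps)
  qed
  then have "\<forall>s. (\<Sum>p\<le>n + 1. (real (n + 1 choose p) * pair_moment (p + 1) (n + 1 - p)) * s ^ p) = (\<Sum>p\<le>n + 1. d p * s ^ p)"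
    using sum_pair_moment_recursion[of n] by simp
  then have "real (n + 1 choose p) * pair_moment (p + 1) (n + 1 - p) = d p"
    unfolding polyfun_eq_coeffs using Suc by simp
  moreover have q: "q = n + 1 - p" "p \<le> n + 1" using Suc by auto
  moreover have "d p = real (n + 1 choose p) * (real p * pair_moment (p - 1) q + r * real q * pair_moment p (q - 1))"
  proof -
    have 1: "real (n + 1 choose p) * real q = real (n + 1) * real (n choose p)"
      using binomial_absorb_comp[of "n + 1" p] q by (simp only: of_nat_mult[symmetric]) (simp add: mult.commute)
    have 2: "real (n + 1 choose p) * real p = real (n + 1) * real (n choose (p - 1))" if "p > 0"
      using times_binomial_minus1_eq[OF that, of "n + 1"] by (simp only: of_nat_mult[symmetric]) (simp add: mult.commute)
    have 3: "n - (p - 1) = q" if "p > 0" using q that by auto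
    have 4: "n - p = q - 1" using q by auto
    have "real (n + 1 choose p) * (real p * pair_moment (p - 1) q + r * real q * pair_moment p (q - 1)) =
       (real (n + 1 choose p) * real p) * pair_moment (p - 1) q + r * (real (n + 1 choose p) * real q) * pair_moment p (q - 1)"
      by (simp only: algebra_simps)
    also have "\<dots> = d p"
      unfolding 1 d_def using 2 3 4 by (cases "p = 0") (simp_all add: algebra_simps)
    finally show ?thesis by simp
  qed
  moreover have "n + 1 choose p > 0" using q by simp
  ultimately show ?thesis by simp
qed

section \<open>Gaussian integration by parts and orthogonality\<close>

definition pair_expectation :: "real poly \<Rightarrow> real poly \<Rightarrow> real" where
  "pair_expectation f g = expectation (\<lambda>\<omega>. poly f (Y \<omega>) * poly g (Z \<omega>))"

lemma integrable_poly: "integrable M (\<lambda>\<omega>. poly f (Y \<omega>) * poly g (Z \<omega>))"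
proof -
  have "poly f y * poly g z = (\<Sum>i\<le>degree f. \<Sum>j\<le>degree g. coeff f i * coeff g j * (y ^ i * z ^ j))" for y z
    by (simp add: poly_altdef sum_product mult_ac)
  then show ?thesis using integrable_powers by simp
qed

lemma pair_expectation_add_left: "pair_expectation (f + f') g = pair_expectation f g + pair_expectation f' g"
  and pair_expectation_add_right: "pair_expectation f (g + g') = pair_expectation f g + pair_expectation f g'"
  and pair_expectation_diff_left: "pair_expectation (f - f') g = pair_expectation f g - pair_expectation f' g"
  and pair_expectation_smult_left: "pair_expectation (smult a f) g = a * pair_expectation f g"
  and pair_expectation_smult_right: "pair_expectation f (smult a g) = a * pair_expectation f g"
  using integrable_poly by (simp_all add: pair_expectation_def distrib_left distrib_right left_diff_distrib mult.assoc mult.left_commute)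

lemma pair_expectation_0: "pair_expectation 0 g = 0" "pair_expectation f 0 = 0"
  by (simp_all add: pair_expectation_def)

lemma pair_expectation_sum_left: "finite A \<Longrightarrow> pair_expectation (sum F A) g = (\<Sum>i\<in>A. pair_expectation (F i) g)"
  and pair_expectation_sum_right: "finite A \<Longrightarrow> pair_expectation f (sum F A) = (\<Sum>i\<in>A. pair_expectation f (F i))"
  by (induction A rule: finite_induct) (simp_all add: pair_expectation_0 pair_expectation_add_left pair_expectation_add_right)

lemma pderiv_sum: "finite A \<Longrightarrow> pderiv (sum F A) = (\<Sum>i\<in>A. pderiv (F i))"
  by (induction A rule: finite_induct) (simp_all add: pderiv_add)

lemma pair_expectation_monom: "pair_expectation (monom a p) (monom b q) = a * b * pair_moment p q"
  by (simp add: pair_expectation_def pair_moment_def poly_monom mult_ac)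

text \<open>Both sides are bilinear in f and g, so monomials suffice, where this is
  \<open>pair_moment_recursion\<close>.\<close>

lemma stein: "pair_expectation ([:0, 1:] * f) g = pair_expectation (pderiv f) g + r * pair_expectation f (pderiv g)"
proof -
  let ?f = "\<Sum>i\<le>degree f. monom (coeff f i) i" and ?g = "\<Sum>i\<le>degree g. monom (coeff g i) i"
  have mon: "pair_expectation ([:0, 1:] * monom a p) (monom b q) =
      pair_expectation (pderiv (monom a p)) (monom b q) + r * pair_expectation (monom a p) (pderiv (monom b q))" for a b p q
  proof -
    have "[:0, 1:] * monom a p = monom a (Suc p)" by (simp add: monom_Suc)
    then show ?thesis by (simp add: pderiv_monom pair_expectation_monom pair_moment_recursion algebra_simps del: mult_pCons_left)
  qed
  have "pair_expectation ([:0, 1:] * ?f) ?g =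
      (\<Sum>j\<le>degree g. \<Sum>i\<le>degree f. pair_expectation ([:0, 1:] * monom (coeff f i) i) (monom (coeff g j) j))"
    by (simp only: sum_distrib_left pair_expectation_sum_left pair_expectation_sum_right finite_atMost)
  also have "\<dots> = pair_expectation (pderiv ?f) ?g + r * pair_expectation ?f (pderiv ?g)"
    by (simp only: mon pderiv_sum pair_expectation_sum_left pair_expectation_sum_right finite_atMost sum.distrib sum_distrib_left)
  finally have "pair_expectation ([:0, 1:] * ?f) ?g = pair_expectation (pderiv ?f) ?g + r * pair_expectation ?f (pderiv ?g)" .
  then show ?thesis by (simp only: poly_as_sum_of_monoms)
qed

lemma pair_expectation_hermite_poly_1: "pair_expectation (hermite_poly q) 1 = (if q = 0 then 1 else 0)"
proof (cases q)
  case 0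
  then show ?thesis by (simp add: pair_expectation_def prob_space)
next
  case (Suc q')
  then show ?thesis by (simp add: hermite_poly_Suc pair_expectation_diff_left stein pair_expectation_0 del: hermite_poly.simps(2,3) mult_pCons_left)
qed

text \<open>By \<open>stein\<close> and the raising operator, lowering the left index by one
  differentiates the right factor and costs r. At p = 0 the constant stands on the left, so the base
  case exchanges the two variables.\<close>

lemma pair_expectation_hermite_poly: "pair_expectation (hermite_poly p) (hermite_poly q) = (if p = q then fact p * r ^ p else 0)"
proof (induction p arbitrary: q)
  case 0
  have "pair_expectation 1 (hermite_poly q) = gaussian_pair.pair_expectation M Z Y (hermite_poly q) 1"
    by (simp add: pair_expectation_def gaussian_pair.pair_expectation_def[OF swap])
  then show ?case using gaussian_pair.pair_expectation_hermite_poly_1[OF swap, of q] by auto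
next
  case (Suc p)
  have "pair_expectation (hermite_poly (Suc p)) (hermite_poly q) = r * pair_expectation (hermite_poly p) (pderiv (hermite_poly q))"
    by (simp add: hermite_poly_Suc pair_expectation_diff_left stein del: hermite_poly.simps(2,3) mult_pCons_left)
  also have "\<dots> = (if Suc p = q then fact (Suc p) * r ^ Suc p else 0)"
    by (cases q) (auto simp: pair_expectation_0 pderiv_hermite_poly pair_expectation_smult_right Suc simp del: hermite_poly.simps(2,3))
  finally show ?case .
qed

lemma abs_r_le_1: "\<bar>r\<bar> \<le> 1"
proof -
  have "integrable M (\<lambda>\<omega>. (Y \<omega>)\<^sup>2)" "integrable M (\<lambda>\<omega>. (Z \<omega>)\<^sup>2)"
    using integrable_powers[of 2 0] integrable_powers[of 0 2] by simp_all
  then show ?thesis using Cauchy_Schwarz_integral[of Y M Z] by (simp add: EYY EZZ EYZ)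
qed

end

section \<open>Hermite expansions of square integrable functions\<close>

context gaussian_pair
begin

lemma hermite_expansion_L2:
  fixes H :: "real \<Rightarrow> real"
  assumes [measurable]: "H \<in> borel_measurable borel" and H2: "integrable M (\<lambda>\<omega>. (H (Y \<omega>))\<^sup>2)"
    and exp: "hermite_expansion H c"
  shows "integrable M (\<lambda>\<omega>. (H (Y \<omega>) - poly (\<Sum>q\<le>n. smult (c q) (hermite_poly q)) (Y \<omega>))\<^sup>2)"
    and "(\<lambda>n. expectation (\<lambda>\<omega>. (H (Y \<omega>) - poly (\<Sum>q\<le>n. smult (c q) (hermite_poly q)) (Y \<omega>))\<^sup>2)) \<longlonglongrightarrow> 0"
proof -
  let ?S = "\<lambda>n. \<Sum>q\<le>n. smult (c q) (hermite_poly q)"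
  have mp [measurable]: "poly f \<in> borel_measurable borel" for f :: "real poly"
    by (intro borel_measurable_continuous_onI continuous_intros)
  have p2: "integrable M (\<lambda>\<omega>. (poly f (Y \<omega>))\<^sup>2)" for f
    using integrable_poly[of "f * f" 1] by (simp add: power2_eq_square)
  have i: "integrable M (\<lambda>\<omega>. (H (Y \<omega>) - poly f (Y \<omega>))\<^sup>2)" for f
  proof -
    have "integrable M (\<lambda>\<omega>. (H (Y \<omega>))\<^sup>2 + (poly f (Y \<omega>))\<^sup>2 - 2 * (H (Y \<omega>) * poly f (Y \<omega>)))"
      by (intro Bochner_Integration.integrable_add Bochner_Integration.integrable_diff
          Bochner_Integration.integrable_mult_right integrable_mult_of_squares H2 p2) measurable
    then show ?thesis by (simp add: power2_diff mult.assoc)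
  qed
  then show "integrable M (\<lambda>\<omega>. (H (Y \<omega>) - poly (?S n) (Y \<omega>))\<^sup>2)" .
  have S: "poly (?S n) x = (\<Sum>q\<le>n. c q * hermite q x)" for n x
    by (simp add: poly_sum poly_hermite_poly)
  have "(\<integral>\<^sup>+x. ennreal ((H x - poly (?S n) x)\<^sup>2) \<partial>density lborel (\<lambda>x. ennreal (std_normal_density x))) =
      ennreal (expectation (\<lambda>\<omega>. (H (Y \<omega>) - poly (?S n) (Y \<omega>))\<^sup>2))" for n
  proof -
    have "(\<integral>\<^sup>+x. ennreal ((H x - poly (?S n) x)\<^sup>2) \<partial>density lborel (\<lambda>x. ennreal (std_normal_density x))) =
        (\<integral>\<^sup>+x. ennreal (std_normal_density x) * ennreal ((H x - poly (?S n) x)\<^sup>2) \<partial>lborel)"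
      by (rule nn_integral_density) auto
    also have "\<dots> = (\<integral>\<^sup>+\<omega>. ennreal ((H (Y \<omega>) - poly (?S n) (Y \<omega>))\<^sup>2) \<partial>M)"
      by (rule distributed_nn_integral[OF std_normal]) auto
    also have "\<dots> = ennreal (expectation (\<lambda>\<omega>. (H (Y \<omega>) - poly (?S n) (Y \<omega>))\<^sup>2))"
      by (rule nn_integral_eq_integral[OF i]) auto
    finally show ?thesis .
  qed
  then have "(\<lambda>n. ennreal (expectation (\<lambda>\<omega>. (H (Y \<omega>) - poly (?S n) (Y \<omega>))\<^sup>2))) \<longlonglongrightarrow> ennreal 0"
    using exp unfolding hermite_expansion_def S by simp
  then show "(\<lambda>n. expectation (\<lambda>\<omega>. (H (Y \<omega>) - poly (?S n) (Y \<omega>))\<^sup>2)) \<longlonglongrightarrow> 0"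
    by (subst (asm) tendsto_ennreal_iff) auto
qed

lemma integrable_H_squared_swap:
  fixes H :: "real \<Rightarrow> real"
  assumes [measurable]: "H \<in> borel_measurable borel" and "integrable M (\<lambda>\<omega>. (H (Y \<omega>))\<^sup>2)"
  shows "integrable M (\<lambda>\<omega>. (H (Z \<omega>))\<^sup>2)"
  using assms distributed_integrable[OF std_normal, of "\<lambda>x. (H x)\<^sup>2"]
    distributed_integrable[OF gaussian_pair.std_normal[OF swap], of "\<lambda>x. (H x)\<^sup>2"] by simp

text \<open>Truncate both factors at the same degree. The product of truncations differs from H(Y)
  H(Z) by three terms, each containing an approximation error, and these vanish in the limit by
  Cauchy-Schwarz. The truncated product is evaluated by orthogonality.\<close>

lemma hermite_expansion_sums:
  fixes H :: "real \<Rightarrow> real"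
  assumes [measurable]: "H \<in> borel_measurable borel" and H2: "integrable M (\<lambda>\<omega>. (H (Y \<omega>))\<^sup>2)"
    and exp: "hermite_expansion H c"
  shows "(\<lambda>q. fact q * (c q)\<^sup>2 * r ^ q) sums expectation (\<lambda>\<omega>. H (Y \<omega>) * H (Z \<omega>))"
proof -
  define S where "S n = (\<Sum>q\<le>n. smult (c q) (hermite_poly q))" for n
  have mp [measurable]: "poly f \<in> borel_measurable borel" for f :: "real poly"
    by (intro borel_measurable_continuous_onI continuous_intros)
  define DY where "DY n \<omega> = H (Y \<omega>) - poly (S n) (Y \<omega>)" for n \<omega>
  define DZ where "DZ n \<omega> = H (Z \<omega>) - poly (S n) (Z \<omega>)" for n \<omega>
  have [measurable]: "DY n \<in> borel_measurable M" "DZ n \<in> borel_measurable M" for n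
    unfolding DY_def[abs_def] DZ_def[abs_def] by measurable
  note H2Z = integrable_H_squared_swap[OF assms(1) H2]
  have iDY: "integrable M (\<lambda>\<omega>. (DY n \<omega>)\<^sup>2)" and dY: "(\<lambda>n. expectation (\<lambda>\<omega>. (DY n \<omega>)\<^sup>2)) \<longlonglongrightarrow> 0" for n
    unfolding DY_def S_def using hermite_expansion_L2[OF assms] by auto
  have iDZ: "integrable M (\<lambda>\<omega>. (DZ n \<omega>)\<^sup>2)" and dZ: "(\<lambda>n. expectation (\<lambda>\<omega>. (DZ n \<omega>)\<^sup>2)) \<longlonglongrightarrow> 0" for n
    unfolding DZ_def S_def using gaussian_pair.hermite_expansion_L2[OF swap assms(1) H2Z exp] by auto
  have small: "(\<lambda>n. expectation (\<lambda>\<omega>. U n \<omega> * V n \<omega>)) \<longlonglongrightarrow> 0"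
    if [measurable]: "\<And>n. U n \<in> borel_measurable M" "\<And>n. V n \<in> borel_measurable M"
      and i: "\<And>n. integrable M (\<lambda>\<omega>. (U n \<omega>)\<^sup>2)" "\<And>n. integrable M (\<lambda>\<omega>. (V n \<omega>)\<^sup>2)"
      and t: "(\<lambda>n. expectation (\<lambda>\<omega>. (U n \<omega>)\<^sup>2)) \<longlonglongrightarrow> 0" "(\<lambda>n. expectation (\<lambda>\<omega>. (V n \<omega>)\<^sup>2)) \<longlonglongrightarrow> b"
    for U V :: "nat \<Rightarrow> 'w \<Rightarrow> real" and b
  proof (rule Lim_null_comparison)
    show "(\<lambda>n. sqrt (expectation (\<lambda>\<omega>. (U n \<omega>)\<^sup>2)) * sqrt (expectation (\<lambda>\<omega>. (V n \<omega>)\<^sup>2))) \<longlonglongrightarrow> 0"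
      using tendsto_mult[OF tendsto_real_sqrt[OF t(1)] tendsto_real_sqrt[OF t(2)]] by simp
    show "\<forall>\<^sub>F n in sequentially. norm (expectation (\<lambda>\<omega>. U n \<omega> * V n \<omega>)) \<le>
        sqrt (expectation (\<lambda>\<omega>. (U n \<omega>)\<^sup>2)) * sqrt (expectation (\<lambda>\<omega>. (V n \<omega>)\<^sup>2))"
      using Cauchy_Schwarz_integral[of "U _" M "V _"] i by simp
  qed
  have 1: "(\<lambda>n. expectation (\<lambda>\<omega>. DY n \<omega> * H (Z \<omega>))) \<longlonglongrightarrow> 0"
    by (rule small[OF _ _ iDY H2Z dY tendsto_const]) auto
  have 2: "(\<lambda>n. expectation (\<lambda>\<omega>. DZ n \<omega> * H (Y \<omega>))) \<longlonglongrightarrow> 0"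
    by (rule small[OF _ _ iDZ H2 dZ tendsto_const]) auto
  have 3: "(\<lambda>n. expectation (\<lambda>\<omega>. DY n \<omega> * DZ n \<omega>)) \<longlonglongrightarrow> 0"
    by (rule small[OF _ _ iDY iDZ dY dZ]) auto
  have "expectation (\<lambda>\<omega>. poly (S n) (Y \<omega>) * poly (S n) (Z \<omega>)) = expectation (\<lambda>\<omega>. H (Y \<omega>) * H (Z \<omega>)) -
      expectation (\<lambda>\<omega>. DY n \<omega> * H (Z \<omega>)) - expectation (\<lambda>\<omega>. DZ n \<omega> * H (Y \<omega>)) +
      expectation (\<lambda>\<omega>. DY n \<omega> * DZ n \<omega>)" for n
  proof -
    have "expectation (\<lambda>\<omega>. poly (S n) (Y \<omega>) * poly (S n) (Z \<omega>)) =
      expectation (\<lambda>\<omega>. H (Y \<omega>) * H (Z \<omega>) - DY n \<omega> * H (Z \<omega>) - DZ n \<omega> * H (Y \<omega>) + DY n \<omega> * DZ n \<omega>)"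
      by (rule Bochner_Integration.integral_cong) (auto simp: DY_def DZ_def algebra_simps)
    also have "\<dots> = expectation (\<lambda>\<omega>. H (Y \<omega>) * H (Z \<omega>)) -
      expectation (\<lambda>\<omega>. DY n \<omega> * H (Z \<omega>)) - expectation (\<lambda>\<omega>. DZ n \<omega> * H (Y \<omega>)) +
      expectation (\<lambda>\<omega>. DY n \<omega> * DZ n \<omega>)"
      using integrable_mult_of_squares[OF _ _ H2 H2Z] integrable_mult_of_squares[OF _ _ iDY H2Z]
        integrable_mult_of_squares[OF _ _ iDZ H2] integrable_mult_of_squares[OF _ _ iDY iDZ]
      by simp
    finally show ?thesis .
  qed
  moreover have "expectation (\<lambda>\<omega>. poly (S n) (Y \<omega>) * poly (S n) (Z \<omega>)) = (\<Sum>q\<le>n. fact q * (c q)\<^sup>2 * r ^ q)" for n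
  proof -
    have "expectation (\<lambda>\<omega>. poly (S n) (Y \<omega>) * poly (S n) (Z \<omega>)) = pair_expectation (S n) (S n)" by (simp add: pair_expectation_def)
    also have "\<dots> = (\<Sum>q\<le>n. \<Sum>p\<le>n. c q * (c p * (if p = q then fact p * r ^ p else 0)))"
      by (simp add: S_def pair_expectation_sum_left pair_expectation_sum_right pair_expectation_smult_left pair_expectation_smult_right pair_expectation_hermite_poly sum_distrib_left)
    also have "\<dots> = (\<Sum>q\<le>n. fact q * (c q)\<^sup>2 * r ^ q)"
      by (intro sum.cong refl) (simp add: if_distrib[of "(*) _"] power2_eq_square mult_ac cong: if_cong)
    finally show ?thesis .
  qed
  ultimately have "(\<lambda>n. \<Sum>q\<le>n. fact q * (c q)\<^sup>2 * r ^ q) = (\<lambda>n. expectation (\<lambda>\<omega>. H (Y \<omega>) * H (Z \<omega>)) -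
      expectation (\<lambda>\<omega>. DY n \<omega> * H (Z \<omega>)) - expectation (\<lambda>\<omega>. DZ n \<omega> * H (Y \<omega>)) +
      expectation (\<lambda>\<omega>. DY n \<omega> * DZ n \<omega>))" by simp
  moreover have "\<dots> \<longlonglongrightarrow> expectation (\<lambda>\<omega>. H (Y \<omega>) * H (Z \<omega>)) - 0 - 0 + 0"
    by (intro tendsto_intros 1 2 3)
  ultimately show ?thesis by (simp add: sums_def_le)
qed

text \<open>\<open>hermite_rank\<close> is silent about index 0; centering settles it. Every
  truncation has expectation \<open>c 0\<close>, so |c 0| is at most its distance to the centered
  H(Y) in mean square.\<close>

lemma hermite_coefficient_0:
  fixes H :: "real \<Rightarrow> real"
  assumes [measurable]: "H \<in> borel_measurable borel" and H2: "integrable M (\<lambda>\<omega>. (H (Y \<omega>))\<^sup>2)"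
    and exp: "hermite_expansion H c" and EH: "expectation (\<lambda>\<omega>. H (Y \<omega>)) = 0"
  shows "c 0 = 0"
proof -
  define S where "S n = (\<Sum>q\<le>n. smult (c q) (hermite_poly q))" for n
  have mp [measurable]: "poly f \<in> borel_measurable borel" for f :: "real poly"
    by (intro borel_measurable_continuous_onI continuous_intros)
  have H1: "integrable M (\<lambda>\<omega>. H (Y \<omega>))"
    using integrable_mult_of_squares[of "\<lambda>\<omega>. H (Y \<omega>)" M "\<lambda>_. 1"] H2 by simp
  have "\<bar>c 0\<bar> \<le> sqrt (expectation (\<lambda>\<omega>. (H (Y \<omega>) - poly (S n) (Y \<omega>))\<^sup>2))" for n
  proof -
    have "expectation (\<lambda>\<omega>. poly (S n) (Y \<omega>)) = pair_expectation (S n) 1" by (simp add: pair_expectation_def)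
    also have "\<dots> = c 0"
      by (simp add: S_def pair_expectation_sum_left pair_expectation_smult_left pair_expectation_hermite_poly_1 if_distrib[of "(*) _"] cong: if_cong)
    finally have "expectation (\<lambda>\<omega>. (H (Y \<omega>) - poly (S n) (Y \<omega>)) * 1) = - c 0"
      using H1 integrable_poly[of "S n" 1] EH by simp
    moreover have "integrable M (\<lambda>\<omega>. (H (Y \<omega>) - poly (S n) (Y \<omega>))\<^sup>2)"
      unfolding S_def by (rule hermite_expansion_L2[OF assms(1-3)])
    ultimately show ?thesis
      using Cauchy_Schwarz_integral[of "\<lambda>\<omega>. H (Y \<omega>) - poly (S n) (Y \<omega>)" M "\<lambda>_. 1"] by (simp add: prob_space)
  qed
  moreover have "(\<lambda>n. sqrt (expectation (\<lambda>\<omega>. (H (Y \<omega>) - poly (S n) (Y \<omega>))\<^sup>2))) \<longlonglongrightarrow> 0"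
    unfolding S_def using tendsto_real_sqrt[OF hermite_expansion_L2(2)[OF assms(1-3)]] by simp
  ultimately have "\<bar>c 0\<bar> \<le> 0" by (intro LIMSEQ_le_const) auto
  then show ?thesis by simp
qed

text \<open>Nonzero terms have q \<ge> m, and |r| \<le> 1, so |r|^m can be pulled out of the series;
  the rest is the Parseval series for the variance.\<close>

lemma hermite_rank_covariance_bound:
  fixes H :: "real \<Rightarrow> real"
  assumes [measurable]: "H \<in> borel_measurable borel" and H2: "integrable M (\<lambda>\<omega>. (H (Y \<omega>))\<^sup>2)"
    and exp: "hermite_expansion H c" and EH: "expectation (\<lambda>\<omega>. H (Y \<omega>)) = 0" and rank: "hermite_rank c m"
  shows "\<bar>expectation (\<lambda>\<omega>. H (Y \<omega>) * H (Z \<omega>))\<bar> \<le> \<bar>r\<bar> ^ m * expectation (\<lambda>\<omega>. (H (Y \<omega>))\<^sup>2)"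
proof -
  have yy: "(\<lambda>q. fact q * (c q)\<^sup>2) sums expectation (\<lambda>\<omega>. (H (Y \<omega>))\<^sup>2)"
    using gaussian_pair.hermite_expansion_sums[OF diagonal assms(1) H2 exp] by (simp add: power2_eq_square)
  have yz: "(\<lambda>q. fact q * (c q)\<^sup>2 * r ^ q) sums expectation (\<lambda>\<omega>. H (Y \<omega>) * H (Z \<omega>))"
    by (rule hermite_expansion_sums[OF assms(1-3)])
  have le: "\<bar>fact q * (c q)\<^sup>2 * r ^ q\<bar> \<le> \<bar>r\<bar> ^ m * (fact q * (c q)\<^sup>2)" for q
  proof (cases "q < m")
    case True
    then have "c q = 0"
      using rank hermite_coefficient_0[OF assms(1-4)] by (cases "q = 0") (auto simp: hermite_rank_def)
    then show ?thesis by simp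
  next
    case False
    then have "\<bar>r\<bar> ^ q \<le> \<bar>r\<bar> ^ m" using abs_r_le_1 by (intro power_decreasing) auto
    from mult_right_mono[OF this, of "fact q * (c q)\<^sup>2"] show ?thesis
      by (simp add: abs_mult power_abs mult_ac)
  qed
  have s: "summable (\<lambda>q. \<bar>r\<bar> ^ m * (fact q * (c q)\<^sup>2))" using yy by (simp add: sums_iff)
  have "\<bar>\<Sum>q. fact q * (c q)\<^sup>2 * r ^ q\<bar> \<le> (\<Sum>q. \<bar>r\<bar> ^ m * (fact q * (c q)\<^sup>2))"
    using norm_suminf_le[of "\<lambda>q. fact q * (c q)\<^sup>2 * r ^ q" "\<lambda>q. \<bar>r\<bar> ^ m * (fact q * (c q)\<^sup>2)"] le s by simp
  then show ?thesis using yy yz by (simp add: sums_iff suminf_mult)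
qed

end

section \<open>Stationarity and second moments of linear combinations\<close>

text \<open>Translation by j carries the pair (j, k) to (0, k - j). One-point quantities are covered
  by a g that ignores its second argument.\<close>

lemma
  fixes X :: "int ^ 'n \<Rightarrow> 'w \<Rightarrow> real"
  assumes stat: "stationary_field M X" and X [measurable]: "\<And>j. X j \<in> borel_measurable M"
    and g [measurable]: "(\<lambda>x. g (fst x) (snd x)) \<in> borel_measurable (borel \<Otimes>\<^sub>M borel)"
  shows stationary_field_expectation: "(\<integral>\<omega>. g (X j \<omega>) (X k \<omega>) \<partial>M) = (\<integral>\<omega>. (g (X 0 \<omega>) (X (k - j) \<omega>) :: real) \<partial>M)"
    and stationary_field_integrable:
      "integrable M (\<lambda>\<omega>. g (X j \<omega>) (X k \<omega>)) \<longleftrightarrow> integrable M (\<lambda>\<omega>. g (X 0 \<omega>) (X (k - j) \<omega>))"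
proof -
  let ?P = "Pi\<^sub>M UNIV (\<lambda>_. borel) :: (int ^ 'n \<Rightarrow> real) measure"
  let ?g = "\<lambda>x :: int ^ 'n \<Rightarrow> real. g (x 0) (x (k - j))"
  have [measurable]: "(\<lambda>\<omega> i. X (i + v) \<omega>) \<in> measurable M ?P" for v
    by (intro measurable_PiM_single') auto
  have [measurable]: "(\<lambda>\<omega> i. X i \<omega>) \<in> measurable M ?P"
    by (intro measurable_PiM_single') auto
  have "?g \<in> borel_measurable ?P"
    using measurable_compose[of "\<lambda>x. (x 0, x (k - j))" ?P "borel \<Otimes>\<^sub>M borel" "\<lambda>x. g (fst x) (snd x)" borel]
    by simp
  then have [measurable]: "?g \<in> borel_measurable ?P" .
  have d: "distr M ?P (\<lambda>\<omega> i. X (i + j) \<omega>) = distr M ?P (\<lambda>\<omega> i. X i \<omega>)"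
    using stat unfolding stationary_field_def by blast
  have "(\<integral>\<omega>. g (X j \<omega>) (X k \<omega>) \<partial>M) = (\<integral>x. ?g x \<partial>distr M ?P (\<lambda>\<omega> i. X (i + j) \<omega>))"
    by (subst integral_distr) auto
  also have "\<dots> = (\<integral>\<omega>. g (X 0 \<omega>) (X (k - j) \<omega>) \<partial>M)"
    unfolding d by (subst integral_distr) auto
  finally show "(\<integral>\<omega>. g (X j \<omega>) (X k \<omega>) \<partial>M) = (\<integral>\<omega>. g (X 0 \<omega>) (X (k - j) \<omega>) \<partial>M)" .
  have "integrable M (\<lambda>\<omega>. g (X j \<omega>) (X k \<omega>)) \<longleftrightarrow> integrable (distr M ?P (\<lambda>\<omega> i. X (i + j) \<omega>)) ?g"
    by (subst integrable_distr_eq) auto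
  also have "\<dots> \<longleftrightarrow> integrable M (\<lambda>\<omega>. g (X 0 \<omega>) (X (k - j) \<omega>))"
    unfolding d by (subst integrable_distr_eq) auto
  finally show "integrable M (\<lambda>\<omega>. g (X j \<omega>) (X k \<omega>)) \<longleftrightarrow> integrable M (\<lambda>\<omega>. g (X 0 \<omega>) (X (k - j) \<omega>))" .
qed

section \<open>The random distributions\<close>

lemma gaussian_field_pair:
  fixes X :: "int ^ 'n \<Rightarrow> 'w \<Rightarrow> real"
  assumes prob: "prob_space M" and gauss: "gaussian_field M X" and stat: "stationary_field M X"
    and mean: "(\<integral>\<omega>. X 0 \<omega> \<partial>M) = 0" and var: "(\<integral>\<omega>. (X 0 \<omega>)\<^sup>2 \<partial>M) = 1"
  shows "gaussian_pair M (X j) (X k) (\<integral>\<omega>. X 0 \<omega> * X (k - j) \<omega> \<partial>M)"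
proof -
  interpret prob_space M by (rule prob)
  have X [measurable]: "X i \<in> borel_measurable M" for i using gauss by (simp add: gaussian_field_def)
  have comb: "gaussian_var M (\<lambda>\<omega>. \<Sum>i\<in>J. a i * X i \<omega>)" if "finite J" for J a
    using gauss that by (simp add: gaussian_field_def)
  show ?thesis
  proof unfold_locales
    fix a b :: real
    show "gaussian_var M (\<lambda>\<omega>. a * X j \<omega> + b * X k \<omega>)"
    \<comment> \<open>For equal indices the finite index set is a singleton, so the two coefficients
      must be added.\<close>
    proof (cases "j = k")
      case True
      then show ?thesis using comb[of "{j}" "\<lambda>_. a + b"] by (simp add: distrib_right)
    next
      case False
      then show ?thesis using comb[of "{j, k}" "\<lambda>i. if i = j then a else b"] by simp
    qed
    show "expectation (X j) = 0" "expectation (X k) = 0"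
      using stationary_field_expectation[OF stat X, of "\<lambda>x y. x"] mean by simp_all
    show "expectation (\<lambda>\<omega>. (X j \<omega>)\<^sup>2) = 1" "expectation (\<lambda>\<omega>. (X k \<omega>)\<^sup>2) = 1"
      using stationary_field_expectation[OF stat X, of "\<lambda>x y. x\<^sup>2"] var by simp_all
    show "expectation (\<lambda>\<omega>. X j \<omega> * X k \<omega>) = (\<integral>\<omega>. X 0 \<omega> * X (k - j) \<omega> \<partial>M)"
      using stationary_field_expectation[OF stat X, of "\<lambda>x y. x * y" j k] by simp
  qed auto
qed

text \<open>A Schur test: bound |a_j a_k| by half the sum of squares. With one index fixed, the
  differences k - j are distinct, so the sum of b over them is at most the full sum, whatever J
  is.\<close>

lemma linear_combination_second_moment:
  fixes V :: "'i :: ab_group_add \<Rightarrow> 'w \<Rightarrow> real"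
  assumes i: "\<And>j k. integrable M (\<lambda>\<omega>. V j \<omega> * V k \<omega>)"
    and cov: "\<And>j k. \<bar>\<integral>\<omega>. V j \<omega> * V k \<omega> \<partial>M\<bar> \<le> b (k - j) * s"
    and b: "b summable_on UNIV" "\<And>u. 0 \<le> b u" and s: "0 \<le> s" and J: "finite J"
  shows "integrable M (\<lambda>\<omega>. (\<Sum>j\<in>J. a j * V j \<omega>)\<^sup>2)"
    and "(\<integral>\<omega>. (\<Sum>j\<in>J. a j * V j \<omega>)\<^sup>2 \<partial>M) \<le> s * (\<Sum>\<^sub>\<infinity>u. b u) * (\<Sum>j\<in>J. (a j)\<^sup>2)"
proof -
  let ?R = "\<Sum>\<^sub>\<infinity>u. b u"
  have sq: "(\<Sum>j\<in>J. a j * V j \<omega>)\<^sup>2 = (\<Sum>j\<in>J. \<Sum>k\<in>J. a j * a k * (V j \<omega> * V k \<omega>))" for \<omega>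
    by (simp add: power2_eq_square sum_product mult_ac)
  show "integrable M (\<lambda>\<omega>. (\<Sum>j\<in>J. a j * V j \<omega>)\<^sup>2)" unfolding sq using i by simp
  have bsum: "(\<Sum>k\<in>J. b (h k)) \<le> ?R" if "inj_on h J" for h
  proof -
    have "(\<Sum>k\<in>J. b (h k)) = sum b (h ` J)" using that by (simp add: sum.reindex)
    also have "\<dots> \<le> ?R" by (rule finite_sum_le_infsum) (use b J in auto)
    finally show ?thesis .
  qed
  have "(\<integral>\<omega>. (\<Sum>j\<in>J. a j * V j \<omega>)\<^sup>2 \<partial>M) = (\<Sum>j\<in>J. \<Sum>k\<in>J. a j * a k * (\<integral>\<omega>. V j \<omega> * V k \<omega> \<partial>M))"
    unfolding sq using i by simp
  also have "\<dots> \<le> (\<Sum>j\<in>J. \<Sum>k\<in>J. ((a j)\<^sup>2 / 2) * (b (k - j) * s) + ((a k)\<^sup>2 / 2) * (b (k - j) * s))"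
  proof (intro sum_mono)
    fix j k
    have ab: "\<bar>a j * a k\<bar> \<le> (a j)\<^sup>2 / 2 + (a k)\<^sup>2 / 2"
      using sum_squares_bound[of "\<bar>a j\<bar>" "\<bar>a k\<bar>"] by (simp add: abs_mult)
    have "a j * a k * (\<integral>\<omega>. V j \<omega> * V k \<omega> \<partial>M) \<le> \<bar>a j * a k\<bar> * \<bar>\<integral>\<omega>. V j \<omega> * V k \<omega> \<partial>M\<bar>"
      by (simp flip: abs_mult)
    also have "\<dots> \<le> ((a j)\<^sup>2 / 2 + (a k)\<^sup>2 / 2) * (b (k - j) * s)"
      by (intro mult_mono ab cov) auto
    finally show "a j * a k * (\<integral>\<omega>. V j \<omega> * V k \<omega> \<partial>M) \<le>
        ((a j)\<^sup>2 / 2) * (b (k - j) * s) + ((a k)\<^sup>2 / 2) * (b (k - j) * s)" by (simp add: distrib_right)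
  qed
  also have "\<dots> = (\<Sum>j\<in>J. (a j)\<^sup>2 / 2 * s * (\<Sum>k\<in>J. b (k - j))) + (\<Sum>k\<in>J. (a k)\<^sup>2 / 2 * s * (\<Sum>j\<in>J. b (k - j)))"
    unfolding sum.distrib sum.swap[of "\<lambda>j k. (a k)\<^sup>2 / 2 * (b (k - j) * s)"]
    by (simp add: sum_distrib_left sum_divide_distrib mult_ac)
  also have "\<dots> \<le> (\<Sum>j\<in>J. (a j)\<^sup>2 / 2 * s * ?R) + (\<Sum>k\<in>J. (a k)\<^sup>2 / 2 * s * ?R)"
    by (intro add_mono sum_mono mult_left_mono bsum) (auto simp: s inj_on_def)
  also have "\<dots> = s * ?R * (\<Sum>j\<in>J. (a j)\<^sup>2)"
    by (simp add: sum_distrib_left field_simps flip: sum.distrib)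
  finally show "(\<integral>\<omega>. (\<Sum>j\<in>J. a j * V j \<omega>)\<^sup>2 \<partial>M) \<le> s * ?R * (\<Sum>j\<in>J. (a j)\<^sup>2)" .
qed

text \<open>Only after exchanging the sums over k and j does a bound appear, as every point then
  contributes \<open>eval_const\<close>. \<Psi> enters through its values on the basis alone, so a
  functional on the space of one order can be measured in the norm of another.\<close>

lemma (in sobolev_scale) nn_integral_dual_norm2_le:
  fixes p :: "'i \<Rightarrow> real ^ 'n" and V :: "'i \<Rightarrow> 'w \<Rightarrow> real"
  assumes \<Psi>: "\<And>\<omega> k. \<Psi> \<omega> (\<phi> k) = (\<Sum>j\<in>J. c * V j \<omega> * \<phi> k (p j))"
    and p: "p ` J \<subseteq> unit_cube" and V [measurable]: "\<And>j. V j \<in> borel_measurable M"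
    and i: "\<And>a. integrable M (\<lambda>\<omega>. (\<Sum>j\<in>J. a j * V j \<omega>)\<^sup>2)"
    and bd: "\<And>a. (\<integral>\<omega>. (\<Sum>j\<in>J. a j * V j \<omega>)\<^sup>2 \<partial>M) \<le> C * (\<Sum>j\<in>J. (a j)\<^sup>2)"
    and C: "0 \<le> C"
  shows "(\<lambda>\<omega>. dual_norm2 \<phi> lam \<alpha> (\<Psi> \<omega>)) \<in> borel_measurable M"
    and "(\<integral>\<^sup>+\<omega>. dual_norm2 \<phi> lam \<alpha> (\<Psi> \<omega>) \<partial>M) \<le> ennreal (C * c\<^sup>2 * real (card J) * eval_const)"
proof -
  let ?F = "\<lambda>k \<omega>. (\<Sum>j\<in>J. (c * \<phi> k (p j)) * V j \<omega>)\<^sup>2"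
  have eq: "dual_norm2 \<phi> lam \<alpha> (\<Psi> \<omega>) = (\<Sum>k. ennreal (wt' k * ?F k \<omega>))" for \<omega>
    by (simp add: dual_norm2_def \<Psi> mult_ac)
  show "(\<lambda>\<omega>. dual_norm2 \<phi> lam \<alpha> (\<Psi> \<omega>)) \<in> borel_measurable M" unfolding eq by measurable
  have "(\<integral>\<^sup>+\<omega>. dual_norm2 \<phi> lam \<alpha> (\<Psi> \<omega>) \<partial>M) = (\<Sum>k. \<integral>\<^sup>+\<omega>. ennreal (wt' k * ?F k \<omega>) \<partial>M)"
    unfolding eq by (rule nn_integral_suminf) measurable
  also have "\<dots> = (\<Sum>k. ennreal (wt' k * (\<integral>\<omega>. ?F k \<omega> \<partial>M)))"
    using i by (subst nn_integral_eq_integral) auto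
  also have "\<dots> \<le> ennreal (C * c\<^sup>2 * real (card J) * eval_const)"
  proof (rule suminf_le_const[OF summableI])
    fix n
    have "(\<Sum>k<n. wt' k * (\<integral>\<omega>. ?F k \<omega> \<partial>M)) \<le> (\<Sum>k<n. wt' k * (C * (\<Sum>j\<in>J. (c * \<phi> k (p j))\<^sup>2)))"
      by (intro sum_mono mult_left_mono bd) auto
    also have "\<dots> = (\<Sum>k<n. \<Sum>j\<in>J. C * c\<^sup>2 * (wt' k * (\<phi> k (p j))\<^sup>2))"
      by (simp add: sum_distrib_left power_mult_distrib mult_ac)
    also have "\<dots> = (\<Sum>j\<in>J. C * c\<^sup>2 * (\<Sum>k<n. wt' k * (\<phi> k (p j))\<^sup>2))"
      by (subst sum.swap) (simp only: sum_distrib_left)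
    also have "\<dots> \<le> (\<Sum>j\<in>J. C * c\<^sup>2 * eval_const)"
      using p C by (intro sum_mono mult_left_mono weighted_sum_le_eval_const) auto
    finally have "(\<Sum>k<n. wt' k * (\<integral>\<omega>. ?F k \<omega> \<partial>M)) \<le> C * c\<^sup>2 * real (card J) * eval_const"
      by (simp add: mult_ac)
    then show "(\<Sum>k<n. ennreal (wt' k * (\<integral>\<omega>. ?F k \<omega> \<partial>M))) \<le> ennreal (C * c\<^sup>2 * real (card J) * eval_const)"
      by (subst sum_ennreal) (auto intro: ennreal_leI)
  qed
  finally show "(\<integral>\<^sup>+\<omega>. dual_norm2 \<phi> lam \<alpha> (\<Psi> \<omega>) \<partial>M) \<le> ennreal (C * c\<^sup>2 * real (card J) * eval_const)" .
qed

lemma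
  fixes N :: nat
  shows finite_lattice_box: "finite (lattice_box N :: (int ^ 'n) set)"
    and card_lattice_box_le: "card (lattice_box N :: (int ^ 'n) set) \<le> (N + 1) ^ CARD('n)"
proof -
  \<comment> \<open>An integer of absolute value at most N/2 has absolute value at most N div 2,
    which leaves 2 (N div 2) + 1 \<le> N + 1 values per coordinate.\<close>
  let ?I = "{- int (N div 2) .. int (N div 2)}"
  have sub: "(lattice_box N :: (int ^ 'n) set) \<subseteq> (\<lambda>f. \<chi> i. f i) ` (PiE UNIV (\<lambda>_. ?I))"
  proof
    fix j :: "int ^ 'n" assume j: "j \<in> lattice_box N"
    have "j $ i \<in> ?I" for i
    proof -
      have "\<bar>real_of_int (j $ i)\<bar> * 2 \<le> real N" using j by (simp add: lattice_box_def)
      then have "real_of_int (\<bar>j $ i\<bar> * 2) \<le> real_of_int (int N)" by simp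
      then have "\<bar>j $ i\<bar> * 2 \<le> int N" by (simp only: of_int_le_iff)
      then show ?thesis by auto
    qed
    then have "(\<lambda>i. j $ i) \<in> PiE UNIV (\<lambda>_. ?I)" by auto
    moreover have "j = (\<chi> i. j $ i)" by simp
    ultimately show "j \<in> (\<lambda>f. \<chi> i. f i) ` (PiE UNIV (\<lambda>_. ?I))" by (metis (no_types) imageI)
  qed
  have fin: "finite (PiE (UNIV :: 'n set) (\<lambda>_. ?I))" by (simp add: finite_PiE)
  show "finite (lattice_box N :: (int ^ 'n) set)" by (rule finite_subset[OF sub]) (use fin in simp)
  have "card (lattice_box N :: (int ^ 'n) set) \<le> card (PiE (UNIV :: 'n set) (\<lambda>_. ?I))"
    using card_mono[OF finite_imageI[OF fin] sub] card_image_le[OF fin] by (rule order_trans)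
  also have "\<dots> = card ?I ^ CARD('n)" by (simp add: card_PiE)
  also have "\<dots> \<le> (N + 1) ^ CARD('n)" by (intro power_mono) auto
  finally show "card (lattice_box N :: (int ^ 'n) set) \<le> (N + 1) ^ CARD('n)" .
qed

lemma lattice_point_in_unit_cube:
  assumes "j \<in> lattice_box N" "0 < N"
  shows "(\<chi> i. real_of_int (j $ i) / real N) \<in> unit_cube"
  using assms by (auto simp: mem_unit_cube lattice_box_def field_simps)

lemma (in sobolev_scale) scaled_distribution_eq_point_functional:
  "scaled_distribution \<phi> lam \<alpha> H X N \<omega> =
     point_functional (lattice_box N) (\<lambda>j. \<chi> i. real_of_int (j $ i) / real N)
       (\<lambda>j. real N powr (real CARD('n) / 2) / real N ^ CARD('n) * H (X j \<omega>))"
  unfolding scaled_distribution_def point_functional_def random_distribution_def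
  by (simp add: sum_distrib_left mult.assoc)

lemma (in prob_space) prob_le_nn_integral_Markov:
  assumes u [measurable]: "u \<in> borel_measurable M" and b: "(\<integral>\<^sup>+\<omega>. u \<omega> \<partial>M) \<le> ennreal b"
    and "0 \<le> b" "0 < R"
  shows "prob {\<omega> \<in> space M. u \<omega> \<le> ennreal R} \<ge> 1 - b / R"
proof -
  have "emeasure M {\<omega> \<in> space M. \<not> u \<omega> \<le> ennreal R} \<le> emeasure M {\<omega> \<in> space M. 1 \<le> ennreal (1 / R) * u \<omega>}"
  proof (intro emeasure_mono subsetI)
    fix \<omega> assume \<omega>: "\<omega> \<in> {\<omega> \<in> space M. \<not> u \<omega> \<le> ennreal R}"
    have "1 = ennreal (1 / R) * ennreal R" using \<open>0 < R\<close> by (simp flip: ennreal_mult)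
    also have "\<dots> \<le> ennreal (1 / R) * u \<omega>" using \<omega> by (intro mult_left_mono) auto
    finally show "\<omega> \<in> {\<omega> \<in> space M. 1 \<le> ennreal (1 / R) * u \<omega>}" using \<omega> by simp
  qed measurable
  also have "\<dots> \<le> ennreal (1 / R) * (\<integral>\<^sup>+\<omega>. u \<omega> * indicator (space M) \<omega> \<partial>M)"
    by (rule nn_integral_Markov_inequality) auto
  also have "(\<integral>\<^sup>+\<omega>. u \<omega> * indicator (space M) \<omega> \<partial>M) = (\<integral>\<^sup>+\<omega>. u \<omega> \<partial>M)"
    by (intro nn_integral_cong) auto
  also have "ennreal (1 / R) * (\<integral>\<^sup>+\<omega>. u \<omega> \<partial>M) \<le> ennreal (1 / R) * ennreal b"
    by (intro mult_left_mono b) auto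
  also have "\<dots> = ennreal (b / R)" using assms by (simp flip: ennreal_mult)
  finally have "prob {\<omega> \<in> space M. \<not> u \<omega> \<le> ennreal R} \<le> b / R"
    using assms by (simp add: emeasure_eq_measure)
  moreover have "prob {\<omega> \<in> space M. \<not> u \<omega> \<le> ennreal R} = 1 - prob {\<omega> \<in> space M. u \<omega> \<le> ennreal R}"
    by (rule prob_neg) measurable
  ultimately show ?thesis by simp
qed

section \<open>Moment bound, tightness and finiteness of the constant\<close>

theorem lemma4:
  fixes M :: "'w measure"
    and X :: "int ^ 'n \<Rightarrow> 'w \<Rightarrow> real"
    and \<rho> :: "int ^ 'n \<Rightarrow> real"
    and H :: "real \<Rightarrow> real"
    and c :: "nat \<Rightarrow> real"
    and m :: nat
    and \<phi> :: "nat \<Rightarrow> real ^ 'n \<Rightarrow> real"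
    and lam :: "nat \<Rightarrow> real"
  assumes dim: "CARD('n) \<ge> 2"
    and prob: "prob_space M"
    and gauss: "gaussian_field M X"
    and stat: "stationary_field M X"
    and mean: "(\<integral>\<omega>. X 0 \<omega> \<partial>M) = 0"
    and var: "(\<integral>\<omega>. (X 0 \<omega>)\<^sup>2 \<partial>M) = 1"
    and cov: "\<And>u. \<rho> u = (\<integral>\<omega>. X 0 \<omega> * X u \<omega> \<partial>M)"
    and H_meas: "H \<in> borel_measurable borel"
    and H_L2: "integrable M (\<lambda>\<omega>. (H (X 0 \<omega>))\<^sup>2)"
    and H_mean: "(\<integral>\<omega>. H (X 0 \<omega>) \<partial>M) = 0"
    and expansion: "hermite_expansion H c"
    and rank: "hermite_rank c m"
    and rho_sum: "(\<lambda>u. \<bar>\<rho> u\<bar> ^ m) summable_on UNIV"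
    and basis: "dirichlet_eigenbasis \<phi> lam"
  shows "(\<forall>\<alpha> > real CARD('n) / 2.
            (SUP N\<in>{2..}. \<integral>\<^sup>+\<omega>. dual_norm2 \<phi> lam \<alpha> (scaled_distribution \<phi> lam \<alpha> H X N \<omega>) \<partial>M) < \<infinity>) \<and>
         (\<forall>\<alpha> > real CARD('n) / 2.
            tight_family (dual_topology \<phi> lam \<alpha>) M {2..} (scaled_distribution \<phi> lam \<alpha> H X)) \<and>
         (\<forall>q\<ge>m. (\<lambda>u. \<rho> u ^ q) summable_on UNIV) \<and>
         (\<lambda>q. fact q * (c q)\<^sup>2 * (\<Sum>\<^sub>\<infinity>u\<in>UNIV. \<rho> u ^ q)) summable_on {m..}"
proof -
  interpret prob_space M by (rule prob)
  note H_meas [measurable]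
  have X [measurable]: "X j \<in> borel_measurable M" for j using gauss by (simp add: gaussian_field_def)
  have pair: "gaussian_pair M (X j) (X k) (\<rho> (k - j))" for j k
    unfolding cov by (rule gaussian_field_pair[OF prob gauss stat mean var])
  define s where "s = expectation (\<lambda>\<omega>. (H (X 0 \<omega>))\<^sup>2)"
  define R where "R = (\<Sum>\<^sub>\<infinity>u. \<bar>\<rho> u\<bar> ^ m)"
  have s0: "0 \<le> s" by (simp add: s_def)
  have R0: "0 \<le> R" unfolding R_def by (rule infsum_nonneg) simp
  have L2: "integrable M (\<lambda>\<omega>. (H (X j \<omega>))\<^sup>2)" "expectation (\<lambda>\<omega>. (H (X j \<omega>))\<^sup>2) = s"
    "expectation (\<lambda>\<omega>. H (X j \<omega>)) = 0" for j
    using stationary_field_integrable[OF stat X, of "\<lambda>x y. (H x)\<^sup>2" j]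
      stationary_field_expectation[OF stat X, of "\<lambda>x y. (H x)\<^sup>2" j]
      stationary_field_expectation[OF stat X, of "\<lambda>x y. H x" j] H_L2 H_mean
    by (simp_all add: s_def)
  have covH: "\<bar>expectation (\<lambda>\<omega>. H (X j \<omega>) * H (X k \<omega>))\<bar> \<le> \<bar>\<rho> (k - j)\<bar> ^ m * s" for j k
    using gaussian_pair.hermite_rank_covariance_bound[OF pair H_meas L2(1) expansion L2(3) rank, of j k]
    by (simp add: L2)
  have intH: "integrable M (\<lambda>\<omega>. H (X j \<omega>) * H (X k \<omega>))" for j k
    by (intro integrable_mult_of_squares L2) measurable
  note second_moment = linear_combination_second_moment[where V = "\<lambda>j \<omega>. H (X j \<omega>)" and b = "\<lambda>u. \<bar>\<rho> u\<bar> ^ m",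
    OF intH covH rho_sum _ s0, folded R_def, simplified]

  \<comment> \<open>The power of 2 comes from (N + 1)^d \<le> (2N)^d points against the squared
    normalization N^-d.\<close>
  define B where "B \<alpha> = s * R * 2 ^ CARD('n) * sobolev_scale.eval_const \<phi> lam \<alpha>" for \<alpha>
  let ?p = "\<lambda>N (j :: int ^ 'n). (\<chi> i. real_of_int (j $ i) / real N) :: real ^ 'n"
  let ?Y = "\<lambda>\<alpha>. scaled_distribution \<phi> lam \<alpha> H X"
  have scale: "sobolev_scale \<phi> lam \<alpha>" if "\<alpha> > real CARD('n) / 2" for \<alpha>
    using basis that by unfold_locales
  have p: "?p N ` lattice_box N \<subseteq> unit_cube" if "2 \<le> N" for N
    using lattice_point_in_unit_cube that by fastforce
  \<comment> \<open>\<beta> is the order of the space on which the functional lives, \<alpha> that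
    of the norm measuring it; tightness takes them different.\<close>
  have moment: "(\<lambda>\<omega>. dual_norm2 \<phi> lam \<alpha> (?Y \<beta> N \<omega>)) \<in> borel_measurable M"
      "(\<integral>\<^sup>+\<omega>. dual_norm2 \<phi> lam \<alpha> (?Y \<beta> N \<omega>) \<partial>M) \<le> ennreal (B \<alpha>)"
    if \<alpha>: "\<alpha> > real CARD('n) / 2" and \<beta>: "\<beta> > real CARD('n) / 2" and N: "2 \<le> N" for \<alpha> \<beta> N
  proof -
    interpret A: sobolev_scale \<phi> lam \<alpha> by (rule scale[OF \<alpha>])
    interpret B: sobolev_scale \<phi> lam \<beta> by (rule scale[OF \<beta>])
    let ?c = "real N powr (real CARD('n) / 2) / real N ^ CARD('n)"
    have Y: "?Y \<beta> N \<omega> (\<phi> k) = (\<Sum>j\<in>lattice_box N. ?c * H (X j \<omega>) * \<phi> k (?p N j))" for \<omega> k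
      by (simp only: B.scaled_distribution_eq_point_functional B.point_functional_phi)
    note * = A.nn_integral_dual_norm2_le[where V = "\<lambda>j \<omega>. H (X j \<omega>)" and C = "s * R" and M = M,
        OF Y p[OF N] _ second_moment[OF finite_lattice_box] mult_nonneg_nonneg[OF s0 R0]]
    show "(\<lambda>\<omega>. dual_norm2 \<phi> lam \<alpha> (?Y \<beta> N \<omega>)) \<in> borel_measurable M"
      by (rule *(1)) measurable
    have "(\<integral>\<^sup>+\<omega>. dual_norm2 \<phi> lam \<alpha> (?Y \<beta> N \<omega>) \<partial>M) \<le>
        ennreal (s * R * ?c\<^sup>2 * real (card (lattice_box N :: (int ^ 'n) set)) * A.eval_const)"
      by (rule *(2)) measurable
    also have "\<dots> \<le> ennreal (B \<alpha>)"
    proof (rule ennreal_leI)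
      have "?c\<^sup>2 = 1 / real N ^ CARD('n)"
        using N by (simp add: power_divide power2_eq_square powr_add[symmetric] powr_realpow)
      moreover have "real (card (lattice_box N :: (int ^ 'n) set)) \<le> 2 ^ CARD('n) * real N ^ CARD('n)"
      proof -
        have "real (card (lattice_box N :: (int ^ 'n) set)) \<le> real ((N + 1) ^ CARD('n))"
          using card_lattice_box_le by (simp only: of_nat_le_iff)
        also have "\<dots> \<le> real ((2 * N) ^ CARD('n))" using N by (intro of_nat_mono power_mono) auto
        finally show ?thesis by (simp add: power_mult_distrib)
      qed
      ultimately have "?c\<^sup>2 * real (card (lattice_box N :: (int ^ 'n) set)) \<le> 2 ^ CARD('n)"
        using N by (simp add: divide_le_eq)
      then have "s * R * A.eval_const * (?c\<^sup>2 * real (card (lattice_box N :: (int ^ 'n) set))) \<le> s * R * A.eval_const * 2 ^ CARD('n)"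
        by (intro mult_left_mono mult_nonneg_nonneg s0 R0 A.eval_const_nonneg)
      then show "s * R * ?c\<^sup>2 * real (card (lattice_box N :: (int ^ 'n) set)) * A.eval_const \<le> B \<alpha>"
        by (simp only: B_def mult_ac)
    qed
    finally show "(\<integral>\<^sup>+\<omega>. dual_norm2 \<phi> lam \<alpha> (?Y \<beta> N \<omega>) \<partial>M) \<le> ennreal (B \<alpha>)" .
  qed

  have "(SUP N\<in>{2..}. \<integral>\<^sup>+\<omega>. dual_norm2 \<phi> lam \<alpha> (?Y \<alpha> N \<omega>) \<partial>M) < \<infinity>"
    if \<alpha>: "\<alpha> > real CARD('n) / 2" for \<alpha>
  proof -
    have "(SUP N\<in>{2..}. \<integral>\<^sup>+\<omega>. dual_norm2 \<phi> lam \<alpha> (?Y \<alpha> N \<omega>) \<partial>M) \<le> ennreal (B \<alpha>)"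
      by (rule SUP_least) (use moment[OF \<alpha> \<alpha>] in auto)
    also have "\<dots> < \<infinity>" by simp
    finally show ?thesis .
  qed
  moreover have "tight_family (dual_topology \<phi> lam \<alpha>) M {2..} (?Y \<alpha>)"
    if \<alpha>: "\<alpha> > real CARD('n) / 2" for \<alpha>
  proof -
    interpret A: sobolev_scale \<phi> lam \<alpha> by (rule scale[OF \<alpha>])
    \<comment> \<open>The midpoint of d/2 and \<alpha>: still in the range of the moment bound, yet
      below \<alpha> as compactness demands.\<close>
    define \<alpha>' where "\<alpha>' = (\<alpha> + real CARD('n) / 2) / 2"
    have \<alpha>': "\<alpha>' > real CARD('n) / 2" "\<alpha>' < \<alpha>" using \<alpha> by (auto simp: \<alpha>'_def)
    interpret A': sobolev_scale \<phi> lam \<alpha>' by (rule scale[OF \<alpha>'(1)])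
    have B0: "0 \<le> B \<alpha>'" unfolding B_def by (intro mult_nonneg_nonneg s0 R0 A'.eval_const_nonneg) auto
    have dual: "?Y \<alpha> N \<omega> \<in> sobolev_dual \<phi> lam \<alpha>" if "2 \<le> N" for N \<omega>
      unfolding A.scaled_distribution_eq_point_functional by (rule A.point_functional_in_dual[OF p[OF that]])
    show ?thesis
      unfolding tight_family_def dual_topology_def
    proof (intro conjI ballI allI impI)
      fix N :: nat assume "N \<in> {2..}"
      then have N: "2 \<le> N" by simp
      show "?Y \<alpha> N \<in> measurable M (sigma (topspace A.dual_metric.mtopology) {U. openin A.dual_metric.mtopology U})"
        using A.measurable_point_functional[OF p[OF N],
            of "\<lambda>\<omega> j. real N powr (real CARD('n) / 2) / real N ^ CARD('n) * H (X j \<omega>)" M]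
        by (simp add: A.scaled_distribution_eq_point_functional[abs_def])
    next
      fix \<epsilon> :: real assume \<epsilon>: "0 < \<epsilon>"
      \<comment> \<open>Markov's inequality leaves probability at most B/r \<le> \<epsilon> outside
        K; the summand 1 makes the radius positive even if the bound is 0.\<close>
      define r where "r = (B \<alpha>' + 1) / \<epsilon>"
      have r: "0 < r" using B0 \<epsilon> by (simp add: r_def)
      define K where "K = {\<Phi> \<in> sobolev_dual \<phi> lam \<alpha>. dual_norm2 \<phi> lam \<alpha>' \<Phi> \<le> ennreal r}"
      have "compactin A.dual_metric.mtopology K"
        unfolding K_def by (rule A.compactin_dual_ball[OF \<alpha>'(2)]) (use r in simp)
      moreover have "1 - \<epsilon> \<le> prob {\<omega> \<in> space M. ?Y \<alpha> N \<omega> \<in> K}" if N: "N \<in> {2..}" for N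
      proof -
        have "1 - B \<alpha>' / r \<le> prob {\<omega> \<in> space M. dual_norm2 \<phi> lam \<alpha>' (?Y \<alpha> N \<omega>) \<le> ennreal r}"
          using N by (intro prob_le_nn_integral_Markov moment \<alpha> \<alpha>' B0 r) auto
        also have "{\<omega> \<in> space M. dual_norm2 \<phi> lam \<alpha>' (?Y \<alpha> N \<omega>) \<le> ennreal r} = {\<omega> \<in> space M. ?Y \<alpha> N \<omega> \<in> K}"
          using dual N by (auto simp: K_def)
        finally have "1 - B \<alpha>' / r \<le> prob {\<omega> \<in> space M. ?Y \<alpha> N \<omega> \<in> K}" .
        moreover have "B \<alpha>' / r \<le> \<epsilon>" using B0 \<epsilon> by (simp add: r_def field_simps)
        ultimately show ?thesis by simp
      qed
      ultimately show "\<exists>K. compactin A.dual_metric.mtopology K \<and>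
          (\<forall>N\<in>{2..}. 1 - \<epsilon> \<le> prob {\<omega> \<in> space M. ?Y \<alpha> N \<omega> \<in> K})" by blast
    qed
  qed
  moreover have rho_le: "\<bar>\<rho> u ^ q\<bar> \<le> \<bar>\<rho> u\<bar> ^ m" if "m \<le> q" for u q
    using gaussian_pair.abs_r_le_1[OF pair, of u 0] that by (simp add: power_abs power_decreasing)
  have rho_q: "(\<lambda>u. \<bar>\<rho> u ^ q\<bar>) summable_on UNIV" if "m \<le> q" for q
    by (rule summable_on_comparison_test[OF rho_sum]) (use rho_le[OF that] in auto)
  have rho_q': "(\<lambda>u. \<rho> u ^ q) summable_on UNIV" if "m \<le> q" for q
    by (rule abs_summable_summable) (use rho_q[OF that] in simp)
  \<comment> \<open>Since |\<rho>| \<le> 1, the sums over u are bounded by R for all q \<ge> m at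
    once; the remaining series q! c_q^2 is Parseval's and has the finite sum s.\<close>
  moreover have "(\<lambda>q. fact q * (c q)\<^sup>2 * (\<Sum>\<^sub>\<infinity>u\<in>UNIV. \<rho> u ^ q)) summable_on {m..}"
  proof (rule abs_summable_summable, rule summable_on_comparison_test)
    have "(\<lambda>q. fact q * (c q)\<^sup>2) sums s"
      using gaussian_pair.hermite_expansion_sums[OF gaussian_pair.diagonal[OF pair] H_meas L2(1) expansion, of 0]
      by (simp add: L2 flip: power2_eq_square)
    then have "summable (\<lambda>q. fact q * (c q)\<^sup>2 * R)" by (intro summable_mult2) (rule sums_summable)
    then have "(\<lambda>q. fact q * (c q)\<^sup>2 * R) summable_on UNIV"
      using R0 by (intro summable_nonneg_imp_summable_on) auto
    then show "(\<lambda>q. fact q * (c q)\<^sup>2 * R) summable_on {m..}"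
      by (rule summable_on_subset_banach) simp
    fix q assume "q \<in> {m..}"
    then have q: "m \<le> q" by simp
    have "\<bar>\<Sum>\<^sub>\<infinity>u. \<rho> u ^ q\<bar> \<le> (\<Sum>\<^sub>\<infinity>u. \<bar>\<rho> u ^ q\<bar>)"
      using norm_infsum_bound[of "\<lambda>u. \<rho> u ^ q" UNIV] rho_q[OF q] by simp
    also have "\<dots> \<le> R"
      unfolding R_def by (rule infsum_mono[OF rho_q[OF q] rho_sum]) (rule rho_le[OF q])
    finally show "norm (fact q * (c q)\<^sup>2 * (\<Sum>\<^sub>\<infinity>u\<in>UNIV. \<rho> u ^ q)) \<le> fact q * (c q)\<^sup>2 * R"
      by (simp add: abs_mult mult_left_mono)
  qed auto
  ultimately show ?thesis by blast
qed

end
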